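(* Let $\mathcal G$ be an ultragraph satisfying the graph-theoretic RFD conditions (B1)--(B4), and let $K$ be a field. Then the ultragraph Leavitt path algebra $L_K(\mathcal G)$ is residually finite-dimensional.
   Context: Ultragraphs. An ultragraph is a quadruple $\mathcal G=(G^0,\mathcal G^1,r,s)$ with $G^0$ a set of vertices, $\mathcal G^1$ a set of edges, $s:\mathcal G^1\to G^0$ and $r:\mathcal G^1\to\mathcal P(G^0)\setminus\{\emptyset\}$. $\mathcal G^0$ is the smallest collection of subsets of $G^0$ containing all singletons $\{v\}$ and all ranges $r(e)$ and closed under finite unions and finite intersections (with $\emptyset\in\mathcal G^0$). A path of length $n\ge1$ is a word $\alpha=e_1\cdots e_n$ of edges with $s(e_{i+1})\in r(e_i)$ for $1\le i<n$; $s(\alpha)=s(e_1)$, $r(\alpha)=r(e_n)$. A vertex $v$ is a sink if $s^{-1}(v)=\emptyset$, and regular if $0<|s^{-1}(v)|<\infty$. For $A\in\mathcal G^0$ let $\varepsilon(A)=\{e\in\mathcal G^1:s(e)\in A\}$; $A$ is an infinite emitter if $|\varepsilon(A)|=\infty$. $A\in\mathcal G^0$ is a minimal infinite emitter if $|\varepsilon(A)|=\infty$ and no proper subset $B\subsetneq A$ with $B\in\mathcal G^0$ is either an infinite emitter or an infinite set with $|\varepsilon(B)|<\infty$. $A\in\mathcal G^0$ is a minimal sink if $|A|=\infty$, $|\varepsilon(A)|<\infty$ and no proper subset $B\subsetneq A$ with $B\in\mathcal G^0$ is infinite. Terminal boundary sets. $\mathcal A\subseteq\mathcal G^0$ is the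 collection of all minimal infinite emitters, all minimal sinks, and all $\{v\}$ with $v$ a sink; its elements are terminal boundary sets. Cycles. A cycle is a path $c=e_1\cdots e_n$, $n\ge1$, with $s(e_1)\in r(e_n)$ and $s(e_1),\dots,s(e_n)$ distinct; the vertices on $c$ are the $s(e_i)$. An exit for $c$ is either an edge $f$ with $s(f)\in r(e_i)$ and $f\ne e_{i+1}$ for some $i$ (indices cyclic), or a sink $w\in r(e_i)$ for some $i$. Graph-theoretic RFD conditions. (B1) No infinite receivers: for every $v\in G^0$ the set $\{e\in\mathcal G^1:v\in r(e)\}$ is finite. (B2) No cycle has an exit. (B3) No infinite backward chains: there is no infinite sequence of distinct edges $e_1,e_2,e_3,\dots$ with $s(e_i)\in r(e_{i+1})$ for all $i\ge1$. (B4) Every $v\in G^0$ reaches a terminal boundary set (i.e. $\{v\}\in\mathcal A$, or there are a path $\alpha$ with $|\alpha|\ge1$, $s(\alpha)=v$, and $A\in\mathcal A$ with $A\subseteq r(\alpha)$) or reaches a cycle (i.e. $v$ lies on a cycle, or there is a path $\alpha$ with $|\alpha|\ge1$, $s(\alpha)=v$, such that $r(\alpha)$ contains a vertex lying on a cycle). Algebra. $L_K(\mathcal G)$ is the universal $K$-algebra generated by $\{s_e,s_e^*:e\in\mathcal G^1\}\cup\{p_A:A\in\mathcal G^0\}$ subject to: $p_\emptyset=0$, $p_Ap_B=p_{A\cap B}$, $p_{A\cup B}=p_A+p_B-p_{A\cap B}$; $p_{s(e)}s_e=s_ep_{r(e)}=s_e$ and $p_{r(e)}s_e^*=s_e^*p_{s(e)}=s_e^*$;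 $s_e^*s_f=\delta_{e,f}p_{r(e)}$; $p_v=\sum_{s(e)=v}s_es_e^*$ for every regular vertex $v$ (where $p_v:=p_{\{v\}}$). RFD. A $K$-algebra $A$ is residually finite-dimensional (RFD) if for every $0\ne a\in A$ there are a finite-dimensional $K$-vector space $V$ and a $K$-algebra homomorphism $\pi:A\to\operatorname{End}_K(V)$ with $\pi(a)\ne0$. *)

theory Defs
  imports Complex_Main "HOL-Library.Poly_Mapping" "HOL-Library.FuncSet"
begin

section \<open>Ultragraphs\<close>

record ('v, 'e) ultragraph =
  verts :: "'v set"
  edges :: "'e set"
  src :: "'e \<Rightarrow> 'v"
  rng :: "'e \<Rightarrow> 'v set"

locale ultragraph =
  fixes G :: "('v, 'e) ultragraph"
  assumes src_in: "e \<in> edges G \<Longrightarrow> src G e \<in> verts G"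
    and rng_sub: "e \<in> edges G \<Longrightarrow> rng G e \<subseteq> verts G"
    and rng_nonempty: "e \<in> edges G \<Longrightarrow> rng G e \<noteq> {}"

inductive_set gen_verts :: "('v, 'e) ultragraph \<Rightarrow> 'v set set"
  for G :: "('v, 'e) ultragraph" where
  empty: "{} \<in> gen_verts G"
| singleton: "v \<in> verts G \<Longrightarrow> {v} \<in> gen_verts G"
| range: "e \<in> edges G \<Longrightarrow> rng G e \<in> gen_verts G"
| union: "A \<in> gen_verts G \<Longrightarrow> B \<in> gen_verts G \<Longrightarrow> A \<union> B \<in> gen_verts G"
| inter: "A \<in> gen_verts G \<Longrightarrow> B \<in> gen_verts G \<Longrightarrow> A \<inter> B \<in> gen_verts G"

definition emitted :: "('v, 'e) ultragraph \<Rightarrow> 'v set \<Rightarrow> 'e set" where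
  "emitted G A = {e \<in> edges G. src G e \<in> A}"

definition is_sink :: "('v, 'e) ultragraph \<Rightarrow> 'v \<Rightarrow> bool" where
  "is_sink G v \<longleftrightarrow> v \<in> verts G \<and> {e \<in> edges G. src G e = v} = {}"

definition is_regular :: "('v, 'e) ultragraph \<Rightarrow> 'v \<Rightarrow> bool" where
  "is_regular G v \<longleftrightarrow> v \<in> verts G \<and>
     {e \<in> edges G. src G e = v} \<noteq> {} \<and> finite {e \<in> edges G. src G e = v}"

definition is_path :: "('v, 'e) ultragraph \<Rightarrow> 'e list \<Rightarrow> bool" where
  "is_path G \<alpha> \<longleftrightarrow> \<alpha> \<noteq> [] \<and> set \<alpha> \<subseteq> edges G \<and>
     (\<forall>i. Suc i < length \<alpha> \<longrightarrow> src G (\<alpha> ! Suc i) \<in> rng G (\<alpha> ! i))"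

definition path_src :: "('v, 'e) ultragraph \<Rightarrow> 'e list \<Rightarrow> 'v" where
  "path_src G \<alpha> = src G (hd \<alpha>)"

definition path_rng :: "('v, 'e) ultragraph \<Rightarrow> 'e list \<Rightarrow> 'v set" where
  "path_rng G \<alpha> = rng G (last \<alpha>)"

definition infinite_emitter :: "('v, 'e) ultragraph \<Rightarrow> 'v set \<Rightarrow> bool" where
  "infinite_emitter G A \<longleftrightarrow> A \<in> gen_verts G \<and> infinite (emitted G A)"

definition minimal_infinite_emitter :: "('v, 'e) ultragraph \<Rightarrow> 'v set \<Rightarrow> bool" where
  "minimal_infinite_emitter G A \<longleftrightarrow> infinite_emitter G A \<and>
     \<not> (\<exists>B \<in> gen_verts G. B \<subset> A \<and>
          (infinite_emitter G B \<or> infinite B \<and> finite (emitted G B)))"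

definition minimal_sink :: "('v, 'e) ultragraph \<Rightarrow> 'v set \<Rightarrow> bool" where
  "minimal_sink G A \<longleftrightarrow> A \<in> gen_verts G \<and> infinite A \<and> finite (emitted G A) \<and>
     \<not> (\<exists>B \<in> gen_verts G. B \<subset> A \<and> infinite B)"

definition terminal_boundary_sets :: "('v, 'e) ultragraph \<Rightarrow> 'v set set" where
  "terminal_boundary_sets G =
     {A. minimal_infinite_emitter G A} \<union> {A. minimal_sink G A} \<union> {{v} |v. is_sink G v}"

definition is_cycle :: "('v, 'e) ultragraph \<Rightarrow> 'e list \<Rightarrow> bool" where
  "is_cycle G c \<longleftrightarrow> is_path G c \<and> path_src G c \<in> path_rng G c \<and> distinct (map (src G) c)"

definition on_cycle :: "('v, 'e) ultragraph \<Rightarrow> 'v \<Rightarrow> bool" where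
  "on_cycle G v \<longleftrightarrow> (\<exists>c. is_cycle G c \<and> v \<in> src G ` set c)"

definition has_exit :: "('v, 'e) ultragraph \<Rightarrow> 'e list \<Rightarrow> bool" where
  "has_exit G c \<longleftrightarrow> (\<exists>i < length c.
     (\<exists>f \<in> edges G. src G f \<in> rng G (c ! i) \<and> f \<noteq> c ! (Suc i mod length c)) \<or>
     (\<exists>w \<in> rng G (c ! i). is_sink G w))"

definition no_infinite_receivers :: "('v, 'e) ultragraph \<Rightarrow> bool" where
  "no_infinite_receivers G \<longleftrightarrow> (\<forall>v \<in> verts G. finite {e \<in> edges G. v \<in> rng G e})"

definition no_cycle_has_exit :: "('v, 'e) ultragraph \<Rightarrow> bool" where
  "no_cycle_has_exit G \<longleftrightarrow> (\<forall>c. is_cycle G c \<longrightarrow> \<not> has_exit G c)"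

definition no_infinite_backward_chains :: "('v, 'e) ultragraph \<Rightarrow> bool" where
  "no_infinite_backward_chains G \<longleftrightarrow>
     \<not> (\<exists>e :: nat \<Rightarrow> 'e. inj e \<and> (\<forall>i. e i \<in> edges G) \<and> (\<forall>i. src G (e i) \<in> rng G (e (Suc i))))"

definition reaches_terminal :: "('v, 'e) ultragraph \<Rightarrow> 'v \<Rightarrow> bool" where
  "reaches_terminal G v \<longleftrightarrow> {v} \<in> terminal_boundary_sets G \<or>
     (\<exists>\<alpha> A. is_path G \<alpha> \<and> path_src G \<alpha> = v \<and> A \<in> terminal_boundary_sets G \<and> A \<subseteq> path_rng G \<alpha>)"

definition reaches_cycle :: "('v, 'e) ultragraph \<Rightarrow> 'v \<Rightarrow> bool" where
  "reaches_cycle G v \<longleftrightarrow> on_cycle G v \<or>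
     (\<exists>\<alpha> w. is_path G \<alpha> \<and> path_src G \<alpha> = v \<and> w \<in> path_rng G \<alpha> \<and> on_cycle G w)"

definition every_vertex_reaches_terminal_or_cycle :: "('v, 'e) ultragraph \<Rightarrow> bool" where
  "every_vertex_reaches_terminal_or_cycle G \<longleftrightarrow>
     (\<forall>v \<in> verts G. reaches_terminal G v \<or> reaches_cycle G v)"


section \<open>Algebras over a field\<close>

text \<open>Associative algebras, not necessarily unital, with an explicit carrier; the ground field
  is the type \<open>'k\<close>.\<close>

record ('k, 'a) kalgebra =
  acarrier :: "'a set"
  azero :: 'a
  aadd :: "'a \<Rightarrow> 'a \<Rightarrow> 'a"
  ascale :: "'k \<Rightarrow> 'a \<Rightarrow> 'a"
  amult :: "'a \<Rightarrow> 'a \<Rightarrow> 'a"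

locale kalgebra =
  fixes A :: "('k::field, 'a) kalgebra"
  assumes zero_closed: "azero A \<in> acarrier A"
    and add_closed: "\<lbrakk>x \<in> acarrier A; y \<in> acarrier A\<rbrakk> \<Longrightarrow> aadd A x y \<in> acarrier A"
    and scale_closed: "x \<in> acarrier A \<Longrightarrow> ascale A c x \<in> acarrier A"
    and mult_closed: "\<lbrakk>x \<in> acarrier A; y \<in> acarrier A\<rbrakk> \<Longrightarrow> amult A x y \<in> acarrier A"
    and add_assoc: "\<lbrakk>x \<in> acarrier A; y \<in> acarrier A; z \<in> acarrier A\<rbrakk>
      \<Longrightarrow> aadd A (aadd A x y) z = aadd A x (aadd A y z)"
    and add_commute: "\<lbrakk>x \<in> acarrier A; y \<in> acarrier A\<rbrakk> \<Longrightarrow> aadd A x y = aadd A y x"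
    and add_zero: "x \<in> acarrier A \<Longrightarrow> aadd A x (azero A) = x"
    and add_inverse: "x \<in> acarrier A \<Longrightarrow> aadd A x (ascale A (- 1) x) = azero A"
    and scale_one: "x \<in> acarrier A \<Longrightarrow> ascale A 1 x = x"
    and scale_scale: "x \<in> acarrier A \<Longrightarrow> ascale A c (ascale A d x) = ascale A (c * d) x"
    and scale_add_right: "\<lbrakk>x \<in> acarrier A; y \<in> acarrier A\<rbrakk>
      \<Longrightarrow> ascale A c (aadd A x y) = aadd A (ascale A c x) (ascale A c y)"
    and scale_add_left: "x \<in> acarrier A
      \<Longrightarrow> ascale A (c + d) x = aadd A (ascale A c x) (ascale A d x)"
    and mult_assoc: "\<lbrakk>x \<in> acarrier A; y \<in> acarrier A; z \<in> acarrier A\<rbrakk>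
      \<Longrightarrow> amult A (amult A x y) z = amult A x (amult A y z)"
    and mult_add_right: "\<lbrakk>x \<in> acarrier A; y \<in> acarrier A; z \<in> acarrier A\<rbrakk>
      \<Longrightarrow> amult A x (aadd A y z) = aadd A (amult A x y) (amult A x z)"
    and mult_add_left: "\<lbrakk>x \<in> acarrier A; y \<in> acarrier A; z \<in> acarrier A\<rbrakk>
      \<Longrightarrow> amult A (aadd A x y) z = aadd A (amult A x z) (amult A y z)"
    and mult_scale_left: "\<lbrakk>x \<in> acarrier A; y \<in> acarrier A\<rbrakk>
      \<Longrightarrow> amult A (ascale A c x) y = ascale A c (amult A x y)"
    and mult_scale_right: "\<lbrakk>x \<in> acarrier A; y \<in> acarrier A\<rbrakk>
      \<Longrightarrow> amult A x (ascale A c y) = ascale A c (amult A x y)"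

definition kalgebra_hom :: "('k, 'a) kalgebra \<Rightarrow> ('k, 'b) kalgebra \<Rightarrow> ('a \<Rightarrow> 'b) set" where
  "kalgebra_hom A B = {\<phi>. \<phi> \<in> acarrier A \<rightarrow> acarrier B \<and>
     (\<forall>x \<in> acarrier A. \<forall>y \<in> acarrier A. \<phi> (aadd A x y) = aadd B (\<phi> x) (\<phi> y)) \<and>
     (\<forall>c. \<forall>x \<in> acarrier A. \<phi> (ascale A c x) = ascale B c (\<phi> x)) \<and>
     (\<forall>x \<in> acarrier A. \<forall>y \<in> acarrier A. \<phi> (amult A x y) = amult B (\<phi> x) (\<phi> y))}"

definition two_sided_ideal :: "('k, 'a) kalgebra \<Rightarrow> 'a set \<Rightarrow> bool" where
  "two_sided_ideal A I \<longleftrightarrow> I \<subseteq> acarrier A \<and> azero A \<in> I \<and>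
     (\<forall>x \<in> I. \<forall>y \<in> I. aadd A x y \<in> I) \<and>
     (\<forall>c. \<forall>x \<in> I. ascale A c x \<in> I) \<and>
     (\<forall>a \<in> acarrier A. \<forall>x \<in> I. amult A a x \<in> I \<and> amult A x a \<in> I)"

definition ideal_generated :: "('k, 'a) kalgebra \<Rightarrow> 'a set \<Rightarrow> 'a set" where
  "ideal_generated A R = \<Inter> {I. two_sided_ideal A I \<and> R \<subseteq> I}"

definition alg_coset :: "('k, 'a) kalgebra \<Rightarrow> 'a set \<Rightarrow> 'a \<Rightarrow> 'a set" where
  "alg_coset A I a = aadd A a ` I"

definition quotient_algebra :: "('k, 'a) kalgebra \<Rightarrow> 'a set \<Rightarrow> ('k, 'a set) kalgebra" where
  "quotient_algebra A I = \<lparr>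
     acarrier = alg_coset A I ` acarrier A,
     azero = alg_coset A I (azero A),
     aadd = (\<lambda>X Y. \<Union>x \<in> X. \<Union>y \<in> Y. alg_coset A I (aadd A x y)),
     ascale = (\<lambda>c X. \<Union>x \<in> X. alg_coset A I (ascale A c x)),
     amult = (\<lambda>X Y. \<Union>x \<in> X. \<Union>y \<in> Y. alg_coset A I (amult A x y))\<rparr>"


section \<open>Free algebras\<close>

text \<open>The free monoid is written additively, because the product of \<open>'a \<Rightarrow>\<^sub>0 'k\<close> is the
  convolution product for an additive monoid \<open>'a\<close>.\<close>

datatype 'x free_monoid = Word (letters: "'x list")

instantiation free_monoid :: (type) monoid_add
begin

definition zero_free_monoid :: "'a free_monoid" where
  "0 = Word []"

definition plus_free_monoid :: "'a free_monoid \<Rightarrow> 'a free_monoid \<Rightarrow> 'a free_monoid" where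
  "u + w = Word (letters u @ letters w)"

instance
  by standard (simp_all add: zero_free_monoid_def plus_free_monoid_def)

end

definition pm_scale :: "'k::field \<Rightarrow> ('a \<Rightarrow>\<^sub>0 'k) \<Rightarrow> ('a \<Rightarrow>\<^sub>0 'k)" where
  "pm_scale c f = Poly_Mapping.map ((*) c) f"

text \<open>The free algebra without unit on \<open>X\<close>: linear combinations of nonempty words over \<open>X\<close>.\<close>

definition free_algebra :: "'x set \<Rightarrow> ('k::field, 'x free_monoid \<Rightarrow>\<^sub>0 'k) kalgebra" where
  "free_algebra X = \<lparr>
     acarrier = {f. \<forall>w \<in> Poly_Mapping.keys f. letters w \<noteq> [] \<and> set (letters w) \<subseteq> X},
     azero = 0,
     aadd = (+),
     ascale = pm_scale,
     amult = (*)\<rparr>"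

definition gen_elem :: "'x \<Rightarrow> ('x free_monoid \<Rightarrow>\<^sub>0 'k::field)" where
  "gen_elem x = Poly_Mapping.single (Word [x]) 1"


section \<open>Ultragraph Leavitt path algebras\<close>

datatype ('v, 'e) leavitt_gen = Edge 'e | Ghost 'e | Proj "'v set"

definition leavitt_gens :: "('v, 'e) ultragraph \<Rightarrow> ('v, 'e) leavitt_gen set" where
  "leavitt_gens G = Edge ` edges G \<union> Ghost ` edges G \<union> Proj ` gen_verts G"

text \<open>A defining relation \<open>x = y\<close> is represented by the element \<open>x - y\<close>.\<close>

inductive_set leavitt_relations ::
    "('v, 'e) ultragraph \<Rightarrow> (('v, 'e) leavitt_gen free_monoid \<Rightarrow>\<^sub>0 'k::field) set"
  for G :: "('v, 'e) ultragraph" where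
  proj_empty: "gen_elem (Proj {}) \<in> leavitt_relations G"
| proj_inter: "\<lbrakk>A \<in> gen_verts G; B \<in> gen_verts G\<rbrakk> \<Longrightarrow>
    gen_elem (Proj A) * gen_elem (Proj B) - gen_elem (Proj (A \<inter> B)) \<in> leavitt_relations G"
| proj_union: "\<lbrakk>A \<in> gen_verts G; B \<in> gen_verts G\<rbrakk> \<Longrightarrow>
    gen_elem (Proj (A \<union> B))
      - (gen_elem (Proj A) + gen_elem (Proj B) - gen_elem (Proj (A \<inter> B))) \<in> leavitt_relations G"
| src_edge: "e \<in> edges G \<Longrightarrow>
    gen_elem (Proj {src G e}) * gen_elem (Edge e) - gen_elem (Edge e) \<in> leavitt_relations G"
| edge_rng: "e \<in> edges G \<Longrightarrow>
    gen_elem (Edge e) * gen_elem (Proj (rng G e)) - gen_elem (Edge e) \<in> leavitt_relations G"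
| rng_ghost: "e \<in> edges G \<Longrightarrow>
    gen_elem (Proj (rng G e)) * gen_elem (Ghost e) - gen_elem (Ghost e) \<in> leavitt_relations G"
| ghost_src: "e \<in> edges G \<Longrightarrow>
    gen_elem (Ghost e) * gen_elem (Proj {src G e}) - gen_elem (Ghost e) \<in> leavitt_relations G"
| ghost_edge: "\<lbrakk>e \<in> edges G; f \<in> edges G\<rbrakk> \<Longrightarrow>
    gen_elem (Ghost e) * gen_elem (Edge f)
      - (if e = f then gen_elem (Proj (rng G e)) else 0) \<in> leavitt_relations G"
| regular: "is_regular G v \<Longrightarrow>
    gen_elem (Proj {v})
      - (\<Sum>e \<in> {e \<in> edges G. src G e = v}. gen_elem (Edge e) * gen_elem (Ghost e))
      \<in> leavitt_relations G"

definition leavitt_path_algebra :: "('v, 'e) ultragraph \<Rightarrow>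
    ('k::field, (('v, 'e) leavitt_gen free_monoid \<Rightarrow>\<^sub>0 'k) set) kalgebra" where
  "leavitt_path_algebra G =
     quotient_algebra (free_algebra (leavitt_gens G))
       (ideal_generated (free_algebra (leavitt_gens G)) (leavitt_relations G))"


section \<open>Residual finite-dimensionality\<close>

context vector_space
begin

definition fin_dim_subspace :: "'b set \<Rightarrow> bool" where
  "fin_dim_subspace V \<longleftrightarrow> subspace V \<and> (\<exists>B. finite B \<and> span B = V)"

text \<open>Linear endomorphisms of a subspace \<open>V\<close>, made extensional so that equality of elements is
  equality on \<open>V\<close>.\<close>

definition endomorphism_algebra :: "'b set \<Rightarrow> ('a, 'b \<Rightarrow> 'b) kalgebra" where
  "endomorphism_algebra V = \<lparr>
     acarrier = {T \<in> V \<rightarrow>\<^sub>E V. (\<forall>x \<in> V. \<forall>y \<in> V. T (x + y) = T x + T y) \<and>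
                              (\<forall>c. \<forall>x \<in> V. T (scale c x) = scale c (T x))},
     azero = (\<lambda>x \<in> V. 0),
     aadd = (\<lambda>S T. \<lambda>x \<in> V. S x + T x),
     ascale = (\<lambda>c T. \<lambda>x \<in> V. scale c (T x)),
     amult = (\<lambda>S T. \<lambda>x \<in> V. S (T x))\<rparr>"

end

text \<open>Definitions cannot quantify over types, so the finite-dimensional spaces range over the
  finite-dimensional subspaces of the space \<open>nat \<Rightarrow>\<^sub>0 'k\<close> of countable dimension. Up to
  isomorphism these are all finite-dimensional \<open>'k\<close>-vector spaces; see
  \<open>representation_transfer\<close> below.\<close>

definition residually_finite_dimensional :: "('k::field, 'a) kalgebra \<Rightarrow> bool" where
  "residually_finite_dimensional A \<longleftrightarrow>
     (\<forall>a \<in> acarrier A. a \<noteq> azero A \<longrightarrow>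
        (\<exists>(V :: (nat \<Rightarrow>\<^sub>0 'k) set) \<pi>.
           vector_space.fin_dim_subspace pm_scale V \<and>
           \<pi> \<in> kalgebra_hom A (vector_space.endomorphism_algebra pm_scale V) \<and>
           \<pi> a \<noteq> azero (vector_space.endomorphism_algebra pm_scale V)))"


section \<open>Basic facts\<close>

lemma lookup_pm_scale [simp]:
  "Poly_Mapping.lookup (pm_scale c f) x = c * Poly_Mapping.lookup f x"
  unfolding pm_scale_def by transfer (simp add: when_def)

lemma pm_scale_conv_mult: "pm_scale c f = Poly_Mapping.single 0 c * f"
  for f :: "'a::monoid_add \<Rightarrow>\<^sub>0 'k::field"
  unfolding pm_scale_def by (rule mult_map_scale_conv_mult)

lemma pm_scale_mult_left: "pm_scale c f * g = pm_scale c (f * g)"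
  for f :: "'a::monoid_add \<Rightarrow>\<^sub>0 'k::field"
  by (simp add: pm_scale_conv_mult mult.assoc)

lemma single_zero_commute: "f * Poly_Mapping.single 0 c = Poly_Mapping.single 0 c * f"
  for f :: "'a::monoid_add \<Rightarrow>\<^sub>0 'k::field"
proof (induction f rule: update_induct)
  case const
  show ?case by simp
next
  case (update f k v)
  have "Poly_Mapping.update k v f = f + Poly_Mapping.single k v"
    using update.hyps
    by (intro poly_mapping_eqI)
      (auto simp: lookup_update lookup_add lookup_single when_def in_keys_iff)
  with update.IH show ?case
    by (simp add: algebra_simps mult_single)
qed

lemma pm_scale_mult_right: "f * pm_scale c g = pm_scale c (f * g)"
  for f :: "'a::monoid_add \<Rightarrow>\<^sub>0 'k::field"
  by (metis pm_scale_conv_mult single_zero_commute mult.assoc)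

lemma vector_space_pm_scale: "vector_space (pm_scale :: 'k::field \<Rightarrow> ('a \<Rightarrow>\<^sub>0 'k) \<Rightarrow> _)"
  by standard (auto intro!: poly_mapping_eqI simp: lookup_add algebra_simps)

lemma kalgebra_free_algebra:
  fixes X :: "'x set"
  shows "kalgebra (free_algebra X :: ('k::field, 'x free_monoid \<Rightarrow>\<^sub>0 'k) kalgebra)"
proof -
  let ?P = "\<lambda>f :: 'x free_monoid \<Rightarrow>\<^sub>0 'k.
    \<forall>w \<in> Poly_Mapping.keys f. letters w \<noteq> [] \<and> set (letters w) \<subseteq> X"
  have add: "?P (f + g)" if "?P f" "?P g" for f g
    using that keys_add[of f g] by blast
  have scale: "?P (pm_scale c f)" if "?P f" for c f
    using that by (auto simp: in_keys_iff)
  have mult: "?P (f * g)" if "?P f" "?P g" for f g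
  proof
    fix w assume "w \<in> Poly_Mapping.keys (f * g)"
    then obtain u v where "u \<in> Poly_Mapping.keys f" "v \<in> Poly_Mapping.keys g" "w = u + v"
      using keys_mult[of f g] by blast
    with that show "letters w \<noteq> [] \<and> set (letters w) \<subseteq> X"
      by (auto simp: plus_free_monoid_def)
  qed
  interpret vector_space "pm_scale :: 'k \<Rightarrow> ('x free_monoid \<Rightarrow>\<^sub>0 'k) \<Rightarrow> _"
    by (rule vector_space_pm_scale)
  define C where "C = acarrier (free_algebra X :: ('k, 'x free_monoid \<Rightarrow>\<^sub>0 'k) kalgebra)"
  have C: "acarrier (free_algebra X) = C" by (simp add: C_def)
  have closed: "0 \<in> C" "f \<in> C \<Longrightarrow> g \<in> C \<Longrightarrow> f + g \<in> C" "f \<in> C \<Longrightarrow> pm_scale c f \<in> C"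
    "f \<in> C \<Longrightarrow> g \<in> C \<Longrightarrow> f * g \<in> C" for f g c
    unfolding C_def free_algebra_def kalgebra.simps mem_Collect_eq
    by (simp, fact add, fact scale, fact mult)
  have [simp]: "azero (free_algebra X) = (0 :: 'x free_monoid \<Rightarrow>\<^sub>0 'k)"
    "aadd (free_algebra X) = ((+) :: ('x free_monoid \<Rightarrow>\<^sub>0 'k) \<Rightarrow> _)"
    "ascale (free_algebra X) = (pm_scale :: 'k \<Rightarrow> ('x free_monoid \<Rightarrow>\<^sub>0 'k) \<Rightarrow> _)"
    "amult (free_algebra X) = ((*) :: ('x free_monoid \<Rightarrow>\<^sub>0 'k) \<Rightarrow> _)"
    by (simp_all add: free_algebra_def)
  show ?thesis
    by unfold_locales
      (simp_all add: C closed add.assoc add.commute mult.assoc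
        distrib_left distrib_right pm_scale_mult_left pm_scale_mult_right
        scale_right_distrib scale_left_distrib)
qed

context kalgebra
begin

lemma two_sided_ideal_generated:
  assumes "R \<subseteq> acarrier A"
  shows "two_sided_ideal A (ideal_generated A R)"
proof -
  have "two_sided_ideal A (acarrier A)"
    by (simp add: two_sided_ideal_def zero_closed add_closed scale_closed mult_closed)
  with assms have "ideal_generated A R \<subseteq> acarrier A"
    unfolding ideal_generated_def by blast
  then show ?thesis
    unfolding two_sided_ideal_def ideal_generated_def by blast
qed

lemma add_left_commute:
  assumes "x \<in> acarrier A" "y \<in> acarrier A" "z \<in> acarrier A"
  shows "aadd A x (aadd A y z) = aadd A y (aadd A x z)"
  using assms by (metis add_assoc add_commute)

lemma zero_add: "x \<in> acarrier A \<Longrightarrow> aadd A (azero A) x = x"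
  by (metis add_commute add_zero zero_closed)

context
  fixes I
  assumes I: "two_sided_ideal A I"
begin

lemma ideal_closed:
  shows "x \<in> I \<Longrightarrow> x \<in> acarrier A" "azero A \<in> I"
    "x \<in> I \<Longrightarrow> y \<in> I \<Longrightarrow> aadd A x y \<in> I"
    "x \<in> I \<Longrightarrow> ascale A c x \<in> I"
    "a \<in> acarrier A \<Longrightarrow> x \<in> I \<Longrightarrow> amult A a x \<in> I"
    "a \<in> acarrier A \<Longrightarrow> x \<in> I \<Longrightarrow> amult A x a \<in> I"
  using I by (auto simp: two_sided_ideal_def)

lemma coset_absorb:
  assumes x: "x \<in> acarrier A" and i: "i \<in> I"
  shows "alg_coset A I (aadd A x i) = alg_coset A I x"
proof -
  note closed = ideal_closed add_closed scale_closed
  have sub1: "aadd A (aadd A x i) j = aadd A x (aadd A i j)" if "j \<in> I" for j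
    using that x i by (simp add: add_assoc ideal_closed)
  have sub2: "aadd A x j = aadd A (aadd A x i) (aadd A (ascale A (- 1) i) j)" if "j \<in> I" for j
  proof -
    have "aadd A i (aadd A (ascale A (- 1) i) j) = aadd A (aadd A i (ascale A (- 1) i)) j"
      using that i by (simp add: add_assoc closed)
    also have "\<dots> = j"
      using that i by (simp add: add_inverse zero_add closed)
    finally show ?thesis
      using that x i by (simp add: add_assoc closed)
  qed
  show ?thesis
  proof
    show "alg_coset A I (aadd A x i) \<subseteq> alg_coset A I x"
      unfolding alg_coset_def using i by (auto simp: sub1 ideal_closed)
    show "alg_coset A I x \<subseteq> alg_coset A I (aadd A x i)"
      unfolding alg_coset_def using i
      by (intro image_subsetI) (subst sub2, simp_all add: ideal_closed)
  qed
qed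

lemma coset_self: "x \<in> acarrier A \<Longrightarrow> x \<in> alg_coset A I x"
  unfolding alg_coset_def using add_zero ideal_closed(2) by (metis image_eqI)

lemma coset_eq_iff:
  assumes "x \<in> acarrier A" "y \<in> acarrier A"
  shows "alg_coset A I x = alg_coset A I y \<longleftrightarrow> (\<exists>i \<in> I. x = aadd A y i)"
proof
  assume "alg_coset A I x = alg_coset A I y"
  with coset_self[OF assms(1)] show "\<exists>i \<in> I. x = aadd A y i"
    unfolding alg_coset_def by blast
qed (use assms(2) coset_absorb in blast)

lemma quotient_add:
  assumes x: "x \<in> acarrier A" and y: "y \<in> acarrier A"
  shows "aadd (quotient_algebra A I) (alg_coset A I x) (alg_coset A I y)
    = alg_coset A I (aadd A x y)"
proof -
  have const: "alg_coset A I (aadd A x' y') = alg_coset A I (aadd A x y)"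
    if x'y': "x' \<in> alg_coset A I x" "y' \<in> alg_coset A I y" for x' y'
  proof -
    obtain i j where ij: "i \<in> I" "j \<in> I" and eq: "x' = aadd A x i" "y' = aadd A y j"
      using x'y' unfolding alg_coset_def by blast
    have "aadd A x' y' = aadd A (aadd A x y) (aadd A i j)"
      unfolding eq using x y ij by (simp add: add_assoc add_left_commute[of i] add_closed ideal_closed)
    then show ?thesis using x y ij by (simp add: coset_absorb add_closed ideal_closed)
  qed
  have "alg_coset A I x \<noteq> {}" "alg_coset A I y \<noteq> {}"
    using coset_self[OF x] coset_self[OF y] by blast+
  then show ?thesis
    by (simp add: quotient_algebra_def const)
qed

lemma quotient_scale:
  assumes x: "x \<in> acarrier A"
  shows "ascale (quotient_algebra A I) c (alg_coset A I x) = alg_coset A I (ascale A c x)"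
proof -
  have const: "alg_coset A I (ascale A c x') = alg_coset A I (ascale A c x)"
    if "x' \<in> alg_coset A I x" for x'
    using that x
    by (auto simp: alg_coset_def[of A I x] scale_add_right coset_absorb scale_closed ideal_closed)
  have "alg_coset A I x \<noteq> {}"
    using coset_self[OF x] by blast
  then show ?thesis
    by (simp add: quotient_algebra_def const)
qed

lemma quotient_mult:
  assumes x: "x \<in> acarrier A" and y: "y \<in> acarrier A"
  shows "amult (quotient_algebra A I) (alg_coset A I x) (alg_coset A I y)
    = alg_coset A I (amult A x y)"
proof -
  have const: "alg_coset A I (amult A x' y') = alg_coset A I (amult A x y)"
    if x'y': "x' \<in> alg_coset A I x" "y' \<in> alg_coset A I y" for x' y'
  proof -
    obtain i j where ij: "i \<in> I" "j \<in> I" and eq: "x' = aadd A x i" "y' = aadd A y j"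
      using x'y' unfolding alg_coset_def by blast
    have "amult A x' y' =
        aadd A (amult A x y) (aadd A (amult A x j) (aadd A (amult A i y) (amult A i j)))"
      unfolding eq using x y ij
      by (simp add: mult_add_left mult_add_right add_assoc add_left_commute add_closed
          mult_closed ideal_closed)
    then show ?thesis using x y ij by (simp add: coset_absorb mult_closed ideal_closed)
  qed
  have "alg_coset A I x \<noteq> {}" "alg_coset A I y \<noteq> {}"
    using coset_self[OF x] coset_self[OF y] by blast+
  then show ?thesis
    by (simp add: quotient_algebra_def const)
qed

lemma quotient_carrier: "acarrier (quotient_algebra A I) = alg_coset A I ` acarrier A"
  by (simp add: quotient_algebra_def)

lemma quotient_zero: "azero (quotient_algebra A I) = alg_coset A I (azero A)"
  by (simp add: quotient_algebra_def)

lemma kalgebra_quotient: "kalgebra (quotient_algebra A I)"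
proof -
  note [simp] = quotient_carrier quotient_zero quotient_add quotient_scale quotient_mult
    zero_closed add_closed scale_closed mult_closed add_zero add_inverse scale_one scale_scale
    scale_add_right scale_add_left mult_assoc mult_add_right mult_add_left
    mult_scale_left mult_scale_right add_assoc
  show ?thesis
  proof unfold_locales
    fix X Y assume "X \<in> acarrier (quotient_algebra A I)" "Y \<in> acarrier (quotient_algebra A I)"
    then obtain x y where "x \<in> acarrier A" "y \<in> acarrier A"
      and "X = alg_coset A I x" "Y = alg_coset A I y" by auto
    then show "aadd (quotient_algebra A I) X Y = aadd (quotient_algebra A I) Y X"
      by (simp add: add_commute[of x])
  qed auto
qed

end

end

lemma leavitt_relations_subset:
  fixes G :: "('v, 'e) ultragraph"
  assumes "ultragraph G"
  shows "leavitt_relations G \<subseteq> acarrier (free_algebra (leavitt_gens G))"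
proof
  interpret ultragraph G by fact
  interpret F: kalgebra "free_algebra (leavitt_gens G)" by (rule kalgebra_free_algebra)
  let ?C = "acarrier (free_algebra (leavitt_gens G))"
  have gen: "gen_elem x \<in> ?C" if "x \<in> leavitt_gens G" for x
    using that by (simp add: free_algebra_def gen_elem_def)
  have add: "f + g \<in> ?C" if "f \<in> ?C" "g \<in> ?C" for f g
    using F.add_closed[OF that] by (simp add: free_algebra_def)
  have mult: "f * g \<in> ?C" if "f \<in> ?C" "g \<in> ?C" for f g
    using F.mult_closed[OF that] by (simp add: free_algebra_def)
  have diff: "f - g \<in> ?C" if "f \<in> ?C" "g \<in> ?C" for f g
  proof -
    have "pm_scale (- 1) g \<in> ?C"
      using F.scale_closed[OF that(2)] by (simp add: free_algebra_def)
    moreover have "f - g = f + pm_scale (- 1) g"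
      by (intro poly_mapping_eqI) (simp add: lookup_add lookup_minus)
    ultimately show ?thesis using add[OF that(1)] by (simp only:)
  qed
  have zero: "0 \<in> ?C" by (simp add: free_algebra_def)
  have sum: "sum h S \<in> ?C" if "\<And>x. x \<in> S \<Longrightarrow> h x \<in> ?C" for h :: "'e \<Rightarrow> _" and S
    using that by (induction S rule: infinite_finite_induct) (simp_all add: zero add)
  have gens: "Proj A \<in> leavitt_gens G" if "A \<in> gen_verts G" for A
    using that by (simp add: leavitt_gens_def)
  have gens': "Edge e \<in> leavitt_gens G" "Ghost e \<in> leavitt_gens G"
    "Proj {src G e} \<in> leavitt_gens G" "Proj (rng G e) \<in> leavitt_gens G" if "e \<in> edges G" for e
    using that by (simp_all add: leavitt_gens_def gen_verts.range gen_verts.singleton src_in)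
  fix r assume "r \<in> leavitt_relations G"
  then show "r \<in> ?C"
  proof cases
    case (regular v)
    then have "gen_elem (Proj {v}) \<in> ?C"
      by (intro gen gens gen_verts.singleton) (simp add: is_regular_def)
    then show ?thesis
      unfolding regular(1) by (intro diff sum) (auto intro: mult gen gens')
  qed (simp_all add: is_regular_def zero gen add mult diff sum gens gens' gen_verts.intros)
qed

lemma kalgebra_leavitt_path_algebra:
  assumes "ultragraph G"
  shows "kalgebra (leavitt_path_algebra G)"
  unfolding leavitt_path_algebra_def
  by (rule kalgebra.kalgebra_quotient[OF kalgebra_free_algebra
      kalgebra.two_sided_ideal_generated[OF kalgebra_free_algebra
        leavitt_relations_subset[OF assms]]])

lemma (in vector_space) kalgebra_endomorphism_algebra:
  assumes "subspace V"
  shows "kalgebra (endomorphism_algebra V)"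
proof -
  have V: "0 \<in> V" "x \<in> V \<Longrightarrow> y \<in> V \<Longrightarrow> x + y \<in> V" "x \<in> V \<Longrightarrow> scale c x \<in> V" for x y c
    using assms by (auto simp: subspace_def)
  show ?thesis
    by unfold_locales
      (auto simp: endomorphism_algebra_def V PiE_iff extensional_def restrict_def fun_eq_iff
        scale_right_distrib scale_left_distrib ac_simps)
qed

text \<open>A representation on a finite-dimensional subspace of an arbitrary vector space can be moved
  to one on a subspace of \<open>nat \<Rightarrow>\<^sub>0 'k\<close>.\<close>

lemma representation_transfer:
  fixes scale :: "'k::field \<Rightarrow> 'w::ab_group_add \<Rightarrow> 'w"
  assumes vs: "vector_space scale"
    and W: "vector_space.fin_dim_subspace scale W"
    and \<pi>: "\<pi> \<in> kalgebra_hom A (vector_space.endomorphism_algebra scale W)"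
    and a: "a \<in> acarrier A" "\<pi> a \<noteq> azero (vector_space.endomorphism_algebra scale W)"
  shows "\<exists>(V :: (nat \<Rightarrow>\<^sub>0 'k) set) \<rho>.
    vector_space.fin_dim_subspace pm_scale V \<and>
    \<rho> \<in> kalgebra_hom A (vector_space.endomorphism_algebra pm_scale V) \<and>
    \<rho> a \<noteq> azero (vector_space.endomorphism_algebra pm_scale V)"
proof -
  interpret vs: vector_space scale by (rule vs)
  interpret pm: vector_space "pm_scale :: 'k \<Rightarrow> (nat \<Rightarrow>\<^sub>0 'k) \<Rightarrow> _"
    by (rule vector_space_pm_scale)
  interpret vp: vector_space_pair scale "pm_scale :: 'k \<Rightarrow> (nat \<Rightarrow>\<^sub>0 'k) \<Rightarrow> _" ..
  interpret pv: vector_space_pair "pm_scale :: 'k \<Rightarrow> (nat \<Rightarrow>\<^sub>0 'k) \<Rightarrow> _" scale ..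
  obtain B0 where B0: "finite B0" "vs.span B0 = W" and subW: "vs.subspace W"
    using W by (auto simp: vs.fin_dim_subspace_def)
  obtain B where B: "B \<subseteq> B0" "vs.independent B" "B0 \<subseteq> vs.span B"
    using vs.maximal_independent_subset[of B0] by blast
  have finB: "finite B" using B(1) B0(1) by (rule finite_subset)
  have spanB: "vs.span B = W"
    using B B0(2) vs.span_mono[OF B(1)] vs.span_minimal[OF B(3) vs.subspace_span] by auto
  obtain f :: "'w \<Rightarrow> nat" where f: "inj_on f B"
    using finite_imp_inj_to_nat_seg[OF finB] by blast
  define \<phi> where "\<phi> = vp.construct B (\<lambda>b. Poly_Mapping.single (f b) (1 :: 'k))"
  define \<psi> where "\<psi> g = (\<Sum>b \<in> B. scale (Poly_Mapping.lookup g (f b)) b)" for g :: "nat \<Rightarrow>\<^sub>0 'k"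
  have lin\<phi>: "Vector_Spaces.linear scale pm_scale \<phi>"
    unfolding \<phi>_def by (rule vp.linear_construct[OF B(2)])
  have lin\<psi>: "Vector_Spaces.linear pm_scale scale \<psi>"
    by unfold_locales
      (simp_all add: \<psi>_def lookup_add vs.scale_left_distrib sum.distrib vs.scale_sum_right)
  have "\<psi> (\<phi> b) = b" if "b \<in> B" for b
  proof -
    have "\<phi> b = Poly_Mapping.single (f b) 1"
      unfolding \<phi>_def by (rule vp.construct_basis[OF B(2) that])
    then have "\<psi> (\<phi> b) = (\<Sum>b' \<in> B. if b' = b then b' else 0)"
      unfolding \<psi>_def using that f
      by (intro sum.cong) (auto simp: lookup_single when_def inj_on_eq_iff)
    with that finB show ?thesis by simp
  qed
  note \<psi>\<phi>_B = this
  have \<psi>\<phi>: "\<psi> (\<phi> w) = w" if "w \<in> W" for w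
  proof -
    have "w \<in> vs.span B" using that spanB by simp
    then show ?thesis
      by (rule vs.span_induct)
        (simp_all add: \<psi>\<phi>_B vs.subspace_def vp.linear_0[OF lin\<phi>] pv.linear_0[OF lin\<psi>]
          vp.linear_add[OF lin\<phi>] pv.linear_add[OF lin\<psi>]
          vp.linear_scale[OF lin\<phi>] pv.linear_scale[OF lin\<psi>])
  qed
  define V where "V = \<phi> ` W"
  have subV: "pm.fin_dim_subspace V"
    unfolding pm.fin_dim_subspace_def V_def
    using vp.linear_subspace_image[OF lin\<phi> subW] vp.linear_span_image[OF lin\<phi>, of B] finB spanB
    by auto
  define \<rho> where "\<rho> x = (\<lambda>v \<in> V. \<phi> (\<pi> x (\<psi> v)))" for x
  note \<phi>_simps = vp.linear_add[OF lin\<phi>] vp.linear_scale[OF lin\<phi>]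
  have W_closed: "x \<in> W \<Longrightarrow> y \<in> W \<Longrightarrow> x + y \<in> W" "x \<in> W \<Longrightarrow> scale c x \<in> W" for x y c
    using subW by (auto simp: vs.subspace_def)
  have \<pi>_mem: "\<pi> x \<in> W \<rightarrow>\<^sub>E W" "w \<in> W \<Longrightarrow> \<pi> x w \<in> W"
    "w \<in> W \<Longrightarrow> w' \<in> W \<Longrightarrow> \<pi> x (w + w') = \<pi> x w + \<pi> x w'"
    "w \<in> W \<Longrightarrow> \<pi> x (scale c w) = scale c (\<pi> x w)" if "x \<in> acarrier A" for x w w' c
  proof -
    have "\<pi> x \<in> acarrier (vs.endomorphism_algebra W)"
      using \<pi> that by (auto simp: kalgebra_hom_def)
    then show "\<pi> x \<in> W \<rightarrow>\<^sub>E W" "w \<in> W \<Longrightarrow> \<pi> x w \<in> W"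
      "w \<in> W \<Longrightarrow> w' \<in> W \<Longrightarrow> \<pi> x (w + w') = \<pi> x w + \<pi> x w'"
      "w \<in> W \<Longrightarrow> \<pi> x (scale c w) = scale c (\<pi> x w)"
      by (auto simp: vs.endomorphism_algebra_def)
  qed
  have \<pi>_hom: "w \<in> W \<Longrightarrow> \<pi> (aadd A x y) w = \<pi> x w + \<pi> y w"
    "w \<in> W \<Longrightarrow> \<pi> (amult A x y) w = \<pi> x (\<pi> y w)"
    "w \<in> W \<Longrightarrow> \<pi> (ascale A c x) w = scale c (\<pi> x w)"
    if "x \<in> acarrier A" "y \<in> acarrier A" for x y w c
    using \<pi> that by (auto simp: kalgebra_hom_def vs.endomorphism_algebra_def)
  have \<rho>_\<phi>: "\<rho> x (\<phi> w) = \<phi> (\<pi> x w)" if "w \<in> W" for x w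
    using that by (simp add: \<rho>_def V_def \<psi>\<phi>)
  have \<rho>_ext: "\<rho> x \<in> extensional V" for x
    by (simp add: \<rho>_def)
  have "\<rho> \<in> kalgebra_hom A (pm.endomorphism_algebra V)"
    unfolding kalgebra_hom_def pm.endomorphism_algebra_def
  proof (simp, intro conjI ballI allI)
    show "\<rho> \<in> acarrier A \<rightarrow> {T \<in> V \<rightarrow>\<^sub>E V. (\<forall>x \<in> V. \<forall>y \<in> V. T (x + y) = T x + T y) \<and>
        (\<forall>c. \<forall>x \<in> V. T (pm_scale c x) = pm_scale c (T x))}"
    proof (intro funcsetI CollectI conjI PiE_I ballI allI)
      fix x u v c assume x: "x \<in> acarrier A" and u: "u \<in> V"
      then obtain w where w: "w \<in> W" "u = \<phi> w" by (auto simp: V_def)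
      show "\<rho> x u \<in> V" using x w by (auto simp: \<rho>_\<phi> V_def intro: \<pi>_mem)
      show "\<rho> x (pm_scale c u) = pm_scale c (\<rho> x u)"
        using x w by (metis W_closed(2) \<phi>_simps(2) \<pi>_mem(4) \<rho>_\<phi>)
      assume "v \<in> V"
      then obtain w' where w': "w' \<in> W" "v = \<phi> w'" by (auto simp: V_def)
      show "\<rho> x (u + v) = \<rho> x u + \<rho> x v"
        using x w w' by (metis W_closed(1) \<phi>_simps(1) \<pi>_mem(3) \<rho>_\<phi>)
    qed (simp add: \<rho>_def)
  next
    fix x y assume "x \<in> acarrier A" "y \<in> acarrier A"
    then show "\<rho> (aadd A x y) = (\<lambda>v \<in> V. \<rho> x v + \<rho> y v)"
      by (intro extensionalityI[OF \<rho>_ext restrict_extensional])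
        (use \<pi>_hom(1) in \<open>auto simp: V_def \<rho>_\<phi> \<phi>_simps\<close>)
  next
    fix c x assume "x \<in> acarrier A"
    then show "\<rho> (ascale A c x) = (\<lambda>v \<in> V. pm_scale c (\<rho> x v))"
      by (intro extensionalityI[OF \<rho>_ext restrict_extensional])
        (auto simp: V_def \<rho>_\<phi> \<pi>_hom(3) \<phi>_simps)
  next
    fix x y assume "x \<in> acarrier A" "y \<in> acarrier A"
    then show "\<rho> (amult A x y) = (\<lambda>v \<in> V. \<rho> x (\<rho> y v))"
      by (intro extensionalityI[OF \<rho>_ext restrict_extensional])
        (auto simp: V_def \<rho>_\<phi> \<pi>_hom(2) \<pi>_mem(2))
  qed
  moreover have "\<rho> a \<noteq> azero (pm.endomorphism_algebra V)"
  proof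
    assume "\<rho> a = azero (pm.endomorphism_algebra V)"
    then have "\<phi> (\<pi> a w) = 0" if "w \<in> W" for w
      using \<rho>_\<phi>[OF that, of a] that by (simp add: pm.endomorphism_algebra_def V_def)
    then have "\<pi> a w = 0" if "w \<in> W" for w
      using that \<psi>\<phi>[OF \<pi>_mem(2)[OF a(1) that]] pv.linear_0[OF lin\<psi>] by simp
    moreover have "\<pi> a \<in> extensional W" using \<pi>_mem(1)[OF a(1)] by (simp add: PiE_def)
    ultimately have "\<pi> a = (\<lambda>x \<in> W. 0)"
      by (intro extensionalityI[OF _ restrict_extensional]) auto
    with a(2) show False by (simp add: vs.endomorphism_algebra_def)
  qed
  ultimately show ?thesis using subV by blast
qed

end

theory Submission
  imports Defs "HOL-Library.Function_Algebras"
begin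

text \<open>Let \<open>J\<close> be the ideal of defining relations and \<open>N\<close> the ideal of elements killed by all
  finite-dimensional representations; we need \<open>N \<subseteq> J\<close>. Modulo \<open>J\<close> every element is a combination of
  monomials \<open>s\<^sub>\<alpha> p\<^sub>A s\<^sub>\<beta>\<^sup>*\<close>. For \<open>f \<in> N\<close> we argue by induction on the maximal length of \<open>\<beta>\<close>:
  \<open>f s\<^sub>e\<close> has shorter ghost parts, so all \<open>f s\<^sub>e\<close> are in \<open>J\<close>; this forces the coefficients of the
  ghost-free part of \<open>f\<close> to vanish except at finitely many regular vertices, where the relation
  \<open>p\<^sub>v = \<Sum> s\<^sub>e s\<^sub>e\<^sup>*\<close> yields \<open>f \<in> J\<close>. The only input on \<open>N\<close> is that a combination of elements
  \<open>s\<^sub>\<alpha> p\<^sub>v\<close> in \<open>N\<close> has zero coefficients. This is witnessed by two kinds of representations by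
  partial bijections of a set of paths: paths ending in a terminal boundary set \<open>A\<close>, and
  infinite paths ending in a given cycle together with a residue modulo \<open>M\<close>. The paths form finite
  sets because the predecessor relation is finitely branching (B1) and well-founded off the cycles
  (B3), while cycles without exits (B2) can be continued in only one way.\<close>

section \<open>Ideals of free algebras\<close>

text \<open>Neither a basis of \<open>leavitt_path_algebra G\<close> nor a faithful representation
  is constructed. \<open>N\<close> is the common kernel of all finite-dimensional representations;
  being a two-sided ideal, it may be probed by right multiplication.

  One obstacle is that the sets in \<open>gen_verts G\<close> may be infinite and have no
  differences, so a combination of projections has no evident normal form. It is replaced by its
  coefficient function on vertices, and right multiplication by one \<open>proj {v}\<close> or one
  \<open>edge e\<close> reads off a single value of that function. Hence independence is tested at
  one vertex v, for finitely many paths ending there.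

  For the test, (B4) provides a base point x over v: a path from v to a terminal boundary set, or
  one that runs into a cycle. The paths \<alpha> are told apart by the points obtained by prepending
  them to x. On a cycle this fails at first: winding once more gives the same infinite path, and a
  finite set cannot record every winding number. Counting modulo an \<open>M\<close> larger than all
  lengths involved restores injectivity, so the representation depends on the element to be
  detected.\<close>

lemma pm_scale_zero [simp]: "pm_scale c 0 = 0"
  by (intro poly_mapping_eqI) simp

lemma pm_scale_0_left [simp]: "pm_scale 0 f = 0"
  by (intro poly_mapping_eqI) simp

lemma pm_scale_add_left: "pm_scale (c + d) f = pm_scale c f + pm_scale d f"
  by (intro poly_mapping_eqI) (simp add: lookup_add algebra_simps)

lemma pm_scale_diff: "pm_scale c (f - g) = pm_scale c f - pm_scale c g"
  by (intro poly_mapping_eqI) (simp add: lookup_minus algebra_simps)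

lemma pm_scale_minus_one: "pm_scale (- 1) f = - f"
  by (intro poly_mapping_eqI) simp

lemma sum_single_keys:
  "(\<Sum>w\<in>Poly_Mapping.keys f. Poly_Mapping.single w (Poly_Mapping.lookup f w)) = f"
proof (intro poly_mapping_eqI)
  fix w
  have "Poly_Mapping.lookup
      (\<Sum>w\<in>Poly_Mapping.keys f. Poly_Mapping.single w (Poly_Mapping.lookup f w)) w
    = (\<Sum>u\<in>Poly_Mapping.keys f. if u = w then Poly_Mapping.lookup f u else 0)"
    unfolding lookup_sum by (intro sum.cong) (auto simp: lookup_single when_def)
  also have "\<dots> = Poly_Mapping.lookup f w"
    by (simp add: in_keys_iff)
  finally show "Poly_Mapping.lookup
      (\<Sum>w\<in>Poly_Mapping.keys f. Poly_Mapping.single w (Poly_Mapping.lookup f w)) w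
    = Poly_Mapping.lookup f w" .
qed

definition unital_words :: "'x set \<Rightarrow> ('x free_monoid \<Rightarrow>\<^sub>0 'k::field) set" where
  "unital_words X = {f. \<forall>w \<in> Poly_Mapping.keys f. set (letters w) \<subseteq> X}"

lemma unital_words_closed [intro, simp]:
  "0 \<in> unital_words X" "1 \<in> unital_words X"
  "f \<in> unital_words X \<Longrightarrow> g \<in> unital_words X \<Longrightarrow> f + g \<in> unital_words X"
  "f \<in> unital_words X \<Longrightarrow> g \<in> unital_words X \<Longrightarrow> f - g \<in> unital_words X"
  "f \<in> unital_words X \<Longrightarrow> g \<in> unital_words X \<Longrightarrow> f * g \<in> unital_words X"
  "f \<in> unital_words X \<Longrightarrow> pm_scale c f \<in> unital_words X"
  "set w \<subseteq> X \<Longrightarrow> Poly_Mapping.single (Word w) c \<in> unital_words X"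
proof -
  show "f * g \<in> unital_words X" if "f \<in> unital_words X" "g \<in> unital_words X"
  proof -
    { fix w assume "w \<in> Poly_Mapping.keys (f * g)"
      then obtain u v where "u \<in> Poly_Mapping.keys f" "v \<in> Poly_Mapping.keys g" "w = u + v"
        using keys_mult[of f g] by blast
      with that have "set (letters w) \<subseteq> X"
        by (auto simp: plus_free_monoid_def unital_words_def) }
    then show ?thesis by (simp add: unital_words_def)
  qed
  show "f + g \<in> unital_words X" if "f \<in> unital_words X" "g \<in> unital_words X"
    using that Poly_Mapping.keys_add[of f g] by (force simp: unital_words_def)
  show "f - g \<in> unital_words X" if "f \<in> unital_words X" "g \<in> unital_words X"
    using that keys_diff[of f g] by (force simp: unital_words_def)
  show "pm_scale c f \<in> unital_words X" if "f \<in> unital_words X"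
    using that by (auto simp: unital_words_def in_keys_iff)
qed (auto simp: unital_words_def zero_free_monoid_def)

lemma unital_words_sum [intro, simp]:
  "(\<And>i. i \<in> S \<Longrightarrow> h i \<in> unital_words X) \<Longrightarrow> sum h S \<in> unital_words X"
  by (induction S rule: infinite_finite_induct) auto

lemma unital_decomp:
  assumes "f \<in> unital_words X"
  obtains h c where "h \<in> acarrier (free_algebra X)" "f = h + pm_scale c 1"
proof
  let ?c = "Poly_Mapping.lookup f 0"
  have lk: "Poly_Mapping.lookup (f - pm_scale ?c 1) 0 = 0"
    by (simp add: lookup_minus)
  have "f - pm_scale ?c 1 \<in> unital_words X" using assms by auto
  moreover have "letters w \<noteq> []" if "w \<in> Poly_Mapping.keys (f - pm_scale ?c 1)" for w
    using that lk by (cases w) (auto simp: in_keys_iff zero_free_monoid_def)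
  ultimately show "f - pm_scale ?c 1 \<in> acarrier (free_algebra X)"
    by (simp add: free_algebra_def unital_words_def)
qed simp

locale free_ideal =
  fixes X :: "'x set" and J :: "('x free_monoid \<Rightarrow>\<^sub>0 'k::field) set"
  assumes ideal: "two_sided_ideal (free_algebra X) J"
begin

lemma J_closed [simp, intro]:
  "0 \<in> J" "f \<in> J \<Longrightarrow> g \<in> J \<Longrightarrow> f + g \<in> J" "f \<in> J \<Longrightarrow> pm_scale c f \<in> J"
  using ideal by (auto simp: two_sided_ideal_def free_algebra_def)

lemma J_sub: "J \<subseteq> acarrier (free_algebra X)"
  using ideal by (auto simp: two_sided_ideal_def)

lemma J_uminus [simp, intro]: "f \<in> J \<Longrightarrow> - f \<in> J"
  by (metis J_closed(3) pm_scale_minus_one)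

lemma J_diff [simp, intro]: "f \<in> J \<Longrightarrow> g \<in> J \<Longrightarrow> f - g \<in> J"
  by (metis J_closed(2) J_uminus add_uminus_conv_diff)

lemma J_sum [intro]: "(\<And>i. i \<in> S \<Longrightarrow> h i \<in> J) \<Longrightarrow> sum h S \<in> J"
  by (induction S rule: infinite_finite_induct) auto

text \<open>A multiplier is an element of the algebra plus a scalar, so an ideal of the non-unital
  algebra is stable under its unital hull as well.\<close>

lemma J_mult:
  assumes f: "f \<in> J" and g: "g \<in> unital_words X"
  shows "g * f \<in> J" "f * g \<in> J"
proof -
  obtain h c where h: "h \<in> acarrier (free_algebra X)" "g = h + pm_scale c 1"
    using unital_decomp[OF g] .
  have "h * f \<in> J" "f * h \<in> J"
    using ideal h f by (auto simp: two_sided_ideal_def free_algebra_def)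
  then show "g * f \<in> J" "f * g \<in> J"
    using f by (auto simp: h algebra_simps pm_scale_mult_left pm_scale_mult_right)
qed

section \<open>Congruence modulo an ideal\<close>

definition cong :: "('x free_monoid \<Rightarrow>\<^sub>0 'k) \<Rightarrow> ('x free_monoid \<Rightarrow>\<^sub>0 'k) \<Rightarrow> bool"
    (infix "\<approx>" 50) where
  "f \<approx> g \<longleftrightarrow> f - g \<in> J"

lemma cong_refl [simp, intro]: "f \<approx> f"
  by (simp add: cong_def)

lemma cong_sym: "f \<approx> g \<Longrightarrow> g \<approx> f"
  using J_uminus[of "f - g"] by (simp add: cong_def)

lemma cong_trans [trans]: "f \<approx> g \<Longrightarrow> g \<approx> h \<Longrightarrow> f \<approx> h"
  using J_closed(2)[of "f - g" "g - h"] by (simp add: cong_def)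

lemma cong_0: "f \<approx> 0 \<longleftrightarrow> f \<in> J"
  by (simp add: cong_def)

lemma cong_add: "f \<approx> g \<Longrightarrow> f' \<approx> g' \<Longrightarrow> f + f' \<approx> g + g'"
  using J_closed(2)[of "f - g" "f' - g'"] by (simp add: cong_def algebra_simps)

lemma cong_diff: "f \<approx> g \<Longrightarrow> f' \<approx> g' \<Longrightarrow> f - f' \<approx> g - g'"
  using J_diff[of "f - g" "f' - g'"] by (simp add: cong_def algebra_simps)

lemma cong_scale: "f \<approx> g \<Longrightarrow> pm_scale c f \<approx> pm_scale c g"
  using J_closed(3)[of "f - g"] by (simp add: cong_def pm_scale_diff)

lemma cong_sum: "(\<And>i. i \<in> S \<Longrightarrow> f i \<approx> g i) \<Longrightarrow> sum f S \<approx> sum g S"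
  using J_sum[of S "\<lambda>i. f i - g i"] by (simp add: cong_def sum_subtractf)

lemma cong_mult_left: "f \<approx> g \<Longrightarrow> h \<in> unital_words X \<Longrightarrow> h * f \<approx> h * g"
  using J_mult(1)[of "f - g" h] by (simp add: cong_def algebra_simps)

lemma cong_mult_right: "f \<approx> g \<Longrightarrow> h \<in> unital_words X \<Longrightarrow> f * h \<approx> g * h"
  using J_mult(2)[of "f - g" h] by (simp add: cong_def algebra_simps)

lemma cong_J: "f \<approx> g \<Longrightarrow> f \<in> J \<longleftrightarrow> g \<in> J"
  using cong_0 cong_sym cong_trans by blast

end

section \<open>Monomials modulo the Leavitt relations\<close>

abbreviation (input) proj :: "'v set \<Rightarrow> (('v, 'e) leavitt_gen free_monoid \<Rightarrow>\<^sub>0 'k::field)" where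
  "proj A \<equiv> gen_elem (Proj A)"

abbreviation (input) edge :: "'e \<Rightarrow> (('v, 'e) leavitt_gen free_monoid \<Rightarrow>\<^sub>0 'k::field)" where
  "edge e \<equiv> gen_elem (Edge e)"

abbreviation (input) ghost :: "'e \<Rightarrow> (('v, 'e) leavitt_gen free_monoid \<Rightarrow>\<^sub>0 'k::field)" where
  "ghost e \<equiv> gen_elem (Ghost e)"

definition path_elem :: "'e list \<Rightarrow> (('v, 'e) leavitt_gen free_monoid \<Rightarrow>\<^sub>0 'k::field)" where
  "path_elem \<alpha> = Poly_Mapping.single (Word (map Edge \<alpha>)) 1"

text \<open>The list \<beta> stays in path order while the word is reversed: the head of \<beta>
  becomes the last letter, the one that meets an edge multiplied from the right.\<close>

definition ghost_elem :: "'e list \<Rightarrow> (('v, 'e) leavitt_gen free_monoid \<Rightarrow>\<^sub>0 'k::field)" where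
  "ghost_elem \<beta> = Poly_Mapping.single (Word (map Ghost (rev \<beta>))) 1"

definition monomial ::
    "'e list \<Rightarrow> 'v set \<Rightarrow> 'e list \<Rightarrow> (('v, 'e) leavitt_gen free_monoid \<Rightarrow>\<^sub>0 'k::field)" where
  "monomial \<alpha> A \<beta> = path_elem \<alpha> * proj A * ghost_elem \<beta>"

lemma single_Word_append:
  "Poly_Mapping.single (Word u) (1::'k::field) * Poly_Mapping.single (Word w) 1
    = Poly_Mapping.single (Word (u @ w)) 1"
  by (simp add: mult_single plus_free_monoid_def)

lemma path_elem_simps [simp]:
  "path_elem [] = 1" "path_elem (e # \<alpha>) = edge e * path_elem \<alpha>"
  "path_elem (\<alpha> @ \<alpha>') = path_elem \<alpha> * path_elem \<alpha>'"
proof -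
  have "Poly_Mapping.single (Word []) (1::'k::field) = 1"
    by (metis zero_free_monoid_def single_one)
  then show "path_elem [] = 1" by (simp add: path_elem_def)
qed (simp_all add: path_elem_def gen_elem_def single_Word_append)

lemma ghost_elem_simps [simp]:
  "ghost_elem [] = 1" "ghost_elem (e # \<beta>) = ghost_elem \<beta> * ghost e"
  "ghost_elem (\<beta> @ \<beta>') = ghost_elem \<beta>' * ghost_elem \<beta>"
proof -
  have "Poly_Mapping.single (Word []) (1::'k::field) = 1"
    by (metis zero_free_monoid_def single_one)
  then show "ghost_elem [] = 1" by (simp add: ghost_elem_def)
qed (simp_all add: ghost_elem_def gen_elem_def single_Word_append)

lemma (in ultragraph) gen_verts_sub: "A \<in> gen_verts G \<Longrightarrow> A \<subseteq> verts G"
  by (induction rule: gen_verts.induct) (use rng_sub in auto)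

locale leavitt_ideal = ultragraph G + free_ideal "leavitt_gens G" J
  for G :: "('v, 'e) ultragraph"
    and J :: "(('v, 'e) leavitt_gen free_monoid \<Rightarrow>\<^sub>0 'k::field) set" +
  assumes relations: "leavitt_relations G \<subseteq> J"
begin

lemma gen_unital [simp, intro]:
  "A \<in> gen_verts G \<Longrightarrow> proj A \<in> unital_words (leavitt_gens G)"
  "e \<in> edges G \<Longrightarrow> edge e \<in> unital_words (leavitt_gens G)"
  "e \<in> edges G \<Longrightarrow> ghost e \<in> unital_words (leavitt_gens G)"
  by (auto simp: gen_elem_def leavitt_gens_def)

lemma path_unital [simp, intro]:
  "set \<alpha> \<subseteq> edges G \<Longrightarrow> path_elem \<alpha> \<in> unital_words (leavitt_gens G)"
  "set \<alpha> \<subseteq> edges G \<Longrightarrow> ghost_elem \<alpha> \<in> unital_words (leavitt_gens G)"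
  unfolding path_elem_def ghost_elem_def
  by (rule unital_words_closed(7), auto simp: leavitt_gens_def)+

lemma monomial_unital [simp, intro]:
  "set \<alpha> \<subseteq> edges G \<Longrightarrow> A \<in> gen_verts G \<Longrightarrow> set \<beta> \<subseteq> edges G
    \<Longrightarrow> monomial \<alpha> A \<beta> \<in> unital_words (leavitt_gens G)"
  by (auto simp: monomial_def)

lemma gen_verts_simps [simp, intro]:
  "{} \<in> gen_verts G"
  "v \<in> verts G \<Longrightarrow> {v} \<in> gen_verts G"
  "e \<in> edges G \<Longrightarrow> {src G e} \<in> gen_verts G"
  "e \<in> edges G \<Longrightarrow> rng G e \<in> gen_verts G"
  "A \<in> gen_verts G \<Longrightarrow> B \<in> gen_verts G \<Longrightarrow> A \<union> B \<in> gen_verts G"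
  "A \<in> gen_verts G \<Longrightarrow> B \<in> gen_verts G \<Longrightarrow> A \<inter> B \<in> gen_verts G"
  by (auto intro: gen_verts.intros src_in)

lemma proj_empty: "proj {} \<in> J"
  by (rule subsetD[OF relations leavitt_relations.proj_empty])

lemma proj_proj: "A \<in> gen_verts G \<Longrightarrow> B \<in> gen_verts G \<Longrightarrow> proj A * proj B \<approx> proj (A \<inter> B)"
  unfolding cong_def by (rule subsetD[OF relations leavitt_relations.proj_inter])

lemma proj_union: "A \<in> gen_verts G \<Longrightarrow> B \<in> gen_verts G
    \<Longrightarrow> proj (A \<union> B) \<approx> proj A + proj B - proj (A \<inter> B)"
  unfolding cong_def by (rule subsetD[OF relations leavitt_relations.proj_union])

lemma src_edge: "e \<in> edges G \<Longrightarrow> proj {src G e} * edge e \<approx> edge e"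
  and edge_rng: "e \<in> edges G \<Longrightarrow> edge e * proj (rng G e) \<approx> edge e"
  and rng_ghost: "e \<in> edges G \<Longrightarrow> proj (rng G e) * ghost e \<approx> ghost e"
  and ghost_src: "e \<in> edges G \<Longrightarrow> ghost e * proj {src G e} \<approx> ghost e"
  and ghost_edge: "e \<in> edges G \<Longrightarrow> f \<in> edges G
    \<Longrightarrow> ghost e * edge f \<approx> (if e = f then proj (rng G e) else 0)"
  unfolding cong_def by (intro subsetD[OF relations] leavitt_relations.intros; assumption)+

lemma regular: "is_regular G v
    \<Longrightarrow> proj {v} \<approx> (\<Sum>e \<in> {e \<in> edges G. src G e = v}. edge e * ghost e)"
  unfolding cong_def by (rule subsetD[OF relations leavitt_relations.regular])

lemma proj_singleton:
  assumes "A \<in> gen_verts G" "v \<in> verts G"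
  shows "proj A * proj {v} \<approx> (if v \<in> A then proj {v} else 0)"
    and "proj {v} * proj A \<approx> (if v \<in> A then proj {v} else 0)"
proof -
  have "A \<inter> {v} = (if v \<in> A then {v} else {})" "{v} \<inter> A = (if v \<in> A then {v} else {})" by auto
  with proj_proj[of A "{v}"] proj_proj[of "{v}" A] assms proj_empty
  show "proj A * proj {v} \<approx> (if v \<in> A then proj {v} else 0)"
    and "proj {v} * proj A \<approx> (if v \<in> A then proj {v} else 0)"
    using cong_trans[of _ "proj {}" 0] by (auto simp: cong_0 split: if_splits)
qed

lemma proj_edge:
  assumes "A \<in> gen_verts G" "e \<in> edges G"
  shows "proj A * edge e \<approx> (if src G e \<in> A then edge e else 0)"
proof -
  have "proj A * edge e \<approx> proj A * (proj {src G e} * edge e)"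
    using assms by (intro cong_mult_left cong_sym[OF src_edge]) auto
  also have "\<dots> = (proj A * proj {src G e}) * edge e" by (simp add: mult.assoc)
  also have "\<dots> \<approx> (if src G e \<in> A then proj {src G e} else 0) * edge e"
    using assms by (intro cong_mult_right proj_singleton) (auto intro: src_in)
  also have "\<dots> \<approx> (if src G e \<in> A then edge e else 0)"
    using src_edge[OF assms(2)] by auto
  finally show ?thesis .
qed

lemma ghost_proj:
  assumes "A \<in> gen_verts G" "e \<in> edges G"
  shows "ghost e * proj A \<approx> (if src G e \<in> A then ghost e else 0)"
proof -
  have "ghost e * proj A \<approx> (ghost e * proj {src G e}) * proj A"
    using assms by (intro cong_mult_right cong_sym[OF ghost_src]) auto
  also have "\<dots> = ghost e * (proj {src G e} * proj A)" by (simp add: mult.assoc)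
  also have "\<dots> \<approx> ghost e * (if src G e \<in> A then proj {src G e} else 0)"
    using assms by (intro cong_mult_left proj_singleton) (auto intro: src_in)
  also have "\<dots> \<approx> (if src G e \<in> A then ghost e else 0)"
    using ghost_src[OF assms(2)] by auto
  finally show ?thesis .
qed

text \<open>Neither list has to be a path. This keeps the class closed under products without case
  distinctions; lists \<alpha> that are not paths are disposed of later by
  \<open>nonpath_elem\<close>.\<close>

definition valid :: "'e list \<Rightarrow> 'v set \<Rightarrow> 'e list \<Rightarrow> bool" where
  "valid \<alpha> A \<beta> \<longleftrightarrow> set \<alpha> \<subseteq> edges G \<and> A \<in> gen_verts G \<and> set \<beta> \<subseteq> edges G"

lemma monomial_empty: "valid \<alpha> A \<beta> \<Longrightarrow> monomial \<alpha> {} \<beta> \<approx> 0"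
  unfolding cong_0 monomial_def by (intro J_mult) (auto simp: proj_empty valid_def)

text \<open>A vanishing product is recorded as a monomial with middle set \<open>{}\<close>, so the
  closure lemmas below need no separate outcome zero.\<close>

lemma cong_if_monomial:
  assumes "f \<approx> (if b then monomial \<alpha> A \<beta> else 0)" "valid \<alpha> A \<beta>"
  shows "f \<approx> monomial \<alpha> (if b then A else {}) \<beta>"
proof (cases b)
  case False
  with assms show ?thesis
    using cong_trans[OF _ cong_sym[OF monomial_empty]] by auto
qed (use assms in simp)

lemma proj_monomial:
  assumes v: "valid \<alpha> A \<beta>" and B: "B \<in> gen_verts G"
  shows "\<exists>A'. valid \<alpha> A' \<beta> \<and> proj B * monomial \<alpha> A \<beta> \<approx> monomial \<alpha> A' \<beta>"
proof (cases \<alpha>)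
  case Nil
  have "proj B * monomial \<alpha> A \<beta> = (proj B * proj A) * ghost_elem \<beta>"
    by (simp add: monomial_def Nil mult.assoc)
  also have "\<dots> \<approx> proj (B \<inter> A) * ghost_elem \<beta>"
    using v B by (intro cong_mult_right proj_proj) (auto simp: valid_def)
  also have "\<dots> = monomial \<alpha> (B \<inter> A) \<beta>" by (simp add: monomial_def Nil)
  finally show ?thesis using v B by (intro exI[of _ "B \<inter> A"]) (auto simp: valid_def)
next
  case (Cons e \<alpha>')
  let ?m = "path_elem \<alpha>' * proj A * ghost_elem \<beta>"
  have "proj B * monomial \<alpha> A \<beta> = (proj B * edge e) * ?m"
    by (simp add: monomial_def Cons mult.assoc)
  also have "\<dots> \<approx> (if src G e \<in> B then edge e else 0) * ?m"
    using v B by (intro cong_mult_right proj_edge) (auto simp: valid_def Cons)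
  also have "\<dots> = (if src G e \<in> B then monomial \<alpha> A \<beta> else 0)"
    by (simp add: monomial_def Cons mult.assoc)
  finally show ?thesis
    using cong_if_monomial[OF _ v] v
    by (intro exI[of _ "if src G e \<in> B then A else {}"]) (auto simp: valid_def)
qed

lemma monomial_proj:
  assumes v: "valid \<alpha> A \<beta>" and B: "B \<in> gen_verts G"
  shows "\<exists>A'. valid \<alpha> A' \<beta> \<and> monomial \<alpha> A \<beta> * proj B \<approx> monomial \<alpha> A' \<beta>"
proof (cases \<beta>)
  case Nil
  have "monomial \<alpha> A \<beta> * proj B = path_elem \<alpha> * (proj A * proj B)"
    by (simp add: monomial_def Nil mult.assoc)
  also have "\<dots> \<approx> path_elem \<alpha> * proj (A \<inter> B)"
    using v B by (intro cong_mult_left proj_proj) (auto simp: valid_def)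
  also have "\<dots> = monomial \<alpha> (A \<inter> B) \<beta>" by (simp add: monomial_def Nil)
  finally show ?thesis using v B by (intro exI[of _ "A \<inter> B"]) (auto simp: valid_def)
next
  case (Cons e \<beta>')
  let ?m = "path_elem \<alpha> * proj A * ghost_elem \<beta>'"
  have "monomial \<alpha> A \<beta> * proj B = ?m * (ghost e * proj B)"
    by (simp add: monomial_def Cons mult.assoc)
  also have "\<dots> \<approx> ?m * (if src G e \<in> B then ghost e else 0)"
    using v B by (intro cong_mult_left ghost_proj) (auto simp: valid_def Cons)
  also have "\<dots> = (if src G e \<in> B then monomial \<alpha> A \<beta> else 0)"
    by (simp add: monomial_def Cons mult.assoc)
  finally show ?thesis
    using cong_if_monomial[OF _ v] v
    by (intro exI[of _ "if src G e \<in> B then A else {}"]) (auto simp: valid_def)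
qed

lemma ghost_monomial:
  assumes v: "valid \<alpha> A \<beta>" and e: "e \<in> edges G"
  shows "\<exists>\<alpha>' A' \<beta>'. valid \<alpha>' A' \<beta>' \<and> ghost e * monomial \<alpha> A \<beta> \<approx> monomial \<alpha>' A' \<beta>'"
proof (cases \<alpha>)
  case Nil
  have "ghost e * monomial \<alpha> A \<beta> = (ghost e * proj A) * ghost_elem \<beta>"
    by (simp add: monomial_def Nil mult.assoc)
  also have "\<dots> \<approx> (if src G e \<in> A then ghost e else 0) * ghost_elem \<beta>"
    using v e by (intro cong_mult_right ghost_proj) (auto simp: valid_def)
  \<comment> \<open>The inserted factor \<open>proj (rng G e)\<close> supplies the middle projection
    that a monomial must have.\<close>
  also have "\<dots> \<approx> (if src G e \<in> A then proj (rng G e) * ghost e else 0) * ghost_elem \<beta>"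
    using v e by (intro cong_mult_right) (auto simp: valid_def cong_sym[OF rng_ghost])
  also have "\<dots> = (if src G e \<in> A then monomial [] (rng G e) (\<beta> @ [e]) else 0)"
    by (simp add: monomial_def mult.assoc)
  finally have "ghost e * monomial \<alpha> A \<beta> \<approx>
    monomial [] (if src G e \<in> A then rng G e else {}) (\<beta> @ [e])"
    using v e by (intro cong_if_monomial) (auto simp: valid_def)
  moreover have "valid [] (if src G e \<in> A then rng G e else {}) (\<beta> @ [e])"
    using v e by (auto simp: valid_def)
  ultimately show ?thesis by blast
next
  case (Cons f \<alpha>')
  have v': "valid \<alpha>' A \<beta>" and f: "f \<in> edges G" using v by (auto simp: valid_def Cons)
  have "ghost e * monomial \<alpha> A \<beta> = (ghost e * edge f) * monomial \<alpha>' A \<beta>"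
    by (simp add: monomial_def Cons mult.assoc)
  also have "\<dots> \<approx> (if e = f then proj (rng G e) else 0) * monomial \<alpha>' A \<beta>"
    using v' e f by (intro cong_mult_right ghost_edge) (auto simp: valid_def)
  finally have *: "ghost e * monomial \<alpha> A \<beta> \<approx>
    (if e = f then proj (rng G e) * monomial \<alpha>' A \<beta> else 0)" by (simp split: if_splits)
  obtain A' where A': "valid \<alpha>' A' \<beta>" "proj (rng G e) * monomial \<alpha>' A \<beta> \<approx> monomial \<alpha>' A' \<beta>"
    using proj_monomial[OF v', of "rng G e"] e by auto
  have v0: "valid \<alpha>' {} \<beta>" using v' by (simp add: valid_def)
  have "ghost e * monomial \<alpha> A \<beta> \<approx> monomial \<alpha>' {} \<beta>" if "e \<noteq> f"
    using * that cong_trans[OF _ cong_sym[OF monomial_empty[OF v']]] by auto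
  moreover have "ghost e * monomial \<alpha> A \<beta> \<approx> monomial \<alpha>' A' \<beta>" if "e = f"
    using * that cong_trans[OF _ A'(2)] by auto
  ultimately show ?thesis using A'(1) v0 by blast
qed

lemma edge_monomial: "edge e * monomial \<alpha> A \<beta> = monomial (e # \<alpha>) A \<beta>"
  by (simp add: monomial_def mult.assoc)

text \<open>The edge meets the head of \<beta> if there is one, and otherwise extends \<alpha>;
  \<open>tl\<close> covers both cases because the tail of the empty list is empty.\<close>

lemma monomial_edge:
  assumes v: "valid \<alpha> A \<beta>" and e: "e \<in> edges G"
  shows "\<exists>\<alpha>' A'. valid \<alpha>' A' (tl \<beta>) \<and> monomial \<alpha> A \<beta> * edge e \<approx> monomial \<alpha>' A' (tl \<beta>)"
proof (cases \<beta>)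
  case Nil
  have "monomial \<alpha> A \<beta> * edge e = path_elem \<alpha> * (proj A * edge e)"
    by (simp add: monomial_def Nil mult.assoc)
  also have "\<dots> \<approx> path_elem \<alpha> * (if src G e \<in> A then edge e else 0)"
    using v e by (intro cong_mult_left proj_edge) (auto simp: valid_def)
  also have "\<dots> \<approx> path_elem \<alpha> * (if src G e \<in> A then edge e * proj (rng G e) else 0)"
    using v e by (intro cong_mult_left) (auto simp: valid_def cong_sym[OF edge_rng])
  also have "\<dots> = (if src G e \<in> A then monomial (\<alpha> @ [e]) (rng G e) (tl \<beta>) else 0)"
    by (simp add: monomial_def mult.assoc Nil)
  finally have "monomial \<alpha> A \<beta> * edge e \<approx>
    monomial (\<alpha> @ [e]) (if src G e \<in> A then rng G e else {}) (tl \<beta>)"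
    using v e by (intro cong_if_monomial) (auto simp: valid_def Nil)
  moreover have "valid (\<alpha> @ [e]) (if src G e \<in> A then rng G e else {}) (tl \<beta>)"
    using v e by (auto simp: valid_def Nil)
  ultimately show ?thesis by blast
next
  case (Cons f \<beta>')
  have v': "valid \<alpha> A \<beta>'" and f: "f \<in> edges G" using v by (auto simp: valid_def Cons)
  have "monomial \<alpha> A \<beta> * edge e = monomial \<alpha> A \<beta>' * (ghost f * edge e)"
    by (simp add: monomial_def Cons mult.assoc)
  also have "\<dots> \<approx> monomial \<alpha> A \<beta>' * (if f = e then proj (rng G f) else 0)"
    using v' e f by (intro cong_mult_left ghost_edge) (auto simp: valid_def)
  finally have *: "monomial \<alpha> A \<beta> * edge e \<approx>
    (if f = e then monomial \<alpha> A \<beta>' * proj (rng G f) else 0)" by (simp split: if_splits)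
  obtain A' where A': "valid \<alpha> A' \<beta>'" "monomial \<alpha> A \<beta>' * proj (rng G f) \<approx> monomial \<alpha> A' \<beta>'"
    using monomial_proj[OF v', of "rng G f"] f by auto
  have v0: "valid \<alpha> {} \<beta>'" using v' by (simp add: valid_def)
  have "monomial \<alpha> A \<beta> * edge e \<approx> monomial \<alpha> {} \<beta>'" if "f \<noteq> e"
    using * that cong_trans[OF _ cong_sym[OF monomial_empty[OF v']]] by auto
  moreover have "monomial \<alpha> A \<beta> * edge e \<approx> monomial \<alpha> A' \<beta>'" if "f = e"
    using * that cong_trans[OF _ A'(2)] by auto
  moreover have "tl \<beta> = \<beta>'" by (simp add: Cons)
  ultimately show ?thesis using A'(1) v0 by metis
qed

lemma word_monomial:
  assumes "gs \<noteq> []" "set gs \<subseteq> leavitt_gens G"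
  shows "\<exists>\<alpha> A \<beta>. valid \<alpha> A \<beta> \<and> Poly_Mapping.single (Word gs) 1 \<approx> monomial \<alpha> A \<beta>"
  using assms
proof (induction gs rule: list_nonempty_induct)
  case (single x)
  then consider e where "x = Edge e" "e \<in> edges G" | e where "x = Ghost e" "e \<in> edges G"
    | A where "x = Proj A" "A \<in> gen_verts G" by (auto simp: leavitt_gens_def)
  then show ?case
  proof cases
    case 1
    then have "valid [e] (rng G e) []"
      "Poly_Mapping.single (Word [x]) 1 \<approx> monomial [e] (rng G e) []"
      using cong_sym[OF edge_rng[of e]] by (auto simp: valid_def monomial_def gen_elem_def)
    then show ?thesis by blast
  next
    case 2
    then have "valid [] (rng G e) [e]"
      "Poly_Mapping.single (Word [x]) 1 \<approx> monomial [] (rng G e) [e]"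
      using cong_sym[OF rng_ghost[of e]] by (auto simp: valid_def monomial_def gen_elem_def)
    then show ?thesis by blast
  next
    case 3
    then have "valid [] A []" "Poly_Mapping.single (Word [x]) 1 \<approx> monomial [] A []"
      by (auto simp: valid_def monomial_def gen_elem_def)
    then show ?thesis by blast
  qed
next
  case (cons x gs)
  then obtain \<alpha> A \<beta> where v: "valid \<alpha> A \<beta>"
    and m: "Poly_Mapping.single (Word gs) 1 \<approx> monomial \<alpha> A \<beta>" by auto
  have x: "x \<in> leavitt_gens G" using cons by auto
  have "Poly_Mapping.single (Word (x # gs)) 1 = gen_elem x * Poly_Mapping.single (Word gs) (1::'k)"
    by (simp add: gen_elem_def single_Word_append)
  also have "\<dots> \<approx> gen_elem x * monomial \<alpha> A \<beta>"
    using x by (intro cong_mult_left m) (auto simp: gen_elem_def)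
  finally have *: "Poly_Mapping.single (Word (x # gs)) 1 \<approx> gen_elem x * monomial \<alpha> A \<beta>" .
  from x consider e where "x = Edge e" "e \<in> edges G" | e where "x = Ghost e" "e \<in> edges G"
    | B where "x = Proj B" "B \<in> gen_verts G" by (auto simp: leavitt_gens_def)
  then show ?case
  proof cases
    case 1
    then have "valid (e # \<alpha>) A \<beta>" "gen_elem x * monomial \<alpha> A \<beta> = monomial (e # \<alpha>) A \<beta>"
      using v edge_monomial by (auto simp: valid_def)
    then show ?thesis using * by metis
  next
    case 2
    with * have "Poly_Mapping.single (Word (x # gs)) 1 \<approx> ghost e * monomial \<alpha> A \<beta>" by simp
    from cong_trans[OF this] ghost_monomial[OF v \<open>e \<in> edges G\<close>] show ?thesis by blast
  next
    case 3
    with * have "Poly_Mapping.single (Word (x # gs)) 1 \<approx> proj B * monomial \<alpha> A \<beta>" by simp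
    from cong_trans[OF this] proj_monomial[OF v \<open>B \<in> gen_verts G\<close>] show ?thesis by blast
  qed
qed

text \<open>Including \<open>J\<close> makes membership depend on classes only
  (\<open>depth_cong\<close>). Ghost length is measured rather than total length because it is what
  right multiplication by an edge lowers.\<close>

inductive_set depth :: "nat \<Rightarrow> (('v, 'e) leavitt_gen free_monoid \<Rightarrow>\<^sub>0 'k) set" for n where
  ideal: "f \<in> J \<Longrightarrow> f \<in> depth n"
| mono: "valid \<alpha> A \<beta> \<Longrightarrow> length \<beta> \<le> n \<Longrightarrow> pm_scale c (monomial \<alpha> A \<beta>) \<in> depth n"
| add: "f \<in> depth n \<Longrightarrow> g \<in> depth n \<Longrightarrow> f + g \<in> depth n"

lemma depth_cong: "f \<approx> g \<Longrightarrow> g \<in> depth n \<Longrightarrow> f \<in> depth n"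
  using depth.add[OF depth.ideal, of "f - g" g] by (simp add: cong_def)

lemma depth_mono: "f \<in> depth m \<Longrightarrow> m \<le> n \<Longrightarrow> f \<in> depth n"
proof (induction rule: depth.induct)
  case (mono \<alpha> A \<beta> c)
  then show ?case by (intro depth.mono) simp_all
qed (simp_all add: depth.ideal depth.add)

lemma carrier_depth:
  assumes "f \<in> acarrier (free_algebra (leavitt_gens G))"
  shows "\<exists>n. f \<in> depth n"
proof -
  have *: "\<exists>n. sum h S \<in> depth n" if "\<And>i. i \<in> S \<Longrightarrow> \<exists>n. h i \<in> depth n" for h :: "_ \<Rightarrow> _" and S
    using that
  proof (induction S rule: infinite_finite_induct)
    case (insert x S)
    obtain m where "h x \<in> depth m" using insert.prems[of x] by blast
    moreover obtain n where "sum h S \<in> depth n"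
      using insert.IH insert.prems by blast
    ultimately have "h x + sum h S \<in> depth (max m n)"
      by (intro depth.add; elim depth_mono) simp_all
    with insert show ?case by auto
  qed (use depth.ideal[of 0 0] in auto)
  have "\<exists>n. (\<Sum>w\<in>Poly_Mapping.keys f. Poly_Mapping.single w (Poly_Mapping.lookup f w)) \<in> depth n"
  proof (rule *)
    fix w assume "w \<in> Poly_Mapping.keys f"
    then obtain gs where w: "w = Word gs" and "gs \<noteq> []" "set gs \<subseteq> leavitt_gens G"
      using assms by (cases w) (auto simp: free_algebra_def)
    then obtain \<alpha> A \<beta> where v: "valid \<alpha> A \<beta>"
      and m: "Poly_Mapping.single (Word gs) 1 \<approx> monomial \<alpha> A \<beta>" using word_monomial by blast
    let ?c = "Poly_Mapping.lookup f w"
    have "Poly_Mapping.single w ?c = pm_scale ?c (Poly_Mapping.single (Word gs) 1)"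
      by (intro poly_mapping_eqI) (auto simp: w lookup_single when_def)
    also have "\<dots> \<approx> pm_scale ?c (monomial \<alpha> A \<beta>)" using m by (rule cong_scale)
    finally show "\<exists>n. Poly_Mapping.single w ?c \<in> depth n"
      using depth_cong depth.mono[OF v le_refl] by blast
  qed
  then show ?thesis by (simp add: sum_single_keys)
qed

lemma depth_edge:
  assumes "f \<in> depth n" "e \<in> edges G"
  shows "f * edge e \<in> depth (n - 1)"
  using assms(1)
proof (induction rule: depth.induct)
  case (ideal f)
  then show ?case using assms(2) by (intro depth.ideal J_mult) auto
next
  case (mono \<alpha> A \<beta> c)
  then obtain \<alpha>' A' where "valid \<alpha>' A' (tl \<beta>)" "monomial \<alpha> A \<beta> * edge e \<approx> monomial \<alpha>' A' (tl \<beta>)"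
    using monomial_edge assms(2) by blast
  with mono show ?case unfolding pm_scale_mult_left
    by (elim depth_cong[OF cong_scale] , intro depth.mono) auto
qed (simp add: distrib_right depth.add)

end

section \<open>Injectivity on ghost-free elements and induction on ghost length\<close>

lemma is_path_Cons:
  "is_path G (e # f # \<alpha>) \<longleftrightarrow> e \<in> edges G \<and> src G f \<in> rng G e \<and> is_path G (f # \<alpha>)"
proof -
  have *: "(\<forall>i. Q i) \<longleftrightarrow> Q 0 \<and> (\<forall>i. Q (Suc i))" for Q :: "nat \<Rightarrow> bool"
    by (metis not0_implies_Suc)
  show ?thesis
    unfolding is_path_def by (subst *) auto
qed

lemma is_path_single: "is_path G [e] \<longleftrightarrow> e \<in> edges G"
  by (simp add: is_path_def)

lemma is_path_snoc:
  assumes "is_path G \<alpha>" "e \<in> edges G" "src G e \<in> path_rng G \<alpha>"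
  shows "is_path G (\<alpha> @ [e])"
  using assms
proof (induction \<alpha>)
  case (Cons f \<alpha>)
  then show ?case
    by (cases \<alpha>) (auto simp: is_path_Cons is_path_single path_rng_def)
qed (simp add: is_path_def)

text \<open>The empty list ends everywhere because \<open>path_elem [] * proj {v}\<close> is
  \<open>proj {v}\<close>.\<close>

definition ends_at :: "('v, 'e) ultragraph \<Rightarrow> 'e list \<Rightarrow> 'v \<Rightarrow> bool" where
  "ends_at G \<alpha> v \<longleftrightarrow> \<alpha> = [] \<or> is_path G \<alpha> \<and> v \<in> path_rng G \<alpha>"

context leavitt_ideal
begin

text \<open>Here y is a combination of projections and h the same combination of indicator
  functions. It is a relation since one h may come from many combinations;
  \<open>simple_zero\<close> shows that modulo \<open>J\<close> only h matters.\<close>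

inductive simple :: "(('v, 'e) leavitt_gen free_monoid \<Rightarrow>\<^sub>0 'k) \<Rightarrow> ('v \<Rightarrow> 'k) \<Rightarrow> bool" where
  zero: "simple 0 (\<lambda>_. 0)"
| step: "simple y h \<Longrightarrow> A \<in> gen_verts G
    \<Longrightarrow> simple (y + pm_scale c (proj A)) (\<lambda>v. h v + (if v \<in> A then c else 0))"

lemma simple_unital [simp]: "simple y h \<Longrightarrow> y \<in> unital_words (leavitt_gens G)"
  by (induction rule: simple.induct) auto

lemma simple_support: "simple y h \<Longrightarrow> h v \<noteq> 0 \<Longrightarrow> v \<in> verts G"
  by (induction rule: simple.induct) (use gen_verts_sub in \<open>auto split: if_splits\<close>)

lemma simple_edge:
  assumes "simple y h" "e \<in> edges G"
  shows "y * edge e \<approx> pm_scale (h (src G e)) (edge e)"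
  using assms(1)
proof (induction rule: simple.induct)
  case (step y h A c)
  have "(y + pm_scale c (proj A)) * edge e = y * edge e + pm_scale c (proj A * edge e)"
    by (simp add: distrib_right pm_scale_mult_left)
  also have "\<dots> \<approx> pm_scale (h (src G e)) (edge e)
      + pm_scale c (if src G e \<in> A then edge e else 0)"
    using step assms by (intro cong_add cong_scale proj_edge)
  finally show ?case by (auto simp: pm_scale_add_left split: if_splits)
qed simp

lemma simple_vertex:
  assumes "simple y h" "v \<in> verts G"
  shows "y * proj {v} \<approx> pm_scale (h v) (proj {v})"
  using assms(1)
proof (induction rule: simple.induct)
  case (step y h A c)
  have "(y + pm_scale c (proj A)) * proj {v} = y * proj {v} + pm_scale c (proj A * proj {v})"
    by (simp add: distrib_right pm_scale_mult_left)
  also have "\<dots> \<approx> pm_scale (h v) (proj {v}) + pm_scale c (if v \<in> A then proj {v} else 0)"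
    using step assms by (intro cong_add cong_scale proj_singleton)
  finally show ?case by (auto simp: pm_scale_add_left split: if_splits)
qed simp

lemma simple_add: "simple y' h' \<Longrightarrow> simple y h \<Longrightarrow> simple (y + y') (\<lambda>v. h v + h' v)"
proof (induction rule: simple.induct)
  case (step y' h' A c)
  from simple.step[OF step.IH[OF step.prems] step.hyps(2), of c]
  show ?case by (simp add: add.assoc)
qed simp

lemma simple_sum:
  assumes "simple y h" "finite S" "S \<subseteq> verts G"
  shows "simple (y + (\<Sum>v\<in>S. pm_scale (g v) (proj {v}))) (\<lambda>v. h v + (if v \<in> S then g v else 0))"
  using assms(2,3)
proof (induction S rule: finite_induct)
  case (insert w S)
  have "simple ((y + (\<Sum>v\<in>S. pm_scale (g v) (proj {v}))) + pm_scale (g w) (proj {w}))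
    (\<lambda>v. (h v + (if v \<in> S then g v else 0)) + (if v \<in> {w} then g w else 0))"
    using insert by (intro simple.step) auto
  also have "(\<lambda>v. (h v + (if v \<in> S then g v else 0)) + (if v \<in> {w} then g w else 0))
    = (\<lambda>v. h v + (if v \<in> insert w S then g v else 0))"
    using insert by auto
  finally show ?case using insert by (simp add: ac_simps)
qed (use assms in simp)

text \<open>The union of the sets occurring in y acts as a right unit; it stands in for the unit
  that the algebra may lack.\<close>

lemma simple_bound: "simple y h \<Longrightarrow> \<exists>B\<in>gen_verts G. y * proj B \<approx> y"
proof (induction rule: simple.induct)
  case (step y h A c)
  then obtain B where B: "B \<in> gen_verts G" "y * proj B \<approx> y" by auto
  let ?D = "proj (B \<union> A)"
  have "y * ?D \<approx> (y * proj B) * ?D"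
    using B step by (intro cong_mult_right cong_sym[OF B(2)]) auto
  also have "\<dots> = y * (proj B * ?D)" by (simp add: mult.assoc)
  also have "\<dots> \<approx> y * proj (B \<inter> (B \<union> A))"
    using B step by (intro cong_mult_left proj_proj) auto
  also have "\<dots> \<approx> y" using B by (simp add: Int_absorb2)
  finally have 1: "y * ?D \<approx> y" .
  have 2: "proj A * ?D \<approx> proj A"
    using proj_proj[of A "B \<union> A"] B step by (simp add: Int_absorb2)
  have "(y + pm_scale c (proj A)) * ?D = y * ?D + pm_scale c (proj A * ?D)"
    by (simp add: distrib_right pm_scale_mult_left)
  also have "\<dots> \<approx> y + pm_scale c (proj A)" by (intro cong_add cong_scale 1 2)
  finally show ?case using B step by (intro bexI[of _ "B \<union> A"]) auto
qed (auto intro: bexI[of _ "{}"])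

text \<open>The sets in \<open>gen_verts G\<close> are not closed under differences, so the difference
  \<open>B - U\<close> is represented by \<open>proj B - proj (B \<inter> U)\<close>; it is split along each new set \<open>A\<close>.\<close>

lemma simple_local:
  assumes "simple y h" "B \<in> gen_verts G" "U \<in> gen_verts G" "\<forall>v\<in>B - U. c + h v = 0"
  shows "(pm_scale c 1 + y) * (proj B - proj (B \<inter> U)) \<in> J"
  using assms
proof (induction arbitrary: B U c rule: simple.induct)
  case zero
  show ?case
  proof (cases "B \<subseteq> U")
    case True
    then show ?thesis by (simp add: Int_absorb2)
  next
    case False
    with zero have "c = 0" by auto
    then show ?thesis by simp
  qed
next
  case (step y h A d)
  note [simp] = step.hyps(2) step.prems(1,2)
  let ?X1 = "proj (B \<inter> A) - proj ((B \<inter> A) \<inter> U)"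
  let ?X2 = "proj B - proj (B \<inter> (U \<union> A))"
  let ?y = "pm_scale c 1 + (y + pm_scale d (proj A))"
  note y = simple_unital[OF step.hyps(1)]
  have yu: "?y \<in> unital_words (leavitt_gens G)" using y by auto
  have sets: "(B \<inter> U) \<union> (B \<inter> A) = B \<inter> (U \<union> A)" "(B \<inter> U) \<inter> (B \<inter> A) = (B \<inter> A) \<inter> U"
    "A \<inter> (B \<inter> A) = B \<inter> A" "A \<inter> ((B \<inter> A) \<inter> U) = (B \<inter> A) \<inter> U"
    "A \<inter> (B \<inter> (U \<union> A)) = A \<inter> B" by auto
  have "?X1 + ?X2 \<approx> proj B - proj (B \<inter> U)"
    using proj_union[of "B \<inter> U" "B \<inter> A"] by (simp add: sets cong_def algebra_simps)
      (metis J_uminus minus_diff_eq add_diff_eq diff_diff_eq2 diff_add_eq)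
  then have split: "proj B - proj (B \<inter> U) \<approx> ?X1 + ?X2" by (rule cong_sym)
  have A1: "proj A * ?X1 \<approx> ?X1"
    unfolding right_diff_distrib
    using proj_proj[of A "B \<inter> A"] proj_proj[of A "(B \<inter> A) \<inter> U"]
    by (intro cong_diff) (simp_all add: sets)
  have "proj A * ?X2 \<approx> proj (A \<inter> B) - proj (A \<inter> B)"
    unfolding right_diff_distrib
    using proj_proj[of A B] proj_proj[of A "B \<inter> (U \<union> A)"]
    by (intro cong_diff) (simp_all add: sets)
  then have A2: "proj A * ?X2 \<approx> 0" by simp
  \<comment> \<open>Inside \<open>A\<close> the projection acts as the identity, so d is absorbed
    into the scalar c; outside \<open>A\<close> it acts as zero and the excluded set grows to
    \<open>U \<union> A\<close>. This is why c, B and U vary in the induction.\<close>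
  have "?y * ?X1 = (pm_scale c 1 + y) * ?X1 + pm_scale d (proj A * ?X1)"
    by (simp add: distrib_right pm_scale_mult_left)
  also have "\<dots> \<approx> (pm_scale c 1 + y) * ?X1 + pm_scale d ?X1"
    by (intro cong_add cong_scale A1) simp
  also have "\<dots> = (pm_scale (c + d) 1 + y) * ?X1"
    by (simp add: distrib_right pm_scale_mult_left pm_scale_add_left)
  also have "\<dots> \<approx> 0"
    unfolding cong_0
  proof (intro step.IH ballI)
    fix v assume "v \<in> B \<inter> A - U"
    with step.prems(3)[rule_format, of v] show "(c + d) + h v = 0" by (simp add: ac_simps)
  qed simp_all
  finally have y1: "?y * ?X1 \<approx> 0" .
  have "?y * ?X2 = (pm_scale c 1 + y) * ?X2 + pm_scale d (proj A * ?X2)"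
    by (simp add: distrib_right pm_scale_mult_left)
  also have "\<dots> \<approx> (pm_scale c 1 + y) * ?X2 + pm_scale d 0"
    by (intro cong_add cong_scale A2) simp
  also have "\<dots> = (pm_scale c 1 + y) * ?X2" by simp
  also have "\<dots> \<approx> 0"
    unfolding cong_0
  proof (intro step.IH ballI)
    fix v assume "v \<in> B - (U \<union> A)"
    with step.prems(3)[rule_format, of v] show "c + h v = 0" by simp
  qed simp_all
  finally have y2: "?y * ?X2 \<approx> 0" .
  have "?y * (proj B - proj (B \<inter> U)) \<approx> ?y * (?X1 + ?X2)"
    by (rule cong_mult_left[OF split yu])
  also have "\<dots> = ?y * ?X1 + ?y * ?X2" by (rule distrib_left)
  also have "\<dots> \<approx> 0 + 0" by (intro cong_add y1 y2)
  finally show ?case by (simp add: cong_0)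
qed

text \<open>With B a right unit of y and U empty, the localisation in \<open>simple_local\<close>
  loses nothing.\<close>

lemma simple_zero:
  assumes "simple y h" "\<forall>v. h v = 0"
  shows "y \<in> J"
proof -
  obtain B where B: "B \<in> gen_verts G" "y * proj B \<approx> y" using simple_bound[OF assms(1)] by auto
  have "(pm_scale 0 1 + y) * (proj B - proj (B \<inter> {})) \<in> J"
    using B assms by (intro simple_local) auto
  then have "y * proj B - y * proj {} \<in> J" by (simp add: right_diff_distrib)
  moreover have "y * proj {} \<in> J"
    using simple_unital[OF assms(1)] by (intro J_mult proj_empty)
  ultimately have "y * proj B \<in> J" using J_closed(2) by fastforce
  then show ?thesis using cong_J[OF B(2)] by simp
qed

text \<open>Subtracting the vertex terms leaves a combination with zero coefficient function, even
  if infinite sets occur in y.\<close>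

lemma simple_finite_support:
  assumes "simple y h" "finite S" "S \<subseteq> verts G" "\<And>v. h v \<noteq> 0 \<Longrightarrow> v \<in> S"
  shows "y \<approx> (\<Sum>v\<in>S. pm_scale (h v) (proj {v}))"
proof -
  have "y + (\<Sum>v\<in>S. pm_scale (- h v) (proj {v})) \<in> J"
    by (rule simple_zero[OF simple_sum[OF assms(1-3)]]) (use assms(4) in auto)
  moreover have "pm_scale (- c) f = - pm_scale c f" for c and f :: "('v, 'e) leavitt_gen free_monoid \<Rightarrow>\<^sub>0 'k"
    by (intro poly_mapping_eqI) simp
  ultimately show ?thesis by (simp add: cong_def sum_negf)
qed

text \<open>At a break, \<open>edge e * edge f\<close> equals
  \<open>edge e * proj (rng G e) * edge f\<close> modulo \<open>J\<close>, and the projection kills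
  \<open>edge f\<close> because the source of f lies outside the range of e.\<close>

lemma nonpath_elem:
  assumes "set \<alpha> \<subseteq> edges G" "\<alpha> \<noteq> []" "\<not> is_path G \<alpha>"
  shows "path_elem \<alpha> \<in> J"
  using assms
proof (induction \<alpha>)
  case (Cons e \<alpha>)
  then obtain f \<alpha>' where \<alpha>: "\<alpha> = f # \<alpha>'" by (cases \<alpha>) (auto simp: is_path_single)
  have e: "e \<in> edges G" "f \<in> edges G" using Cons.prems \<alpha> by auto
  show ?case
  proof (cases "src G f \<in> rng G e")
    case True
    then have "path_elem \<alpha> \<in> J" using Cons \<alpha> e by (auto simp: is_path_Cons)
    then show ?thesis using e by (simp add: J_mult)
  next
    case False
    have "edge e * edge f \<approx> (edge e * proj (rng G e)) * edge f"
      using e by (intro cong_mult_right cong_sym[OF edge_rng]) auto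
    also have "\<dots> = edge e * (proj (rng G e) * edge f)" by (simp add: mult.assoc)
    also have "\<dots> \<approx> edge e * 0"
      using e proj_edge[of "rng G e" f] False by (intro cong_mult_left) auto
    finally have "edge e * edge f \<in> J" by (simp add: cong_0)
    then have "(edge e * edge f) * path_elem \<alpha>' \<in> J"
      by (rule J_mult(2)) (use Cons.prems \<alpha> in auto)
    then show ?thesis by (simp add: \<alpha> mult.assoc)
  qed
qed simp

text \<open>An edge absorbs its range projection on the right, so the middle set can be cut down to
  the range of the last edge. Afterwards each coefficient belongs to a path that really ends at its
  vertex, as \<open>separates\<close> demands.\<close>

lemma monomial_ends_at:
  assumes v: "valid \<alpha> A []"
  shows "\<exists>A'\<in>gen_verts G. (\<forall>v\<in>A'. ends_at G \<alpha> v) \<and> monomial \<alpha> A [] \<approx> path_elem \<alpha> * proj A'"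
proof (cases "\<alpha> = []")
  case True
  then show ?thesis using v
    by (intro bexI[of _ A]) (auto simp: ends_at_def monomial_def valid_def)
next
  case False
  then obtain \<alpha>' e where \<alpha>: "\<alpha> = \<alpha>' @ [e]" by (cases \<alpha> rule: rev_cases) auto
  show ?thesis
  proof (cases "is_path G \<alpha>")
    case True
    have e: "e \<in> edges G" "set \<alpha>' \<subseteq> edges G" "A \<in> gen_verts G"
      using v \<alpha> by (auto simp: valid_def)
    have "monomial \<alpha> A [] = path_elem \<alpha>' * edge e * proj A"
      by (simp add: monomial_def \<alpha> mult.assoc)
    also have "\<dots> \<approx> path_elem \<alpha>' * (edge e * proj (rng G e)) * proj A"
      using e by (intro cong_mult_right cong_mult_left cong_sym[OF edge_rng]) auto
    also have "\<dots> = path_elem \<alpha> * (proj (rng G e) * proj A)" by (simp add: \<alpha> mult.assoc)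
    also have "\<dots> \<approx> path_elem \<alpha> * proj (rng G e \<inter> A)"
      using e \<alpha> by (intro cong_mult_left proj_proj path_unital(1)) auto
    finally show ?thesis using e True
      by (intro bexI[of _ "rng G e \<inter> A"]) (auto simp: ends_at_def path_rng_def \<alpha>)
  next
    case False
    have "path_elem \<alpha> \<in> J" using v \<open>\<alpha> \<noteq> []\<close> False by (intro nonpath_elem) (auto simp: valid_def)
    then have "monomial \<alpha> A [] \<in> J" "path_elem \<alpha> * proj {} \<in> J"
      using v by (auto simp: monomial_def valid_def intro!: J_mult)
    then have "monomial \<alpha> A [] \<approx> path_elem \<alpha> * proj {}" by (simp add: cong_def)
    then show ?thesis by (intro bexI[of _ "{}"]) auto
  qed
qed

text \<open>The \<open>ends_at\<close> clause gives the coefficients a meaning: if \<alpha> does not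
  end at v, then \<open>path_elem \<alpha> * proj {v}\<close> lies in \<open>J\<close> and its
  coefficient could not be recovered.\<close>

definition real_form where
  "real_form r P y h \<longleftrightarrow> finite P \<and> (\<forall>\<alpha>\<in>P. set \<alpha> \<subseteq> edges G \<and> simple (y \<alpha>) (h \<alpha>)
    \<and> (\<forall>v. h \<alpha> v \<noteq> 0 \<longrightarrow> ends_at G \<alpha> v)) \<and> r \<approx> (\<Sum>\<alpha>\<in>P. path_elem \<alpha> * y \<alpha>)"

lemma real_form_J: "r \<in> J \<Longrightarrow> real_form r {} y h"
  by (simp add: real_form_def cong_0)

lemma real_form_monomial:
  assumes "valid \<alpha> A []"
  shows "\<exists>P y h. real_form (pm_scale c (monomial \<alpha> A [])) P y h"
proof -
  obtain A' where A': "A' \<in> gen_verts G" "\<forall>v\<in>A'. ends_at G \<alpha> v"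
    and m: "monomial \<alpha> A [] \<approx> path_elem \<alpha> * proj A'"
    using monomial_ends_at[OF assms] by auto
  have "pm_scale c (monomial \<alpha> A []) \<approx> pm_scale c (path_elem \<alpha> * proj A')"
    by (rule cong_scale[OF m])
  then have "pm_scale c (monomial \<alpha> A []) \<approx> path_elem \<alpha> * (0 + pm_scale c (proj A'))"
    by (simp add: pm_scale_mult_right)
  moreover have "simple (0 + pm_scale c (proj A')) (\<lambda>v. 0 + (if v \<in> A' then c else 0))"
    by (rule simple.step[OF simple.zero A'(1)])
  ultimately have "real_form (pm_scale c (monomial \<alpha> A [])) {\<alpha>}
      (\<lambda>_. 0 + pm_scale c (proj A')) (\<lambda>_ v. 0 + (if v \<in> A' then c else 0))"
    using assms A' by (auto simp: real_form_def valid_def)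
  then show ?thesis by blast
qed

lemma real_form_add:
  assumes "real_form r P y h" "real_form r' P' y' h'"
  shows "\<exists>P y h. real_form (r + r') P y h"
proof -
  have fin: "finite P" "finite P'" using assms by (auto simp: real_form_def)
  let ?y = "\<lambda>\<alpha>. (if \<alpha> \<in> P then y \<alpha> else 0) + (if \<alpha> \<in> P' then y' \<alpha> else 0)"
  let ?h = "\<lambda>\<alpha> v. (if \<alpha> \<in> P then h \<alpha> else (\<lambda>_. 0)) v + (if \<alpha> \<in> P' then h' \<alpha> else (\<lambda>_. 0)) v"
  have 1: "(\<Sum>\<alpha>\<in>P. path_elem \<alpha> * y \<alpha>)
      = (\<Sum>\<alpha>\<in>P \<union> P'. path_elem \<alpha> * (if \<alpha> \<in> P then y \<alpha> else 0))"
    using fin by (intro sum.mono_neutral_cong_left) auto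
  have 2: "(\<Sum>\<alpha>\<in>P'. path_elem \<alpha> * y' \<alpha>)
      = (\<Sum>\<alpha>\<in>P \<union> P'. path_elem \<alpha> * (if \<alpha> \<in> P' then y' \<alpha> else 0))"
    using fin by (intro sum.mono_neutral_cong_left) auto
  have "r + r' \<approx> (\<Sum>\<alpha>\<in>P. path_elem \<alpha> * y \<alpha>) + (\<Sum>\<alpha>\<in>P'. path_elem \<alpha> * y' \<alpha>)"
    using assms by (intro cong_add) (auto simp: real_form_def)
  also have "\<dots> = (\<Sum>\<alpha>\<in>P \<union> P'. path_elem \<alpha> * ?y \<alpha>)"
    unfolding 1 2 by (simp add: sum.distrib distrib_left)
  finally have sum: "r + r' \<approx> (\<Sum>\<alpha>\<in>P \<union> P'. path_elem \<alpha> * ?y \<alpha>)" .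
  have "ends_at G \<alpha> v" if "?h \<alpha> v \<noteq> 0" for \<alpha> v
  proof -
    have "\<alpha> \<in> P \<and> h \<alpha> v \<noteq> 0 \<or> \<alpha> \<in> P' \<and> h' \<alpha> v \<noteq> 0"
      using that by (auto split: if_splits)
    then show ?thesis using assms by (auto simp: real_form_def)
  qed
  then have "real_form (r + r') (P \<union> P') ?y ?h"
    unfolding real_form_def using assms fin sum
    by (intro conjI ballI simple_add allI) (auto simp: real_form_def simple.zero)
  then show ?thesis by blast
qed

lemma depth_0_real:
  assumes "f \<in> depth 0"
  shows "\<exists>P y h. real_form f P y h"
  using assms
proof (induction rule: depth.induct)
  case (ideal f)
  then show ?case using real_form_J by blast
next
  case (mono \<alpha> A \<beta> c)
  then show ?case using real_form_monomial by auto
next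
  case (add f g)
  then show ?case using real_form_add by blast
qed

text \<open>An intrinsic substitute for "combination of monomials whose \<beta> starts with an edge
  in \<open>E\<close>". It yields
  \<open>g * (1 - (\<Sum>e\<in>E. edge e * ghost e)) \<approx> 0\<close> and survives sums and
  finite enlargements of \<open>E\<close>.\<close>

definition ghost_part where
  "ghost_part g E \<longleftrightarrow> g \<in> unital_words (leavitt_gens G) \<and> finite E \<and> E \<subseteq> edges G \<and>
     g \<approx> (\<Sum>e\<in>E. g * edge e * ghost e) \<and> (\<forall>e\<in>edges G - E. g * edge e \<in> J)"

lemma ghost_part_mono:
  assumes "ghost_part g E" "E \<subseteq> E'" "finite E'" "E' \<subseteq> edges G"
  shows "ghost_part g E'"
proof -
  have "(\<Sum>e\<in>E' - E. g * edge e * ghost e) \<in> J"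
    by (rule J_sum, rule J_mult(2)) (use assms in \<open>auto simp: ghost_part_def\<close>)
  then have "(\<Sum>e\<in>E' - E. g * edge e * ghost e) + (\<Sum>e\<in>E. g * edge e * ghost e)
      \<approx> 0 + (\<Sum>e\<in>E. g * edge e * ghost e)"
    by (intro cong_add) (auto simp: cong_0)
  then have "(\<Sum>e\<in>E. g * edge e * ghost e) \<approx> (\<Sum>e\<in>E'. g * edge e * ghost e)"
    using sum.subset_diff[OF assms(2,3), of "\<lambda>e. g * edge e * ghost e"]
    by (simp add: cong_sym)
  moreover have "g \<approx> (\<Sum>e\<in>E. g * edge e * ghost e)"
    using assms(1) by (simp add: ghost_part_def)
  ultimately have "g \<approx> (\<Sum>e\<in>E'. g * edge e * ghost e)" by (rule cong_trans[rotated])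
  with assms show ?thesis by (auto simp: ghost_part_def)
qed

lemma ghost_part_add:
  assumes "ghost_part g E" "ghost_part g' E"
  shows "ghost_part (g + g') E"
proof -
  have "g + g' \<approx> (\<Sum>e\<in>E. g * edge e * ghost e) + (\<Sum>e\<in>E. g' * edge e * ghost e)"
    using assms by (intro cong_add) (auto simp: ghost_part_def)
  then show ?thesis using assms
    by (auto simp: ghost_part_def distrib_right sum.distrib)
qed

lemma ghost_part_monomial:
  assumes v: "valid \<alpha> A (e # \<beta>)"
  shows "ghost_part (pm_scale c (monomial \<alpha> A (e # \<beta>))) {e}"
proof -
  have e: "e \<in> edges G" and m: "monomial \<alpha> A \<beta> \<in> unital_words (leavitt_gens G)"
    and g: "monomial \<alpha> A (e # \<beta>) \<in> unital_words (leavitt_gens G)"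
    using v by (auto simp: valid_def)
  have eq: "monomial \<alpha> A (e # \<beta>) = monomial \<alpha> A \<beta> * ghost e"
    by (simp add: monomial_def mult.assoc)
  have *: "monomial \<alpha> A (e # \<beta>) * edge f \<approx> monomial \<alpha> A \<beta> * (if e = f then proj (rng G e) else 0)"
    if "f \<in> edges G" for f
    unfolding eq mult.assoc using e m that by (intro cong_mult_left ghost_edge)
  have "monomial \<alpha> A (e # \<beta>) * edge e * ghost e \<approx> monomial \<alpha> A \<beta> * proj (rng G e) * ghost e"
    using *[OF e] e by (intro cong_mult_right) auto
  also have "\<dots> = monomial \<alpha> A \<beta> * (proj (rng G e) * ghost e)" by (simp add: mult.assoc)
  also have "\<dots> \<approx> monomial \<alpha> A (e # \<beta>)"
    unfolding eq using e m by (intro cong_mult_left rng_ghost)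
  finally have "pm_scale c (monomial \<alpha> A (e # \<beta>))
      \<approx> pm_scale c (monomial \<alpha> A (e # \<beta>) * edge e * ghost e)"
    by (intro cong_scale) (rule cong_sym)
  moreover have "monomial \<alpha> A (e # \<beta>) * edge f \<in> J" if "f \<in> edges G" "f \<noteq> e" for f
    using *[OF that(1)] that by (simp add: cong_0)
  ultimately show ?thesis
    using e g by (auto simp: ghost_part_def pm_scale_mult_left)
qed

lemma depth_decomp:
  assumes "f \<in> depth n"
  shows "\<exists>r P y h g E. f = r + g \<and> real_form r P y h \<and> ghost_part g E"
  using assms
proof (induction rule: depth.induct)
  case (ideal f)
  have "f = f + 0" "real_form f {} (\<lambda>_. 0) (\<lambda>_ _. 0)" "ghost_part 0 {}"
    using real_form_J[OF ideal] by (auto simp: ghost_part_def)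
  then show ?case by blast
next
  case (mono \<alpha> A \<beta> c)
  show ?case
  proof (cases \<beta>)
    case Nil
    then obtain P y h where "real_form (pm_scale c (monomial \<alpha> A \<beta>)) P y h"
      using mono real_form_monomial by blast
    moreover have "ghost_part 0 {}" by (auto simp: ghost_part_def)
    moreover have "pm_scale c (monomial \<alpha> A \<beta>) = pm_scale c (monomial \<alpha> A \<beta>) + 0" by simp
    ultimately show ?thesis by blast
  next
    case (Cons e \<beta>')
    have "ghost_part (pm_scale c (monomial \<alpha> A \<beta>)) {e}"
      using ghost_part_monomial mono Cons by auto
    moreover have "real_form 0 {} (\<lambda>_. 0) (\<lambda>_ _. 0)" by (simp add: real_form_J)
    moreover have "pm_scale c (monomial \<alpha> A \<beta>) = 0 + pm_scale c (monomial \<alpha> A \<beta>)" by simp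
    ultimately show ?thesis by blast
  qed
next
  case (add f f')
  obtain r P y h g E where 1: "f = r + g" "real_form r P y h" "ghost_part g E"
    using add.IH(1) by blast
  obtain r' P' y' h' g' E' where 2: "f' = r' + g'" "real_form r' P' y' h'" "ghost_part g' E'"
    using add.IH(2) by blast
  obtain P'' y'' h'' where 3: "real_form (r + r') P'' y'' h''"
    using real_form_add[OF 1(2) 2(2)] by blast
  have "ghost_part (g + g') (E \<union> E')"
    using 1(3) 2(3)
    by (intro ghost_part_add; elim ghost_part_mono) (auto simp: ghost_part_def)
  moreover have "f + f' = (r + r') + (g + g')" by (simp add: 1 2)
  ultimately show ?case using 3 by blast
qed

end

text \<open>Representations enter the algebraic induction only through \<open>separates\<close>. A
  single vertex suffices there because right multiplication by \<open>proj {v}\<close> isolates the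
  coefficients at v.\<close>

locale separating_ideal = leavitt_ideal G J + N: free_ideal "leavitt_gens G" N
  for G :: "('v, 'e) ultragraph"
    and J N :: "(('v, 'e) leavitt_gen free_monoid \<Rightarrow>\<^sub>0 'k::field) set" +
  assumes J_sub_N: "J \<subseteq> N"
    and separates: "\<lbrakk>v \<in> verts G; finite P; \<forall>\<alpha>\<in>P. ends_at G \<alpha> v;
      (\<Sum>\<alpha>\<in>P. pm_scale (l \<alpha>) (path_elem \<alpha> * proj {v})) \<in> N; \<alpha> \<in> P\<rbrakk> \<Longrightarrow> l \<alpha> = 0"
begin

lemma N_cong: "f \<approx> g \<Longrightarrow> f \<in> N \<Longrightarrow> g \<in> N"
  using J_sub_N N.J_diff[of f "f - g"] by (auto simp: cong_def)

lemma real_form_vertex: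
  assumes r: "real_form r P y h" and v: "v \<in> verts G"
  shows "r * proj {v} \<approx> (\<Sum>\<alpha>\<in>P. pm_scale (h \<alpha> v) (path_elem \<alpha> * proj {v}))"
proof -
  have "r * proj {v} \<approx> (\<Sum>\<alpha>\<in>P. path_elem \<alpha> * y \<alpha>) * proj {v}"
    using r v by (intro cong_mult_right) (auto simp: real_form_def)
  also have "\<dots> = (\<Sum>\<alpha>\<in>P. path_elem \<alpha> * (y \<alpha> * proj {v}))"
    by (simp add: sum_distrib_right mult.assoc)
  also have "\<dots> \<approx> (\<Sum>\<alpha>\<in>P. path_elem \<alpha> * pm_scale (h \<alpha> v) (proj {v}))"
    using r v by (intro cong_sum cong_mult_left simple_vertex) (auto simp: real_form_def)
  finally show ?thesis by (simp add: pm_scale_mult_right)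
qed

lemma real_form_edge:
  assumes r: "real_form r P y h" and e: "e \<in> edges G"
  shows "r * edge e \<approx> (\<Sum>\<alpha>\<in>P. pm_scale (h \<alpha> (src G e)) (path_elem (\<alpha> @ [e])))"
proof -
  have "r * edge e \<approx> (\<Sum>\<alpha>\<in>P. path_elem \<alpha> * y \<alpha>) * edge e"
    using r e by (intro cong_mult_right) (auto simp: real_form_def)
  also have "\<dots> = (\<Sum>\<alpha>\<in>P. path_elem \<alpha> * (y \<alpha> * edge e))"
    by (simp add: sum_distrib_right mult.assoc)
  also have "\<dots> \<approx> (\<Sum>\<alpha>\<in>P. path_elem \<alpha> * pm_scale (h \<alpha> (src G e)) (edge e))"
    using r e by (intro cong_sum cong_mult_left simple_edge) (auto simp: real_form_def)
  finally show ?thesis by (simp add: pm_scale_mult_right)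
qed

lemma vertex_coefficient_zero:
  assumes r: "real_form r P y h" and v: "v \<in> verts G" and N: "r * proj {v} \<in> N" and \<alpha>: "\<alpha> \<in> P"
  shows "h \<alpha> v = 0"
proof (rule ccontr)
  assume "h \<alpha> v \<noteq> 0"
  let ?P = "{\<alpha> \<in> P. h \<alpha> v \<noteq> 0}"
  have "(\<Sum>\<alpha>\<in>P. pm_scale (h \<alpha> v) (path_elem \<alpha> * proj {v})) \<in> N"
    using N_cong[OF real_form_vertex[OF r v] N] .
  also have "(\<Sum>\<alpha>\<in>P. pm_scale (h \<alpha> v) (path_elem \<alpha> * proj {v}))
      = (\<Sum>\<alpha>\<in>?P. pm_scale (h \<alpha> v) (path_elem \<alpha> * proj {v}))"
    using r by (intro sum.mono_neutral_right) (auto simp: real_form_def)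
  finally have "h \<alpha> v = 0"
    by (rule separates[OF v, rotated 2]) (use r \<alpha> \<open>h \<alpha> v \<noteq> 0\<close> in \<open>auto simp: real_form_def\<close>)
  then show False using \<open>h \<alpha> v \<noteq> 0\<close> by simp
qed

text \<open>Only \<open>r * edge e\<close> is known to be in \<open>N\<close>, so independence is
  used one step further on: appending e to the paths is injective, and the longer paths end at any w
  in the range of e.\<close>

lemma edge_coefficient_zero:
  assumes r: "real_form r P y h" and e: "e \<in> edges G" and N: "r * edge e \<in> N" and \<alpha>: "\<alpha> \<in> P"
  shows "h \<alpha> (src G e) = 0"
proof (rule ccontr)
  let ?h = "\<lambda>\<alpha>. h \<alpha> (src G e)"
  assume nz: "?h \<alpha> \<noteq> 0"
  let ?P = "{\<alpha> \<in> P. ?h \<alpha> \<noteq> 0}" and ?s = "\<lambda>\<alpha>. \<alpha> @ [e]"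
  obtain w where w: "w \<in> rng G e" using rng_nonempty[OF e] by auto
  have wv: "w \<in> verts G" using rng_sub[OF e] w by auto
  have "(\<Sum>\<alpha>\<in>P. pm_scale (?h \<alpha>) (path_elem (?s \<alpha>))) * proj {w} \<in> N"
    using wv by (intro N.J_mult N_cong[OF real_form_edge[OF r e] N]) auto
  also have "(\<Sum>\<alpha>\<in>P. pm_scale (?h \<alpha>) (path_elem (?s \<alpha>))) * proj {w}
      = (\<Sum>\<alpha>\<in>?P. pm_scale (?h \<alpha>) (path_elem (?s \<alpha>) * proj {w}))"
    unfolding sum_distrib_right pm_scale_mult_left
    using r by (intro sum.mono_neutral_right) (auto simp: real_form_def)
  \<comment> \<open>\<open>butlast\<close> recovers \<alpha> from \<open>\<alpha> @ [e]\<close>, so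
    the coefficients can be indexed by the longer paths.\<close>
  also have "\<dots> = (\<Sum>\<beta>\<in>?s ` ?P. pm_scale (?h (butlast \<beta>)) (path_elem \<beta> * proj {w}))"
    by (subst sum.reindex) (auto simp: inj_on_def)
  finally have "?h (butlast (?s \<alpha>)) = 0"
  proof (rule separates[OF wv, rotated 2])
    show "finite (?s ` ?P)" using r by (simp add: real_form_def)
    show "\<forall>\<beta>\<in>?s ` ?P. ends_at G \<beta> w"
    proof (intro ballI)
      fix \<beta> assume "\<beta> \<in> ?s ` ?P"
      then obtain \<gamma> where \<gamma>: "\<beta> = ?s \<gamma>" "ends_at G \<gamma> (src G e)"
        using r by (auto simp: real_form_def)
      then have "is_path G \<beta>"
        using e is_path_snoc by (auto simp: ends_at_def is_path_single)
      then show "ends_at G \<beta> w" using w by (simp add: ends_at_def path_rng_def \<gamma>)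
    qed
    show "?s \<alpha> \<in> ?s ` ?P" using \<alpha> nz by auto
  qed
  then show False using nz by simp
qed

text \<open>Without ghosts the vertices alone read off all coefficients, and a combination with zero
  coefficient function lies in \<open>J\<close>.\<close>

lemma N_depth_0:
  assumes "f \<in> depth 0" "f \<in> N"
  shows "f \<in> J"
proof -
  obtain P y h where r: "real_form f P y h" using depth_0_real[OF assms(1)] by auto
  have "y \<alpha> \<in> J" if "\<alpha> \<in> P" for \<alpha>
  proof (rule simple_zero)
    show s: "simple (y \<alpha>) (h \<alpha>)" using r that by (auto simp: real_form_def)
    have "h \<alpha> v = 0" if "v \<in> verts G" for v
      using that assms \<open>\<alpha> \<in> P\<close> by (intro vertex_coefficient_zero[OF r] N.J_mult) auto
    then show "\<forall>v. h \<alpha> v = 0" using simple_support[OF s] by blast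
  qed
  then have "(\<Sum>\<alpha>\<in>P. path_elem \<alpha> * y \<alpha>) \<in> J"
    using r by (intro J_sum J_mult) (auto simp: real_form_def)
  then show ?thesis using r cong_J by (auto simp: real_form_def)
qed

lemma proj_regular_vanishes:
  assumes "is_regular G v" "finite E" "E \<subseteq> edges G" "{e \<in> edges G. src G e = v} \<subseteq> E"
  shows "proj {v} * (1 - (\<Sum>e\<in>E. edge e * ghost e)) \<in> J"
proof -
  have v: "v \<in> verts G" using assms by (simp add: is_regular_def)
  have "proj {v} * (\<Sum>e\<in>E. edge e * ghost e) = (\<Sum>e\<in>E. (proj {v} * edge e) * ghost e)"
    by (simp add: sum_distrib_left mult.assoc)
  also have "\<dots> \<approx> (\<Sum>e\<in>E. (if src G e \<in> {v} then edge e else 0) * ghost e)"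
    using assms v by (intro cong_sum cong_mult_right proj_edge) auto
  also have "\<dots> = (\<Sum>e\<in>{e \<in> edges G. src G e = v}. edge e * ghost e)"
    using assms by (intro sum.mono_neutral_cong_right) auto
  also have "\<dots> \<approx> proj {v}" using regular[OF assms(1)] by (rule cong_sym)
  finally show ?thesis using cong_sym by (simp add: right_diff_distrib cong_def)
qed

text \<open>If \<open>f \<in> N\<close> is killed on the right by all edges, then \<open>f\<close> agrees with
  \<open>r * (1 - (\<Sum>e\<in>E. edge e * ghost e))\<close>, where \<open>r\<close> is its ghost-free part. The coefficients of
  \<open>r\<close> vanish at sinks and at vertices emitting an edge outside \<open>E\<close>, so only regular vertices
  remain, and these are annihilated by the second factor.\<close>

lemma killed_by_edges:
  assumes f: "f \<in> depth n" "f \<in> N" and killed: "\<And>e. e \<in> edges G \<Longrightarrow> f * edge e \<in> J"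
  shows "f \<in> J"
proof -
  obtain r P y h g E where fr: "f = r + g" and r: "real_form r P y h" and g: "ghost_part g E"
    using depth_decomp[OF f(1)] by blast
  have E: "finite E" "E \<subseteq> edges G" using g by (auto simp: ghost_part_def)
  let ?q = "1 - (\<Sum>e\<in>E. edge e * ghost e) :: ('v, 'e) leavitt_gen free_monoid \<Rightarrow>\<^sub>0 'k"
  have q: "?q \<in> unital_words (leavitt_gens G)"
    using E by (intro unital_words_closed unital_words_sum gen_unital) auto
  let ?S = "{v \<in> src G ` E. is_regular G v \<and> {e \<in> edges G. src G e = v} \<subseteq> E}"
  have S: "finite ?S" "?S \<subseteq> verts G" using E src_in by auto
  \<comment> \<open>Since \<open>E\<close> is finite, an infinite emitter has an edge outside
    \<open>E\<close>, so this case is settled together with that of a missed edge.\<close>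
  have supp: "v \<in> ?S" if "\<alpha> \<in> P" "h \<alpha> v \<noteq> 0" for \<alpha> v
  proof -
    have v: "v \<in> verts G" using r that simple_support by (auto simp: real_form_def)
    have sub: "{e \<in> edges G. src G e = v} \<subseteq> E"
    proof (rule ccontr)
      assume "\<not> {e \<in> edges G. src G e = v} \<subseteq> E"
      then obtain e where e: "e \<in> edges G" "src G e = v" "e \<notin> E" by auto
      \<comment> \<open>For e outside \<open>E\<close> the ghost part contributes nothing, so
        \<open>r * edge e\<close> inherits membership from \<open>f * edge e\<close>.\<close>
      have "g * edge e \<in> J" using g e by (auto simp: ghost_part_def)
      with killed[OF e(1)] have "f * edge e - g * edge e \<in> J" by blast
      then have "r * edge e \<in> N" using J_sub_N by (auto simp: fr distrib_right)
      from edge_coefficient_zero[OF r e(1) this that(1)] e(2) that(2) show False by simp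
    qed
    moreover have "{e \<in> edges G. src G e = v} \<noteq> {}"
    proof
      assume none: "{e \<in> edges G. src G e = v} = {}"
      have "g * proj {v} \<approx> (\<Sum>e\<in>E. g * edge e * ghost e) * proj {v}"
        using g v by (intro cong_mult_right) (auto simp: ghost_part_def)
      also have "\<dots> = (\<Sum>e\<in>E. g * edge e * (ghost e * proj {v}))"
        by (simp add: sum_distrib_right mult.assoc)
      also have "\<dots> \<approx> (\<Sum>e\<in>E. g * edge e * (if src G e \<in> {v} then ghost e else 0))"
        using g v E by (intro cong_sum cong_mult_left ghost_proj) (auto simp: ghost_part_def)
      also have "\<dots> = 0" using none E by (intro sum.neutral) auto
      finally have "g * proj {v} \<in> N" using J_sub_N by (auto simp: cong_0)
      moreover have "f * proj {v} \<in> N" using f(2) v by (intro N.J_mult) auto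
      ultimately have "f * proj {v} - g * proj {v} \<in> N" by blast
      then have "r * proj {v} \<in> N" by (simp add: fr distrib_right)
      from vertex_coefficient_zero[OF r v this that(1)] that(2) show False by simp
    qed
    ultimately show ?thesis using v E finite_subset by (auto simp: is_regular_def)
  qed
  have "r * ?q \<approx> (\<Sum>\<alpha>\<in>P. path_elem \<alpha> * y \<alpha>) * ?q"
    using r q by (intro cong_mult_right) (auto simp: real_form_def)
  also have "\<dots> \<approx> (\<Sum>\<alpha>\<in>P. path_elem \<alpha> * (\<Sum>v\<in>?S. pm_scale (h \<alpha> v) (proj {v}))) * ?q"
    using r S supp q
    by (intro cong_mult_right cong_sum cong_mult_left simple_finite_support)
      (auto simp: real_form_def)
  also have "\<dots> = (\<Sum>\<alpha>\<in>P. path_elem \<alpha> * (\<Sum>v\<in>?S. pm_scale (h \<alpha> v) (proj {v} * ?q)))"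
    by (simp only: sum_distrib_right mult.assoc pm_scale_mult_left)
  also have "\<dots> \<approx> 0"
    unfolding cong_0 using r E
    by (intro J_sum J_mult(1) J_closed(3) proj_regular_vanishes) (auto simp: real_form_def)
  finally have r0: "r * ?q \<approx> 0" .
  have g0: "g * ?q \<approx> 0"
    using g by (simp add: ghost_part_def right_diff_distrib sum_distrib_left mult.assoc cong_def)
  have "f * (\<Sum>e\<in>E. edge e * ghost e) \<in> J"
    unfolding sum_distrib_left mult.assoc[symmetric]
    by (rule J_sum, rule J_mult(2)) (use E killed in auto)
  moreover have "f * ?q \<in> J"
    using cong_add[OF r0 g0] by (simp only: fr distrib_right cong_0 add_0_left)
  ultimately have "f * ?q + f * (\<Sum>e\<in>E. edge e * ghost e) \<in> J" by blast
  then show ?thesis by (simp add: right_diff_distrib)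
qed

lemma N_depth: "f \<in> depth n \<Longrightarrow> f \<in> N \<Longrightarrow> f \<in> J"
proof (induction n arbitrary: f)
  case (Suc n)
  have "f * edge e \<in> J" if "e \<in> edges G" for e
    using depth_edge[OF Suc.prems(1) that] Suc.prems that by (intro Suc.IH N.J_mult) auto
  then show ?case using killed_by_edges Suc.prems by blast
qed (rule N_depth_0)

lemma N_sub_J: "N \<subseteq> J"
  using N.J_sub carrier_depth N_depth by blast

end

section \<open>Representations from branching systems\<close>

definition extend_linear :: "('w \<Rightarrow> 'k) \<Rightarrow> ('w \<Rightarrow>\<^sub>0 'k::field) \<Rightarrow> 'k" where
  "extend_linear F f = (\<Sum>w\<in>Poly_Mapping.keys f. Poly_Mapping.lookup f w * F w)"

lemma extend_linear_superset:
  "finite S \<Longrightarrow> Poly_Mapping.keys f \<subseteq> S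
    \<Longrightarrow> extend_linear F f = (\<Sum>w\<in>S. Poly_Mapping.lookup f w * F w)"
  unfolding extend_linear_def by (intro sum.mono_neutral_left) (auto simp: in_keys_iff)

lemma extend_linear_0 [simp]: "extend_linear F 0 = 0"
  by (simp add: extend_linear_def)

lemma extend_linear_add: "extend_linear F (f + g) = extend_linear F f + extend_linear F g"
proof -
  let ?S = "Poly_Mapping.keys f \<union> Poly_Mapping.keys g"
  have "extend_linear F h = (\<Sum>w\<in>?S. Poly_Mapping.lookup h w * F w)"
    if "Poly_Mapping.keys h \<subseteq> ?S" for h
    using that by (intro extend_linear_superset) auto
  moreover have "Poly_Mapping.keys (f + g) \<subseteq> ?S" by (rule Poly_Mapping.keys_add)
  ultimately show ?thesis
    by (simp add: lookup_add distrib_right sum.distrib)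
qed

lemma extend_linear_sum: "extend_linear F (sum h S) = (\<Sum>i\<in>S. extend_linear F (h i))"
  by (induction S rule: infinite_finite_induct) (simp_all add: extend_linear_add)

lemma extend_linear_scale: "extend_linear F (pm_scale c f) = c * extend_linear F f"
proof -
  have "extend_linear F (pm_scale c f)
      = (\<Sum>w\<in>Poly_Mapping.keys f. Poly_Mapping.lookup (pm_scale c f) w * F w)"
    by (intro extend_linear_superset) (auto simp: in_keys_iff)
  then show ?thesis by (simp add: extend_linear_def sum_distrib_left mult.assoc)
qed

lemma extend_linear_single [simp]: "extend_linear F (Poly_Mapping.single w c) = c * F w"
  using extend_linear_superset[of "{w}" "Poly_Mapping.single w c" F] by auto

lemma extend_linear_mult:
  fixes f g :: "'w::monoid_add \<Rightarrow>\<^sub>0 'k::field"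
  shows "extend_linear F (f * g) = extend_linear (\<lambda>u. extend_linear (\<lambda>w. F (u + w)) g) f"
proof -
  have "f * g = (\<Sum>u\<in>Poly_Mapping.keys f. Poly_Mapping.single u (Poly_Mapping.lookup f u))
      * (\<Sum>w\<in>Poly_Mapping.keys g. Poly_Mapping.single w (Poly_Mapping.lookup g w))"
    by (simp add: sum_single_keys)
  also have "\<dots> = (\<Sum>u\<in>Poly_Mapping.keys f. \<Sum>w\<in>Poly_Mapping.keys g.
      Poly_Mapping.single (u + w) (Poly_Mapping.lookup f u * Poly_Mapping.lookup g w))"
    by (simp add: sum_product mult_single)
  finally show ?thesis
    by (simp add: extend_linear_sum sum_distrib_left mult.assoc extend_linear_def[of _ f]
        extend_linear_def[of _ g])
qed

definition fun_scale :: "'k::field \<Rightarrow> ('x \<Rightarrow> 'k) \<Rightarrow> 'x \<Rightarrow> 'k" where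
  "fun_scale c v = (\<lambda>x. c * v x)"

lemma vector_space_fun_scale: "vector_space (fun_scale :: 'k::field \<Rightarrow> ('x \<Rightarrow> 'k) \<Rightarrow> _)"
  by unfold_locales (auto simp: fun_scale_def fun_eq_iff algebra_simps)

text \<open>This realises the functions on \<open>X\<close> inside those on the whole type, so a
  varying finite set \<open>X\<close> needs no type of its own.\<close>

definition supported_functions :: "'x set \<Rightarrow> ('x \<Rightarrow> 'k::field) set" where
  "supported_functions X = {v. \<forall>x. x \<notin> X \<longrightarrow> v x = 0}"

lemma subspace_supported_functions:
  "module.subspace fun_scale (supported_functions X :: ('x \<Rightarrow> 'k::field) set)"
proof -
  interpret vector_space "fun_scale :: 'k \<Rightarrow> ('x \<Rightarrow> 'k) \<Rightarrow> _" by (rule vector_space_fun_scale)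
  show ?thesis by (auto simp: subspace_def supported_functions_def fun_scale_def)
qed

lemma fin_dim_supported_functions:
  assumes "finite X"
  shows "vector_space.fin_dim_subspace fun_scale (supported_functions X :: ('x \<Rightarrow> 'k::field) set)"
proof -
  interpret vector_space "fun_scale :: 'k \<Rightarrow> ('x \<Rightarrow> 'k) \<Rightarrow> _" by (rule vector_space_fun_scale)
  let ?d = "\<lambda>x y. if y = x then (1::'k) else 0"
  have sub: "subspace (supported_functions X :: ('x \<Rightarrow> 'k) set)"
    by (rule subspace_supported_functions)
  have "v \<in> span (?d ` X)" if v: "v \<in> supported_functions X" for v
  proof -
    have "v = (\<Sum>x\<in>X. fun_scale (v x) (?d x))"
    proof
      fix y
      have "(\<Sum>x\<in>S. fun_scale (v x) (?d x)) y = (\<Sum>x\<in>S. if y = x then v x else 0)" for S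
        by (induction S rule: infinite_finite_induct) (auto simp: fun_scale_def)
      then show "v y = (\<Sum>x\<in>X. fun_scale (v x) (?d x)) y"
        using assms v by (simp add: supported_functions_def)
    qed
    also have "\<dots> \<in> span (?d ` X)" by (intro span_sum span_scale span_base) auto
    finally show ?thesis .
  qed
  moreover have "span (?d ` X) \<subseteq> supported_functions X"
    by (rule span_minimal[OF _ sub]) (auto simp: supported_functions_def)
  ultimately show ?thesis
    using sub assms unfolding fin_dim_subspace_def by (intro conjI exI[of _ "?d ` X"]) auto
qed

section \<open>Homomorphisms out of quotient algebras\<close>

context kalgebra
begin

lemma two_sided_ideal_carrier: "two_sided_ideal A (acarrier A)"
  by (simp add: two_sided_ideal_def zero_closed add_closed scale_closed mult_closed)

lemma scale_zero_left: "x \<in> acarrier A \<Longrightarrow> ascale A 0 x = azero A"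
  using scale_add_left[of x 1 "- 1"] add_inverse[of x] scale_one[of x] by simp

lemma scale_azero: "ascale A c (azero A) = azero A"
  using scale_scale[OF zero_closed, of c 0] scale_zero_left[OF zero_closed] by simp

lemma mult_azero:
  assumes "x \<in> acarrier A"
  shows "amult A x (azero A) = azero A" "amult A (azero A) x = azero A"
  using mult_scale_right[OF assms zero_closed, of 0] mult_scale_left[OF zero_closed assms, of 0]
  by (simp_all add: scale_zero_left zero_closed mult_closed assms)

end

lemma kalgebra_homD:
  assumes "\<pi> \<in> kalgebra_hom A B" "x \<in> acarrier A"
  shows "\<pi> x \<in> acarrier B" "\<pi> (ascale A c x) = ascale B c (\<pi> x)"
    "y \<in> acarrier A \<Longrightarrow> \<pi> (aadd A x y) = aadd B (\<pi> x) (\<pi> y)"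
    "y \<in> acarrier A \<Longrightarrow> \<pi> (amult A x y) = amult B (\<pi> x) (\<pi> y)"
  using assms by (auto simp: kalgebra_hom_def)

lemma kalgebra_hom_azero:
  assumes "kalgebra A" "kalgebra B" "\<pi> \<in> kalgebra_hom A B"
  shows "\<pi> (azero A) = azero B"
proof -
  have "\<pi> (ascale A 0 (azero A)) = ascale B 0 (\<pi> (azero A))"
    using assms by (intro kalgebra_homD(2)) (auto intro: kalgebra.zero_closed)
  with assms show ?thesis
    by (simp add: kalgebra.scale_zero_left kalgebra.scale_azero kalgebra.zero_closed
        kalgebra_homD(1))
qed

lemma two_sided_ideal_kernel:
  assumes A: "kalgebra A" and B: "kalgebra B" and \<pi>: "\<pi> \<in> kalgebra_hom A B"
  shows "two_sided_ideal A {x \<in> acarrier A. \<pi> x = azero B}"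
  unfolding two_sided_ideal_def
  using kalgebra_hom_azero[OF assms] A B
  by (auto simp: kalgebra.zero_closed kalgebra.add_closed kalgebra.scale_closed kalgebra.mult_closed
      kalgebra_homD[OF \<pi>] kalgebra.add_zero kalgebra.scale_azero kalgebra.mult_azero)

lemma alg_coset_hom:
  assumes "kalgebra A" "two_sided_ideal A I"
  shows "alg_coset A I \<in> kalgebra_hom A (quotient_algebra A I)"
  using assms
  by (auto simp: kalgebra_hom_def kalgebra.quotient_carrier kalgebra.quotient_add
      kalgebra.quotient_scale kalgebra.quotient_mult)

lemma kalgebra_hom_comp:
  "\<pi> \<in> kalgebra_hom A B \<Longrightarrow> \<rho> \<in> kalgebra_hom B C \<Longrightarrow> \<rho> \<circ> \<pi> \<in> kalgebra_hom A C"
  by (auto simp: kalgebra_hom_def Pi_iff)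

lemma quotient_hom:
  assumes A: "kalgebra A" and B: "kalgebra B" and \<pi>: "\<pi> \<in> kalgebra_hom A B"
    and R: "R \<subseteq> acarrier A" and zero: "\<And>r. r \<in> R \<Longrightarrow> \<pi> r = azero B"
  shows "\<exists>\<rho> \<in> kalgebra_hom (quotient_algebra A (ideal_generated A R)) B.
    \<forall>a \<in> acarrier A. \<rho> (alg_coset A (ideal_generated A R) a) = \<pi> a"
proof -
  interpret A: kalgebra A by (rule A)
  interpret B: kalgebra B by (rule B)
  let ?I = "ideal_generated A R" and ?K = "{x \<in> acarrier A. \<pi> x = azero B}"
  note hom = kalgebra_homD[OF \<pi>]
  have "R \<subseteq> ?K" using R zero by auto
  then have IK: "?I \<subseteq> ?K"
    using two_sided_ideal_kernel[OF A B \<pi>] unfolding ideal_generated_def by blast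
  have ideal: "two_sided_ideal A ?I" by (rule A.two_sided_ideal_generated[OF R])
  \<comment> \<open>Any representative will do: two of them differ by an element of the ideal, which
    lies in the kernel of \<open>\<pi>\<close>.\<close>
  define \<rho> where "\<rho> Y = \<pi> (SOME x. x \<in> Y)" for Y
  have \<rho>: "\<rho> (alg_coset A ?I a) = \<pi> a" if a: "a \<in> acarrier A" for a
  proof -
    have "(SOME x. x \<in> alg_coset A ?I a) \<in> alg_coset A ?I a"
      using A.coset_self[OF ideal a] by (rule someI)
    then obtain i where i: "i \<in> ?I" "(SOME x. x \<in> alg_coset A ?I a) = aadd A a i"
      unfolding alg_coset_def by blast
    have "i \<in> acarrier A" "\<pi> i = azero B" using i IK by auto
    then show ?thesis
      unfolding \<rho>_def i(2) using a by (simp add: hom B.add_zero)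
  qed
  have "\<rho> \<in> kalgebra_hom (quotient_algebra A ?I) B"
    unfolding kalgebra_hom_def
    by (auto simp: A.quotient_carrier[OF ideal] A.quotient_add[OF ideal] A.quotient_mult[OF ideal]
        A.quotient_scale[OF ideal] \<rho> hom A.add_closed A.mult_closed A.scale_closed)
  with \<rho> show ?thesis by blast
qed

definition has_detecting_representation ::
    "('v, 'e) ultragraph \<Rightarrow> (('v, 'e) leavitt_gen free_monoid \<Rightarrow>\<^sub>0 'k::field) \<Rightarrow> bool" where
  "has_detecting_representation G f \<longleftrightarrow> (\<exists>(V :: (nat \<Rightarrow>\<^sub>0 'k) set) \<rho>.
    vector_space.fin_dim_subspace pm_scale V \<and>
    \<rho> \<in> kalgebra_hom (leavitt_path_algebra G) (vector_space.endomorphism_algebra pm_scale V) \<and>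
    \<rho> (alg_coset (free_algebra (leavitt_gens G))
        (ideal_generated (free_algebra (leavitt_gens G)) (leavitt_relations G)) f)
      \<noteq> azero (vector_space.endomorphism_algebra pm_scale V))"

text \<open>The map \<open>push e\<close> is the partial bijection by which \<open>s\<^sub>e\<close> acts, and \<open>pop\<close> inverts all of
  these maps at once.\<close>

locale branching_system = ultragraph G
  for G :: "('v, 'e) ultragraph" +
  fixes X :: "'x set" and D :: "'v set \<Rightarrow> 'x set"
    and push :: "'e \<Rightarrow> 'x \<Rightarrow> 'x" and pop :: "'x \<Rightarrow> ('e \<times> 'x) option"
  assumes finite_X: "finite X"
    and D_sub: "A \<in> gen_verts G \<Longrightarrow> D A \<subseteq> X"
    and D_empty: "D {} = {}"
    and D_inter: "A \<in> gen_verts G \<Longrightarrow> B \<in> gen_verts G \<Longrightarrow> D (A \<inter> B) = D A \<inter> D B"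
    and D_union: "A \<in> gen_verts G \<Longrightarrow> B \<in> gen_verts G \<Longrightarrow> D (A \<union> B) = D A \<union> D B"
    and push_D: "e \<in> edges G \<Longrightarrow> x \<in> D (rng G e) \<Longrightarrow> push e x \<in> D {src G e}"
    and pop_push: "e \<in> edges G \<Longrightarrow> x \<in> D (rng G e) \<Longrightarrow> pop (push e x) = Some (e, x)"
    and pop_D: "x \<in> X \<Longrightarrow> pop x = Some (e, z) \<Longrightarrow> e \<in> edges G \<and> z \<in> D (rng G e)"
    and push_pop: "x \<in> X \<Longrightarrow> pop x = Some (e, z) \<Longrightarrow> push e z = x"
    and pop_regular: "is_regular G v \<Longrightarrow> x \<in> D {v} \<Longrightarrow> pop x \<noteq> None"
begin

text \<open>On the basis of points an edge e sends z to \<open>push e z\<close>. For functions this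
  means that the value at x is read at the popped point, so edges pop and ghosts push.\<close>

fun gen_map :: "('v, 'e) leavitt_gen \<Rightarrow> 'x \<Rightarrow> 'x option" where
  "gen_map (Edge e) x = (case pop x of None \<Rightarrow> None | Some (f, z) \<Rightarrow> if f = e then Some z else None)"
| "gen_map (Ghost e) x = (if e \<in> edges G \<and> x \<in> D (rng G e) then Some (push e x) else None)"
| "gen_map (Proj A) x = (if A \<in> gen_verts G \<and> x \<in> D A then Some x else None)"

fun word_map :: "('v, 'e) leavitt_gen list \<Rightarrow> 'x \<Rightarrow> 'x option" where
  "word_map [] x = Some x"
| "word_map (g # gs) x = Option.bind (gen_map g x) (word_map gs)"

definition eval_opt :: "('x \<Rightarrow> 'k) \<Rightarrow> 'x option \<Rightarrow> 'k::field" where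
  "eval_opt v z = (case z of None \<Rightarrow> 0 | Some x \<Rightarrow> v x)"

lemma eval_opt_simps [simp]: "eval_opt v None = 0" "eval_opt v (Some x) = v x"
  by (simp_all add: eval_opt_def)

text \<open>Operators act on functions by precomposition, so the letters of a word are applied to a
  point from left to right.\<close>

definition act :: "(('v, 'e) leavitt_gen free_monoid \<Rightarrow>\<^sub>0 'k::field) \<Rightarrow> ('x \<Rightarrow> 'k) \<Rightarrow> 'x \<Rightarrow> 'k" where
  "act f v x = (if x \<in> X then extend_linear (\<lambda>w. eval_opt v (word_map (letters w) x)) f else 0)"

lemma D_mem: "A \<in> gen_verts G \<Longrightarrow> x \<in> D A \<Longrightarrow> x \<in> X"
  using D_sub by blast

lemma src_gen: "e \<in> edges G \<Longrightarrow> {src G e} \<in> gen_verts G"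
  by (intro gen_verts.singleton src_in)

lemma gen_map_X: "x \<in> X \<Longrightarrow> gen_map g x = Some z \<Longrightarrow> z \<in> X"
proof (cases g)
  case (Edge e)
  assume "x \<in> X" "gen_map g x = Some z"
  with Edge show ?thesis using pop_D[of x] D_mem[OF gen_verts.range]
    by (fastforce split: option.splits if_splits)
next
  case (Ghost e)
  assume "x \<in> X" "gen_map g x = Some z"
  with Ghost show ?thesis using push_D[of e x] D_mem[OF src_gen]
    by (auto split: if_splits)
qed (auto split: if_splits)

lemma word_map_X: "x \<in> X \<Longrightarrow> word_map gs x = Some z \<Longrightarrow> z \<in> X"
  by (induction gs arbitrary: x) (use gen_map_X in \<open>fastforce split: bind_splits\<close>)+

lemma word_map_append: "word_map (u @ w) x = Option.bind (word_map u x) (word_map w)"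
  by (induction u arbitrary: x) (auto split: bind_splits)

lemma act_closed: "act f v \<in> supported_functions X"
  by (simp add: act_def supported_functions_def)

lemma act_add: "act (f + g) v = (\<lambda>x. act f v x + act g v x)"
  by (auto simp: act_def extend_linear_add)

lemma act_scale: "act (pm_scale c f) v = (\<lambda>x. c * act f v x)"
  by (auto simp: act_def extend_linear_scale)

lemma act_diff: "act (f - g) v = (\<lambda>x. act f v x - act g v x)"
  using act_add[of "f - g" g v] by (auto simp: fun_eq_iff)

lemma act_0: "act 0 v = (\<lambda>_. 0)"
  by (auto simp: act_def)

lemma act_sum: "act (sum h S) v x = (\<Sum>i\<in>S. act (h i) v x)"
  by (auto simp: act_def extend_linear_sum)

text \<open>Words never lead out of \<open>X\<close> (\<open>word_map_X\<close>), so the truncation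
  to \<open>X\<close> in \<open>act\<close> does not disturb composition.\<close>

lemma act_mult: "act (f * g) v = act f (act g v)"
proof
  fix x
  have *: "extend_linear (\<lambda>w. eval_opt v (word_map (letters (u + w)) x)) g
      = eval_opt (act g v) (word_map (letters u) x)" if "x \<in> X" for u
  proof (cases "word_map (letters u) x")
    case None
    then show ?thesis
      by (simp add: plus_free_monoid_def word_map_append extend_linear_def)
  next
    case (Some z)
    then show ?thesis using word_map_X[OF that Some]
      by (simp add: plus_free_monoid_def word_map_append act_def)
  qed
  show "act (f * g) v x = act f (act g v) x"
    by (simp add: act_def[of "f * g"] act_def[of f] extend_linear_mult *)
qed

lemma act_add_right: "act f (\<lambda>x. v x + w x) = (\<lambda>x. act f v x + act f w x)"
proof -
  have "eval_opt (\<lambda>x. v x + w x) z = eval_opt v z + eval_opt w z" for z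
    by (cases z) auto
  then show ?thesis by (auto simp: act_def extend_linear_def distrib_left sum.distrib)
qed

lemma act_scale_right: "act f (\<lambda>x. c * v x) = (\<lambda>x. c * act f v x)"
proof -
  have "eval_opt (\<lambda>x. c * v x) z = c * eval_opt v z" for z
    by (cases z) auto
  then show ?thesis by (auto simp: act_def extend_linear_def sum_distrib_left mult.left_commute)
qed

lemma act_gen: "act (gen_elem g) v x = (if x \<in> X then eval_opt v (gen_map g x) else 0)"
  by (cases "gen_map g x") (simp_all add: act_def gen_elem_def)

lemma act_gen2: "act (gen_elem g * gen_elem g') v x
    = (if x \<in> X then eval_opt v (Option.bind (gen_map g x) (gen_map g')) else 0)"
  by (auto simp: act_def gen_elem_def mult_single plus_free_monoid_def split: bind_splits)

lemma pop_src:
  assumes "x \<in> X" "pop x = Some (e, z)"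
  shows "x \<in> D {src G e}"
  using pop_D[OF assms] push_pop[OF assms] push_D by blast

lemma D_singletons: "v \<in> verts G \<Longrightarrow> w \<in> verts G \<Longrightarrow> x \<in> D {v} \<Longrightarrow> x \<in> D {w} \<Longrightarrow> v = w"
  using D_inter[of "{v}" "{w}"] D_empty by (cases "v = w") (auto intro: gen_verts.singleton)

lemma act_relation:
  assumes "\<rho> \<in> leavitt_relations G"
  shows "act \<rho> v = (\<lambda>_. 0 :: 'k::field)"
proof
  fix x
  note [simp] = gen_verts.intros act_diff act_add act_gen act_gen2 act_0 src_gen
  show "act \<rho> v x = 0"
    using assms
  proof cases
    case proj_empty
    then show ?thesis by (simp add: D_empty)
  next
    case (proj_inter A B)
    then show ?thesis by (simp add: D_inter)
  next
    case (proj_union A B)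
    then show ?thesis by (simp add: D_inter D_union)
  next
    case (src_edge e)
    then show ?thesis using pop_src[of x e] by (auto split: option.splits)
  next
    case (edge_rng e)
    then show ?thesis using pop_D[of x e] by (auto split: option.splits)
  next
    case (rng_ghost e)
    then show ?thesis by auto
  next
    case (ghost_src e)
    then show ?thesis using push_D[of e x] by auto
  next
    case (ghost_edge e f)
    then show ?thesis using pop_push[of e x] by auto
  next
    case (regular u)
    let ?S = "{e \<in> edges G. src G e = u}"
    have u: "u \<in> verts G" "finite ?S" using regular by (auto simp: is_regular_def)
    \<comment> \<open>At a point x only the edge popped from x contributes, and
      \<open>pop_regular\<close> ensures that there is one when x lies over u.\<close>
    have "(\<Sum>e\<in>?S. act (gen_elem (Edge e) * gen_elem (Ghost e)) v x) = act (gen_elem (Proj {u})) v x"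
    proof (cases "x \<in> X")
      case True
      show ?thesis
      proof (cases "pop x")
        case None
        then have "x \<notin> D {u}" using pop_regular[OF regular(2)] by blast
        then show ?thesis using None by simp
      next
        case (Some p)
        then obtain f z where p: "pop x = Some (f, z)" by (cases p) auto
        have f: "f \<in> edges G" "z \<in> D (rng G f)" "push f z = x" "x \<in> D {src G f}"
          using pop_D[OF True p] push_pop[OF True p] pop_src[OF True p] by auto
        have "(\<Sum>e\<in>?S. act (gen_elem (Edge e) * gen_elem (Ghost e)) v x)
            = (\<Sum>e\<in>?S. if e = f then v x else 0)"
          using True p f by (intro sum.cong) auto
        also have "\<dots> = (if src G f = u then v x else 0)" using u f by simp
        also have "\<dots> = act (gen_elem (Proj {u})) v x"
          using D_singletons[of "src G f" u x] True f u by (auto intro: src_in)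
        finally show ?thesis .
      qed
    qed simp
    then show ?thesis using regular by (simp add: act_sum)
  qed
qed

lemma representation:
  fixes f :: "('v, 'e) leavitt_gen free_monoid \<Rightarrow>\<^sub>0 'k::field"
  assumes f: "f \<in> acarrier (free_algebra (leavitt_gens G))"
    and v: "v \<in> supported_functions X" "act f v \<noteq> (\<lambda>_. 0)"
  shows "\<exists>(V :: (nat \<Rightarrow>\<^sub>0 'k) set) \<rho>. vector_space.fin_dim_subspace pm_scale V \<and>
    \<rho> \<in> kalgebra_hom (leavitt_path_algebra G) (vector_space.endomorphism_algebra pm_scale V) \<and>
    \<rho> (alg_coset (free_algebra (leavitt_gens G))
        (ideal_generated (free_algebra (leavitt_gens G)) (leavitt_relations G)) f)
      \<noteq> azero (vector_space.endomorphism_algebra pm_scale V)"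
proof -
  interpret F: vector_space "fun_scale :: 'k \<Rightarrow> ('x \<Rightarrow> 'k) \<Rightarrow> _" by (rule vector_space_fun_scale)
  let ?A = "free_algebra (leavitt_gens G) :: ('k, ('v, 'e) leavitt_gen free_monoid \<Rightarrow>\<^sub>0 'k) kalgebra"
  let ?V = "supported_functions X :: ('x \<Rightarrow> 'k) set"
  let ?E = "F.endomorphism_algebra ?V"
  let ?I = "ideal_generated ?A (leavitt_relations G)"
  define \<pi> where "\<pi> g = (\<lambda>v\<in>?V. act g v)" for g :: "('v, 'e) leavitt_gen free_monoid \<Rightarrow>\<^sub>0 'k"
  have closed: "(\<lambda>x. u x + w x) \<in> ?V" "(\<lambda>x. c * u x) \<in> ?V" if "u \<in> ?V" "w \<in> ?V" for u w c
    using that by (auto simp: supported_functions_def)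
  have "\<pi> \<in> kalgebra_hom ?A ?E"
    unfolding kalgebra_hom_def F.endomorphism_algebra_def \<pi>_def free_algebra_def
    by (auto simp: act_closed closed act_add act_scale act_mult act_add_right act_scale_right
        plus_fun_def fun_scale_def restrict_def fun_eq_iff)
  moreover have "\<pi> r = azero ?E" if "r \<in> leavitt_relations G" for r
    using act_relation[OF that] by (simp add: \<pi>_def F.endomorphism_algebra_def zero_fun_def)
  ultimately obtain \<rho> where \<rho>: "\<rho> \<in> kalgebra_hom (quotient_algebra ?A ?I) ?E"
    "\<forall>a\<in>acarrier ?A. \<rho> (alg_coset ?A ?I a) = \<pi> a"
    using quotient_hom[OF kalgebra_free_algebra
        F.kalgebra_endomorphism_algebra[OF subspace_supported_functions] _
        leavitt_relations_subset[OF ultragraph_axioms]] by blast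
  have "\<pi> f v \<noteq> azero ?E v"
    using v by (simp add: \<pi>_def F.endomorphism_algebra_def zero_fun_def)
  then have "\<rho> (alg_coset ?A ?I f) \<noteq> azero ?E" using \<rho>(2) f by auto
  moreover have "alg_coset ?A ?I f \<in> acarrier (quotient_algebra ?A ?I)"
    using f by (simp add: quotient_algebra_def)
  ultimately show ?thesis
    unfolding leavitt_path_algebra_def
    by (intro representation_transfer[OF vector_space_fun_scale
          fin_dim_supported_functions[OF finite_X] \<rho>(1)])
qed

lemma D_mono: "A \<in> gen_verts G \<Longrightarrow> B \<in> gen_verts G \<Longrightarrow> A \<subseteq> B \<Longrightarrow> D A \<subseteq> D B"
  using D_inter[of A B] by (auto simp: Int_absorb2)

text \<open>Each source on a path lies in the preceding range, so successive pushes stay in the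
  required domains; reading the edges of \<alpha> then pops them again in order.\<close>

lemma foldr_push:
  assumes "is_path G \<alpha>" "A \<in> gen_verts G" "A \<subseteq> path_rng G \<alpha>" "x \<in> D A"
  shows "foldr push \<alpha> x \<in> D {path_src G \<alpha>}" "word_map (map Edge \<alpha> @ gs) (foldr push \<alpha> x) = word_map gs x"
proof -
  have "foldr push \<alpha> x \<in> D {path_src G \<alpha>} \<and>
      word_map (map Edge \<alpha> @ gs) (foldr push \<alpha> x) = word_map gs x"
    using assms
  proof (induction \<alpha>)
    case (Cons e \<alpha>)
    have e: "e \<in> edges G" using Cons.prems by (simp add: is_path_def)
    have "foldr push \<alpha> x \<in> D (rng G e) \<and>
        word_map (map Edge \<alpha> @ gs) (foldr push \<alpha> x) = word_map gs x"
    proof (cases \<alpha>)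
      case Nil
      then show ?thesis
        using Cons.prems D_mono[of A "rng G e"] e
        by (auto simp: path_rng_def gen_verts.range)
    next
      case (Cons f \<beta>)
      then have "is_path G \<alpha>" "src G f \<in> rng G e" "f \<in> edges G"
        using Cons.prems by (auto simp: is_path_Cons is_path_def)
      moreover have "path_rng G (e # \<alpha>) = path_rng G \<alpha>" "path_src G \<alpha> = src G f"
        using Cons by (simp_all add: path_rng_def path_src_def)
      ultimately show ?thesis
        using Cons.IH Cons.prems D_mono[of "{src G f}" "rng G e"] e src_gen
        by (auto simp: gen_verts.range)
    qed
    then show ?case using push_D[OF e] pop_push[OF e] by (simp add: path_src_def)
  qed (simp add: is_path_def)
  then show "foldr push \<alpha> x \<in> D {path_src G \<alpha>}"
    "word_map (map Edge \<alpha> @ gs) (foldr push \<alpha> x) = word_map gs x" by auto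
qed

lemma word_map_path:
  "y \<in> X \<Longrightarrow> word_map (map Edge \<alpha> @ [Proj A]) y = Some z \<Longrightarrow> y = foldr push \<alpha> z"
proof (induction \<alpha> arbitrary: y)
  case (Cons e \<alpha>)
  then obtain y' where y': "pop y = Some (e, y')" "word_map (map Edge \<alpha> @ [Proj A]) y' = Some z"
    by (auto split: bind_splits option.splits if_splits)
  then have "e \<in> edges G" "y' \<in> D (rng G e)" using pop_D[OF Cons.prems(1) y'(1)] by auto
  then have "y' \<in> X" by (intro D_mem[OF gen_verts.range])
  then show ?case using Cons.IH[of y'] y'(2) push_pop[OF Cons.prems(1) y'(1)] by simp
qed (auto split: if_splits)

text \<open>Apply the element to the delta function of x and evaluate at the point obtained from x
  by pushing \<alpha>. The word of \<beta> contributes only if \<beta> pushes x to the same point,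
  which injectivity excludes for \<beta> other than \<alpha>.\<close>

lemma act_separates:
  fixes l :: "'e list \<Rightarrow> 'k::field"
  assumes v: "v \<in> verts G" "x \<in> D {v}" and P: "finite P" "\<forall>\<alpha>\<in>P. ends_at G \<alpha> v"
    and inj: "inj_on (\<lambda>\<alpha>. foldr push \<alpha> x) P" and \<alpha>: "\<alpha> \<in> P"
  shows "act (\<Sum>\<alpha>\<in>P. pm_scale (l \<alpha>) (path_elem \<alpha> * gen_elem (Proj {v})))
    (\<lambda>y. if y = x then 1 else 0) (foldr push \<alpha> x) = l \<alpha>"
proof -
  have vg: "{v} \<in> gen_verts G" using v by (intro gen_verts.singleton)
  have X: "foldr push \<beta> x \<in> X" "word_map (map Edge \<beta> @ [Proj {v}]) (foldr push \<beta> x) = Some x"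
    if "ends_at G \<beta> v" for \<beta>
  proof -
    have "foldr push \<beta> x \<in> X \<and>
        word_map (map Edge \<beta> @ [Proj {v}]) (foldr push \<beta> x) = word_map [Proj {v}] x"
    proof (cases "\<beta> = []")
      case False
      then have \<beta>: "is_path G \<beta>" "{v} \<subseteq> path_rng G \<beta>" using that by (auto simp: ends_at_def)
      then have "path_src G \<beta> \<in> verts G"
        by (cases \<beta>) (auto simp: is_path_def path_src_def intro: src_in)
      then show ?thesis
        using foldr_push(1)[OF \<beta>(1) vg \<beta>(2) v(2)] foldr_push(2)[OF \<beta>(1) vg \<beta>(2) v(2)]
          D_mem[OF gen_verts.singleton] by metis
    qed (use v vg D_mem in auto)
    then show "foldr push \<beta> x \<in> X"
      "word_map (map Edge \<beta> @ [Proj {v}]) (foldr push \<beta> x) = Some x"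
      using v vg by auto
  qed
  let ?d = "\<lambda>y. if y = x then 1 else (0::'k)" and ?y = "foldr push \<alpha> x"
  have y: "?y \<in> X" using X \<alpha> P by auto
  have elem: "path_elem \<beta> * gen_elem (Proj {v})
      = Poly_Mapping.single (Word (map Edge \<beta> @ [Proj {v}])) (1::'k)" for \<beta> :: "'e list"
    by (simp add: path_elem_def gen_elem_def single_Word_append)
  have "act (path_elem \<beta> * gen_elem (Proj {v})) ?d ?y = (if \<beta> = \<alpha> then 1 else 0)"
    if \<beta>: "\<beta> \<in> P" for \<beta>
  proof (cases "\<beta> = \<alpha>")
    case True
    then show ?thesis using X \<alpha> P y by (simp add: elem act_def)
  next
    case False
    have "word_map (map Edge \<beta> @ [Proj {v}]) ?y \<noteq> Some x"
      using word_map_path[OF y, of \<beta> "{v}" x] inj_onD[OF inj _ \<alpha> \<beta>] False by auto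
    then have "eval_opt ?d (word_map (map Edge \<beta> @ [Proj {v}]) ?y) = 0"
      by (cases "word_map (map Edge \<beta> @ [Proj {v}]) ?y") auto
    then show ?thesis using False by (simp add: elem act_def)
  qed
  then have "act (\<Sum>\<beta>\<in>P. pm_scale (l \<beta>) (path_elem \<beta> * gen_elem (Proj {v}))) ?d ?y
      = (\<Sum>\<beta>\<in>P. if \<beta> = \<alpha> then l \<beta> else 0)"
    by (simp add: act_sum act_scale if_distrib[of "(*) _"] cong: if_cong)
  also have "\<dots> = l \<alpha>" using P \<alpha> by simp
  finally show ?thesis .
qed

lemma separating_representation:
  fixes l :: "'e list \<Rightarrow> 'k::field"
  assumes v: "v \<in> verts G" "x \<in> D {v}" and P: "finite P" "\<forall>\<alpha>\<in>P. ends_at G \<alpha> v"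
    and inj: "inj_on (\<lambda>\<alpha>. foldr push \<alpha> x) P" and \<alpha>: "\<alpha> \<in> P" "l \<alpha> \<noteq> 0"
  shows "has_detecting_representation G
    (\<Sum>\<alpha>\<in>P. pm_scale (l \<alpha>) (path_elem \<alpha> * gen_elem (Proj {v})))"
  unfolding has_detecting_representation_def
proof (rule representation)
  let ?C = "acarrier (free_algebra (leavitt_gens G)) :: (('v, 'e) leavitt_gen free_monoid \<Rightarrow>\<^sub>0 'k) set"
  \<comment> \<open>The carrier is an ideal of itself, so the closure lemmas for ideals apply to
    it.\<close>
  interpret C: free_ideal "leavitt_gens G" ?C
    by (rule free_ideal.intro, rule kalgebra.two_sided_ideal_carrier, rule kalgebra_free_algebra)
  have "path_elem \<beta> * gen_elem (Proj {v}) \<in> ?C" if "\<beta> \<in> P" for \<beta>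
  proof -
    have "set \<beta> \<subseteq> edges G" using P(2) that by (auto simp: ends_at_def is_path_def)
    then show ?thesis using v
      by (auto simp: path_elem_def gen_elem_def single_Word_append free_algebra_def leavitt_gens_def
          gen_verts.singleton)
  qed
  then show "(\<Sum>\<alpha>\<in>P. pm_scale (l \<alpha>) (path_elem \<alpha> * gen_elem (Proj {v}))) \<in> ?C"
    by (intro C.J_sum C.J_closed(3))
  show "(\<lambda>y. if y = x then 1 else 0) \<in> supported_functions X"
    using D_mem[OF gen_verts.singleton[OF v(1)] v(2)] by (auto simp: supported_functions_def)
  show "act (\<Sum>\<alpha>\<in>P. pm_scale (l \<alpha>) (path_elem \<alpha> * gen_elem (Proj {v})))
      (\<lambda>y. if y = x then 1 else 0) \<noteq> (\<lambda>_. 0)"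
    using act_separates[OF v P inj \<alpha>(1), of l] \<alpha>(2) by auto
qed

end

section \<open>Paths and cycles\<close>

definition follows :: "('v, 'e) ultragraph \<Rightarrow> 'e \<Rightarrow> 'e \<Rightarrow> bool" where
  "follows G e f \<longleftrightarrow> e \<in> edges G \<and> f \<in> edges G \<and> src G f \<in> rng G e"

text \<open>Edges are used rather than vertices because (B3) concerns sequences of edges. By
  \<open>cyclic_edge_cycle\<close> and \<open>cycle_cyclic_edge\<close> these are the edges that lie
  on a cycle.\<close>

definition cyclic_edge :: "('v, 'e) ultragraph \<Rightarrow> 'e \<Rightarrow> bool" where
  "cyclic_edge G e \<longleftrightarrow> (follows G)\<^sup>+\<^sup>+ e e"

lemma is_path_append:
  "\<alpha> \<noteq> [] \<Longrightarrow> \<beta> \<noteq> [] \<Longrightarrow> is_path G (\<alpha> @ \<beta>) \<longleftrightarrow>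
    is_path G \<alpha> \<and> is_path G \<beta> \<and> path_src G \<beta> \<in> path_rng G \<alpha>"
proof (induction \<alpha>)
  case (Cons e \<alpha>)
  show ?case
  proof (cases \<alpha>)
    case Nil
    with Cons.prems show ?thesis
      by (cases \<beta>) (auto simp: is_path_Cons is_path_single path_src_def path_rng_def)
  next
    case (Cons f \<gamma>)
    then show ?thesis using Cons.IH Cons.prems by (auto simp: is_path_Cons path_rng_def)
  qed
qed simp

lemma is_path_edges: "is_path G \<alpha> \<Longrightarrow> set \<alpha> \<subseteq> edges G"
  by (simp add: is_path_def)

lemma path_follows:
  "is_path G \<alpha> \<Longrightarrow> e \<in> set \<alpha> \<Longrightarrow> (follows G)\<^sup>*\<^sup>* (hd \<alpha>) e \<and> (follows G)\<^sup>*\<^sup>* e (last \<alpha>)"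
proof (induction \<alpha> arbitrary: e)
  case (Cons f \<alpha>)
  show ?case
  proof (cases \<alpha>)
    case Nil
    then show ?thesis using Cons.prems by simp
  next
    case (Cons g \<beta>)
    then have p: "is_path G \<alpha>" and fg: "follows G f g"
      using Cons.prems by (auto simp: is_path_Cons follows_def dest: is_path_edges)
    then have "(follows G)\<^sup>*\<^sup>* g (last \<alpha>)" using Cons.IH[OF p, of g] Cons by simp
    then have *: "(follows G)\<^sup>*\<^sup>* f (last \<alpha>)" using fg by (rule converse_rtranclp_into_rtranclp[rotated])
    show ?thesis
    proof (cases "e \<in> set \<alpha>")
      case True
      with Cons.IH[OF p] fg Cons show ?thesis
        by (auto intro: converse_rtranclp_into_rtranclp)
    qed (use Cons.prems * Cons in auto)
  qed
qed simp

lemma follows_path: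
  assumes "(follows G)\<^sup>*\<^sup>* e f" "e \<in> edges G"
  shows "\<exists>\<alpha>. is_path G (e # \<alpha>) \<and> last (e # \<alpha>) = f"
  using assms
proof (induction rule: rtranclp_induct)
  case base
  then show ?case by (intro exI[of _ "[]"]) (simp add: is_path_single)
next
  case (step f g)
  then obtain \<alpha> where "is_path G (e # \<alpha>)" "last (e # \<alpha>) = f" by blast
  with step have "is_path G ((e # \<alpha>) @ [g])"
    by (intro is_path_snoc) (auto simp: follows_def path_rng_def)
  then show ?case by (intro exI[of _ "\<alpha> @ [g]"]) simp
qed

text \<open>A shortest closed path starting with e has distinct sources, since between two edges
  with equal source a loop could be cut out.\<close>

lemma cyclic_edge_cycle:
  assumes "cyclic_edge G e"
  shows "\<exists>c. is_cycle G (e # c)"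
proof -
  let ?closed = "\<lambda>c. is_path G (e # c) \<and> path_src G (e # c) \<in> path_rng G (e # c)"
  obtain f where f: "(follows G)\<^sup>*\<^sup>* e f" "follows G f e"
    using assms unfolding cyclic_edge_def
    by (cases rule: tranclp.cases) (blast dest: tranclp_into_rtranclp)+
  then obtain c0 where "is_path G (e # c0)" "last (e # c0) = f"
    using follows_path[of G e f] by (auto simp: follows_def)
  with f have c0: "?closed c0" by (simp add: path_src_def path_rng_def follows_def)
  obtain c where c: "?closed c" and least: "\<And>d. ?closed d \<Longrightarrow> length c \<le> length d"
    using ex_has_least_nat[of ?closed c0 length, OF c0] by blast
  have "distinct (map (src G) (e # c))"
  proof (rule ccontr)
    assume "\<not> ?thesis"
    then obtain xs ys zs y where "map (src G) (e # c) = xs @ [y] @ ys @ [y] @ zs"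
      using not_distinct_decomp by blast
    then obtain c1 r1 where r1: "e # c = c1 @ r1" "map (src G) r1 = y # ys @ y # zs"
      unfolding map_eq_append_conv by auto
    then obtain a r2 where r2: "r1 = a # r2" "src G a = y" "map (src G) r2 = ys @ y # zs"
      by (cases r1) auto
    then obtain c2 r3 where r3: "r2 = c2 @ r3" "map (src G) r3 = y # zs"
      unfolding map_eq_append_conv by auto
    then obtain b c3 where b: "r3 = b # c3" "src G b = y" by (cases r3) auto
    have ec: "e # c = c1 @ [a] @ c2 @ [b] @ c3" using r1(1) r2(1) r3(1) b(1) by simp
    have ab: "src G a = src G b" using r2(2) b(2) by simp
    \<comment> \<open>If the repeated source is that of e, the end \<open>b # c3\<close> is dropped
      so that e remains the first edge; otherwise the inner loop \<open>a # c2\<close> is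
      removed.\<close>
    show False
    proof (cases c1)
      case Nil
      then have a: "a = e" "c = c2 @ b # c3" using ec by auto
      have "is_path G ((e # c2) @ (b # c3))" using c a by simp
      then have "is_path G (e # c2)" "path_src G (b # c3) \<in> path_rng G (e # c2)"
        using is_path_append[of "e # c2" "b # c3" G] by auto
      then have "?closed c2" using ab a by (simp add: path_src_def)
      from least[OF this] show False by (simp add: a)
    next
      case (Cons e' d)
      then have d: "e' = e" "c = d @ a # c2 @ b # c3" using ec by auto
      have p: "is_path G ((e # d) @ (a # c2 @ b # c3))" "is_path G ((e # d @ a # c2) @ (b # c3))"
        using c d by auto
      then have "is_path G (e # d)" "path_src G (a # c2 @ b # c3) \<in> path_rng G (e # d)"
        "is_path G (b # c3)"
        using is_path_append[of "e # d" "a # c2 @ b # c3" G]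
          is_path_append[of "e # d @ a # c2" "b # c3" G] by auto
      then have "is_path G ((e # d) @ (b # c3))"
        using is_path_append[of "e # d" "b # c3" G] ab by (simp add: path_src_def)
      then have "?closed (d @ b # c3)" using c d by (simp add: path_src_def path_rng_def)
      from least[OF this] show False by (simp add: d)
    qed
  qed
  with c show ?thesis by (auto simp: is_cycle_def)
qed

lemma cycle_cyclic_edge:
  assumes "is_cycle G c" "e \<in> set c"
  shows "cyclic_edge G e"
proof -
  have c: "is_path G c" "c \<noteq> []" using assms by (auto simp: is_cycle_def is_path_def)
  have "follows G (last c) (hd c)"
    using assms c is_path_edges[OF c(1)]
    by (auto simp: follows_def is_cycle_def path_src_def path_rng_def)
  with path_follows[OF c(1) assms(2)] show ?thesis
    unfolding cyclic_edge_def by (meson rtranclp_into_tranclp1 tranclp_rtranclp_tranclp)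
qed

lemma foldr_Cons_append: "foldr Cons \<alpha> \<beta> = \<alpha> @ \<beta>"
  by (induction \<alpha>) auto

lemma no_exitD:
  assumes "\<not> has_exit G c" "i < length c"
  shows "f \<in> edges G \<Longrightarrow> src G f \<in> rng G (c ! i) \<Longrightarrow> f = c ! (Suc i mod length c)"
    and "w \<in> rng G (c ! i) \<Longrightarrow> \<not> is_sink G w"
  using assms by (auto simp: has_exit_def)

section \<open>Consequences of the graph conditions\<close>

locale rfd_ultragraph = ultragraph G for G :: "('v, 'e) ultragraph" +
  assumes receivers: "no_infinite_receivers G"
    and no_exit: "no_cycle_has_exit G"
    and chains: "no_infinite_backward_chains G"
    and reaches: "every_vertex_reaches_terminal_or_cycle G"
begin

text \<open>Without exits no vertex in the range of e is a sink, so each emits an edge; that edge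
  must be the next one on the cycle, which leaves room for only one vertex.\<close>

lemma cyclic_edge_successor:
  assumes "cyclic_edge G e"
  shows "\<exists>f. follows G e f \<and> rng G e = {src G f} \<and> (\<forall>g. follows G e g \<longrightarrow> g = f)"
proof -
  obtain c where c: "is_cycle G (e # c)" using cyclic_edge_cycle[OF assms] by blast
  then have "\<not> has_exit G (e # c)" using no_exit by (auto simp: no_cycle_has_exit_def)
  then have unique: "f \<in> edges G \<Longrightarrow> src G f \<in> rng G e \<Longrightarrow> f = (e # c) ! (Suc 0 mod length (e # c))"
    and no_sink: "w \<in> rng G e \<Longrightarrow> \<not> is_sink G w" for f w
    using no_exitD[of G "e # c" 0] by auto
  \<comment> \<open>The index is 0 for a cycle of length one, where e is its own successor.\<close>
  let ?f = "(e # c) ! (Suc 0 mod length (e # c))"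
  have e: "e \<in> edges G" using c by (auto simp: is_cycle_def is_path_def)
  have f: "?f \<in> edges G \<and> src G ?f = w" if w: "w \<in> rng G e" for w
  proof -
    obtain f where "f \<in> edges G" "src G f = w"
      using no_sink[OF w] rng_sub[OF e] w by (auto simp: is_sink_def)
    with unique[of f] w show ?thesis by simp
  qed
  obtain w where w: "w \<in> rng G e" using rng_nonempty[OF e] by auto
  have "follows G e ?f" using f[OF w] w e by (simp add: follows_def)
  moreover have "rng G e = {src G ?f}" using f w by blast
  moreover have "\<forall>g. follows G e g \<longrightarrow> g = ?f" using unique by (simp add: follows_def)
  ultimately show ?thesis by blast
qed

lemma cyclic_edge_unique: "cyclic_edge G e \<Longrightarrow> follows G e f \<Longrightarrow> follows G e g \<Longrightarrow> f = g"
  using cyclic_edge_successor[of e] by auto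

lemma cyclic_edge_step:
  assumes "cyclic_edge G e" "follows G e f"
  shows "cyclic_edge G f \<and> (follows G)\<^sup>*\<^sup>* f e"
proof -
  obtain g where g: "follows G e g" "(follows G)\<^sup>*\<^sup>* g e"
    using assms(1) unfolding cyclic_edge_def by (meson tranclpD)
  then have "(follows G)\<^sup>*\<^sup>* f e" using cyclic_edge_unique[OF assms(1) g(1) assms(2)] by simp
  with assms(2) show ?thesis
    unfolding cyclic_edge_def by (meson rtranclp_into_tranclp1)
qed

lemma cyclic_edge_reach:
  assumes "(follows G)\<^sup>*\<^sup>* e f" "cyclic_edge G e"
  shows "cyclic_edge G f \<and> (follows G)\<^sup>*\<^sup>* f e"
  using assms
proof (induction rule: rtranclp_induct)
  case (step f g)
  then show ?case using cyclic_edge_step[of f g] by (meson rtranclp_trans)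
qed simp

lemma finite_reach:
  assumes "cyclic_edge G e"
  shows "finite {f. (follows G)\<^sup>*\<^sup>* e f}"
proof -
  obtain c where c: "is_cycle G (e # c)" using cyclic_edge_cycle[OF assms] by blast
  have succ: "g \<in> set (e # c)" if f: "f \<in> set (e # c)" and fg: "follows G f g" for f g
  proof -
    obtain i where i: "i < length (e # c)" "f = (e # c) ! i"
      using f unfolding in_set_conv_nth by blast
    have "\<not> has_exit G (e # c)" using no_exit c unfolding no_cycle_has_exit_def by blast
    from no_exitD(1)[OF this i(1), of g]
    have "g = (e # c) ! (Suc i mod length (e # c))"
      using fg unfolding i(2) follows_def by blast
    moreover have "Suc i mod length (e # c) < length (e # c)" by (intro mod_less_divisor) simp
    ultimately show ?thesis by (simp only: nth_mem)
  qed
  have "f \<in> set (e # c)" if "(follows G)\<^sup>*\<^sup>* e f" for f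
    using that by (induction rule: rtranclp_induct) (use succ in auto)
  then have "{f. (follows G)\<^sup>*\<^sup>* e f} \<subseteq> set (e # c)" by blast
  then show ?thesis by (rule finite_subset) simp
qed

text \<open>A descending chain is a backward chain of edges. An edge repeated in it would be cyclic,
  so the edges are distinct, contrary to (B3).\<close>

lemma wf_noncyclic:
  "wf {(e, f). follows G e f \<and> \<not> cyclic_edge G e}"
  unfolding wf_iff_no_infinite_down_chain
proof
  assume "\<exists>s. \<forall>i. (s (Suc i), s i) \<in> {(e, f). follows G e f \<and> \<not> cyclic_edge G e}"
  then obtain s where s: "\<And>i. follows G (s (Suc i)) (s i)" "\<And>i. \<not> cyclic_edge G (s (Suc i))"
    by auto
  \<comment> \<open>The relation leaves open whether \<open>s 0\<close> is cyclic, so the chain is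
    shifted by one.\<close>
  let ?s = "\<lambda>i. s (Suc i)"
  have reach: "(follows G)\<^sup>+\<^sup>+ (?s j) (?s i)" if "i < j" for i j
    using that
  proof (induction j)
    case (Suc j)
    then show ?case using s(1)[of "Suc j"]
      by (cases "i = j") (auto intro: tranclp_trans)
  qed simp
  have "inj ?s"
  proof (rule linorder_injI)
    fix i j :: nat assume "i < j"
    then show "?s i \<noteq> ?s j" using reach[of i j] s(2) by (auto simp: cyclic_edge_def)
  qed
  moreover have "?s i \<in> edges G" "src G (?s i) \<in> rng G (?s (Suc i))" for i
    using s(1)[of "Suc i"] by (auto simp: follows_def)
  ultimately show False using chains unfolding no_infinite_backward_chains_def by blast
qed

definition acyclic_path :: "'e list \<Rightarrow> bool" where
  "acyclic_path \<alpha> \<longleftrightarrow> (\<forall>e\<in>set \<alpha>. \<not> cyclic_edge G e)"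

text \<open>This is the finiteness of a well-founded, finitely branching tree of predecessors: (B1)
  bounds the branching, \<open>wf_noncyclic\<close> gives the induction.\<close>

lemma finite_acyclic_paths_edge:
  "finite {\<alpha>. is_path G \<alpha> \<and> acyclic_path \<alpha> \<and> last \<alpha> = f}"
proof (induction f rule: wf_induct_rule[OF wf_noncyclic])
  case (1 f)
  let ?P = "\<lambda>f. {\<alpha>. is_path G \<alpha> \<and> acyclic_path \<alpha> \<and> last \<alpha> = f}"
  let ?E = "{e. follows G e f \<and> \<not> cyclic_edge G e}"
  have "?P f \<subseteq> insert [f] (\<Union>e\<in>?E. (\<lambda>\<alpha>. \<alpha> @ [f]) ` ?P e)"
  proof
    fix \<alpha> assume \<alpha>: "\<alpha> \<in> ?P f"
    then have "\<alpha> \<noteq> []" by (auto simp: is_path_def)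
    with \<alpha> have eq: "\<alpha> = butlast \<alpha> @ [f]" by auto
    show "\<alpha> \<in> insert [f] (\<Union>e\<in>?E. (\<lambda>\<alpha>. \<alpha> @ [f]) ` ?P e)"
    proof (cases "butlast \<alpha> = []")
      case True
      then show ?thesis using eq by simp
    next
      case False
      let ?\<beta> = "butlast \<alpha>"
      have "is_path G (?\<beta> @ [f])" using \<alpha> eq by simp
      then have p: "is_path G ?\<beta>" "src G f \<in> rng G (last ?\<beta>)" "is_path G [f]"
        using is_path_append[OF False, of "[f]" G] by (auto simp: path_src_def path_rng_def)
      moreover have ac: "acyclic_path ?\<beta>"
        using \<alpha> by (auto simp: acyclic_path_def dest: in_set_butlastD)
      moreover have "last ?\<beta> \<in> ?E"
        using p ac False is_path_edges[OF p(1)]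
        by (auto simp: follows_def is_path_single acyclic_path_def)
      ultimately show ?thesis using eq by blast
    qed
  qed
  moreover have "finite ?E"
  proof (cases "f \<in> edges G")
    case True
    then have "finite {e \<in> edges G. src G f \<in> rng G e}"
      using receivers src_in by (auto simp: no_infinite_receivers_def)
    then show ?thesis by (rule rev_finite_subset) (auto simp: follows_def)
  qed (simp add: follows_def)
  moreover have "finite (?P e)" if "e \<in> ?E" for e
    using 1 that by auto
  ultimately show ?case by (simp add: finite_subset)
qed

lemma finite_acyclic_paths_vertex:
  assumes "v \<in> verts G"
  shows "finite {\<alpha>. ends_at G \<alpha> v \<and> acyclic_path \<alpha>}"
proof -
  have "{\<alpha>. ends_at G \<alpha> v \<and> acyclic_path \<alpha>} \<subseteq>
    insert [] (\<Union>e\<in>{e \<in> edges G. v \<in> rng G e}. {\<alpha>. is_path G \<alpha> \<and> acyclic_path \<alpha> \<and> last \<alpha> = e})"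
    by (auto simp: ends_at_def path_rng_def dest: is_path_edges)
      (metis is_path_def is_path_edges last_in_set subsetD)
  moreover have "finite {e \<in> edges G. v \<in> rng G e}"
    using receivers assms by (auto simp: no_infinite_receivers_def)
  ultimately show ?thesis using finite_acyclic_paths_edge by (simp add: finite_subset)
qed

section \<open>Terminal boundary sets\<close>

lemma terminal_gen: "A \<in> terminal_boundary_sets G \<Longrightarrow> A \<in> gen_verts G"
  by (auto simp: terminal_boundary_sets_def minimal_infinite_emitter_def infinite_emitter_def
      minimal_sink_def is_sink_def intro: gen_verts.singleton)

lemma terminal_nonempty: "A \<in> terminal_boundary_sets G \<Longrightarrow> A \<noteq> {}"
  by (auto simp: terminal_boundary_sets_def minimal_infinite_emitter_def infinite_emitter_def
      minimal_sink_def emitted_def)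

lemma terminal_not_regular: "{v} \<in> terminal_boundary_sets G \<Longrightarrow> \<not> is_regular G v"
  by (auto simp: terminal_boundary_sets_def minimal_infinite_emitter_def infinite_emitter_def
      minimal_sink_def emitted_def is_sink_def is_regular_def)

text \<open>Minimality makes \<open>{B. A \<subseteq> B}\<close> a prime filter of \<open>gen_verts G\<close>.\<close>

lemma terminal_prime:
  assumes A: "A \<in> terminal_boundary_sets G" and BC: "B \<in> gen_verts G" "C \<in> gen_verts G"
    and sub: "A \<subseteq> B \<union> C"
  shows "A \<subseteq> B \<or> A \<subseteq> C"
proof (rule ccontr)
  assume "\<not> ?thesis"
  then have p: "A \<inter> B \<subset> A" "A \<inter> C \<subset> A" by auto
  have g: "A \<inter> B \<in> gen_verts G" "A \<inter> C \<in> gen_verts G"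
    using terminal_gen[OF A] BC by (auto intro: gen_verts.inter)
  have eq: "A = (A \<inter> B) \<union> (A \<inter> C)" using sub by auto
  consider "minimal_infinite_emitter G A" | "minimal_sink G A" | v where "A = {v}"
    using A by (auto simp: terminal_boundary_sets_def)
  then show False
  proof cases
    case 1
    then have "finite (emitted G (A \<inter> B))" "finite (emitted G (A \<inter> C))"
      using p g by (auto simp: minimal_infinite_emitter_def infinite_emitter_def)
    moreover have "emitted G A \<subseteq> emitted G (A \<inter> B) \<union> emitted G (A \<inter> C)"
      using sub by (auto simp: emitted_def)
    ultimately show False
      using 1 by (auto simp: minimal_infinite_emitter_def infinite_emitter_def dest: finite_subset)
  next
    case 2
    then have "finite (A \<inter> B)" "finite (A \<inter> C)" using p g by (auto simp: minimal_sink_def)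
    then have "finite A" using eq by (metis finite_Un)
    then show False using 2 by (simp add: minimal_sink_def)
  qed (use p sub in auto)
qed

text \<open>The range of a cyclic edge is a single vertex emitting a single edge, hence
  regular.\<close>

lemma terminal_not_cyclic:
  assumes A: "A \<in> terminal_boundary_sets G" and e: "cyclic_edge G e" and sub: "A \<subseteq> rng G e"
  shows False
proof -
  obtain f where f: "follows G e f" "rng G e = {src G f}" "\<forall>g. follows G e g \<longrightarrow> g = f"
    using cyclic_edge_successor[OF e] by blast
  have "A = {src G f}" using sub f(2) terminal_nonempty[OF A] by auto
  moreover have "{g \<in> edges G. src G g = src G f} = {f}"
    using f by (auto simp: follows_def)
  then have "is_regular G (src G f)" using f src_in by (auto simp: is_regular_def follows_def)
  ultimately show False using terminal_not_regular A by auto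
qed

definition terminal_points :: "'v set \<Rightarrow> 'e list set" where
  "terminal_points A = {\<beta>. \<beta> = [] \<or> is_path G \<beta> \<and> A \<subseteq> path_rng G \<beta>}"

text \<open>The empty path stands for \<open>A\<close> itself as an end point, without choosing a
  vertex of the possibly infinite set \<open>A\<close>. It lies over B when
  \<open>A \<subseteq> B\<close>, and \<open>terminal_prime\<close> makes this compatible with
  unions.\<close>

definition terminal_domain :: "'v set \<Rightarrow> 'v set \<Rightarrow> 'e list set" where
  "terminal_domain A B = {\<beta> \<in> terminal_points A. if \<beta> = [] then A \<subseteq> B else src G (hd \<beta>) \<in> B}"

definition list_pop :: "'e list \<Rightarrow> ('e \<times> 'e list) option" where
  "list_pop \<beta> = (case \<beta> of [] \<Rightarrow> None | e # \<gamma> \<Rightarrow> Some (e, \<gamma>))"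

lemma terminal_points_Cons:
  assumes e: "e \<in> edges G"
  shows "e # \<beta> \<in> terminal_points A \<longleftrightarrow> \<beta> \<in> terminal_domain A (rng G e)"
  using e
  by (cases \<beta>) (auto simp: terminal_points_def terminal_domain_def is_path_Cons is_path_single
      path_rng_def)

text \<open>A cyclic edge on \<beta> would make the last edge cyclic too, which
  \<open>terminal_not_cyclic\<close> forbids. So these are paths off the cycles ending at any fixed
  vertex of \<open>A\<close>.\<close>

lemma finite_terminal_points:
  assumes A: "A \<in> terminal_boundary_sets G"
  shows "finite (terminal_points A)"
proof -
  obtain v where v: "v \<in> A" using terminal_nonempty[OF A] by auto
  have "v \<in> verts G" using gen_verts_sub[OF terminal_gen[OF A]] v by blast
  moreover have "acyclic_path \<beta>" if \<beta>: "\<beta> \<in> terminal_points A" for \<beta>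
    unfolding acyclic_path_def
  proof (intro ballI notI)
    fix e assume e: "e \<in> set \<beta>" "cyclic_edge G e"
    then have p: "is_path G \<beta>" "A \<subseteq> rng G (last \<beta>)"
      using \<beta> by (auto simp: terminal_points_def path_rng_def)
    then have "cyclic_edge G (last \<beta>)"
      using path_follows[OF p(1) e(1)] cyclic_edge_reach e(2) by blast
    then show False using terminal_not_cyclic[OF A] p(2) by blast
  qed
  then have "terminal_points A \<subseteq> {\<alpha>. ends_at G \<alpha> v \<and> acyclic_path \<alpha>}"
    using v by (auto simp: terminal_points_def ends_at_def)
  ultimately show ?thesis using finite_acyclic_paths_vertex finite_subset by blast
qed

lemma terminal_branching_system:
  assumes A: "A \<in> terminal_boundary_sets G"
  shows "branching_system G (terminal_points A) (terminal_domain A) Cons list_pop"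
proof unfold_locales
  show "finite (terminal_points A)" by (rule finite_terminal_points[OF A])
  show "terminal_domain A {} = {}"
    using terminal_nonempty[OF A] by (auto simp: terminal_domain_def)
  fix B C assume B: "B \<in> gen_verts G" and C: "C \<in> gen_verts G"
  show "terminal_domain A (B \<inter> C) = terminal_domain A B \<inter> terminal_domain A C"
    by (auto simp: terminal_domain_def)
  show "terminal_domain A (B \<union> C) = terminal_domain A B \<union> terminal_domain A C"
    using terminal_prime[OF A B C] by (auto simp: terminal_domain_def split: if_splits)
next
  fix e \<beta> assume e: "e \<in> edges G" and "\<beta> \<in> terminal_domain A (rng G e)"
  then show "e # \<beta> \<in> terminal_domain A {src G e}"
    using terminal_points_Cons[OF e] by (auto simp: terminal_domain_def)
next
  fix \<beta> e \<gamma> assume \<beta>: "\<beta> \<in> terminal_points A" "list_pop \<beta> = Some (e, \<gamma>)"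
  then have eq: "\<beta> = e # \<gamma>" by (auto simp: list_pop_def split: list.splits)
  then have e: "e \<in> edges G" using \<beta> by (auto simp: terminal_points_def is_path_def)
  then show "e \<in> edges G \<and> \<gamma> \<in> terminal_domain A (rng G e)"
    using terminal_points_Cons[OF e] \<beta> eq by auto
  show "e # \<gamma> = \<beta>" by (simp add: eq)
next
  \<comment> \<open>The empty path lies over \<open>{v}\<close> only if \<open>A = {v}\<close>, and
    then v is not regular.\<close>
  fix v \<beta> assume "is_regular G v" "\<beta> \<in> terminal_domain A {v}"
  then show "list_pop \<beta> \<noteq> None"
    using terminal_not_regular[of v] A terminal_nonempty[OF A]
    by (cases \<beta>) (auto simp: terminal_domain_def list_pop_def subset_singleton_iff)
qed (auto simp: terminal_domain_def list_pop_def)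

section \<open>Cycles\<close>

text \<open>The paths must be infinite: vertices on a cycle are regular, so
  \<open>pop_regular\<close> requires that an edge can always be popped there.\<close>

definition cycle_streams :: "'e \<Rightarrow> (nat \<Rightarrow> 'e) set" where
  "cycle_streams e = {x. (\<forall>i. follows G (x i) (x (Suc i))) \<and> (\<exists>i. (follows G)\<^sup>*\<^sup>* e (x i))}"

lemma stream_reach:
  assumes "\<forall>i. follows G (x i) (x (Suc i))" "i \<le> j"
  shows "(follows G)\<^sup>*\<^sup>* (x i) (x j)"
  using assms(2)
proof (induction j rule: dec_induct)
  case (step j)
  then show ?case using assms(1) rtranclp.rtrancl_into_rtrancl by metis
qed simp

lemma stream_path:
  assumes "\<forall>i. follows G (x i) (x (Suc i))"
  shows "is_path G (map x [0..<Suc n])"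
proof -
  have "x i \<in> edges G" "src G (x (Suc i)) \<in> rng G (x i)" for i
    using assms by (simp_all add: follows_def)
  then show ?thesis by (auto simp: is_path_def simp del: upt_Suc)
qed

text \<open>A stream is determined by the finite word up to its first edge reachable from \<open>e\<close>: from
  there on it runs around the cycle.\<close>

lemma finite_cycle_streams:
  assumes e: "cyclic_edge G e"
  shows "finite (cycle_streams e)"
proof -
  define n :: "(nat \<Rightarrow> 'e) \<Rightarrow> nat" where "n x = (LEAST i. (follows G)\<^sup>*\<^sup>* e (x i))" for x
  define w where "w x = map x [0..<n x] @ [x (n x)]" for x
  let ?O = "{f. (follows G)\<^sup>*\<^sup>* e f}"
  let ?Q = "\<lambda>f. {\<alpha>. ends_at G \<alpha> (src G f) \<and> acyclic_path \<alpha>}"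
  have reach: "(follows G)\<^sup>*\<^sup>* e (x (n x))" if "x \<in> cycle_streams e" for x
    using that unfolding n_def cycle_streams_def by (auto intro: LeastI)
  have acyclic: "\<not> cyclic_edge G (x j)" if x: "x \<in> cycle_streams e" and j: "j < n x" for x j
  proof
    assume "cyclic_edge G (x j)"
    moreover have "(follows G)\<^sup>*\<^sup>* (x j) (x (n x))"
      using x j by (intro stream_reach) (auto simp: cycle_streams_def)
    ultimately have "(follows G)\<^sup>*\<^sup>* (x (n x)) (x j)" using cyclic_edge_reach by blast
    with reach[OF x] have "(follows G)\<^sup>*\<^sup>* e (x j)" by (rule rtranclp_trans)
    then have "n x \<le> j" unfolding n_def by (rule Least_le)
    with j show False by simp
  qed
  have "w ` cycle_streams e \<subseteq> (\<Union>f\<in>?O. (\<lambda>\<alpha>. \<alpha> @ [f]) ` ?Q f)"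
  proof
    fix u assume "u \<in> w ` cycle_streams e"
    then obtain x where x: "x \<in> cycle_streams e" "u = map x [0..<n x] @ [x (n x)]"
      by (auto simp: w_def)
    have "acyclic_path (map x [0..<n x])"
      using acyclic[OF x(1)] by (auto simp: acyclic_path_def)
    moreover have "ends_at G (map x [0..<n x]) (src G (x (n x)))"
    proof (cases "n x")
      case (Suc m)
      have s: "\<forall>i. follows G (x i) (x (Suc i))" using x by (simp add: cycle_streams_def)
      with stream_path[OF s, of m] show ?thesis
        by (simp add: Suc ends_at_def path_rng_def follows_def)
    qed (simp add: ends_at_def)
    ultimately show "u \<in> (\<Union>f\<in>?O. (\<lambda>\<alpha>. \<alpha> @ [f]) ` ?Q f)"
      using reach[OF x(1)] x(2) by blast
  qed
  moreover have "finite (\<Union>f\<in>?O. (\<lambda>\<alpha>. \<alpha> @ [f]) ` ?Q f)"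
  proof (intro finite_UN_I finite_imageI finite_acyclic_paths_vertex)
    show "finite ?O" by (rule finite_reach[OF e])
    fix f assume "f \<in> ?O"
    then have "cyclic_edge G f" using cyclic_edge_reach[OF _ e] by simp
    then show "src G f \<in> verts G"
      using cyclic_edge_successor[of f] src_in by (auto simp: follows_def)
  qed
  moreover have "inj_on w (cycle_streams e)"
  proof
    fix x y assume x: "x \<in> cycle_streams e" and y: "y \<in> cycle_streams e" and eq: "w x = w y"
    have n: "n x = n y" using arg_cong[OF eq, of length] by (simp add: w_def)
    have nth: "w z ! i = z i" if "i \<le> n z" for z i
      using that by (auto simp: w_def nth_append)
    have "x i = y i" for i
    proof (induction i)
      case 0
      show ?case using nth[of 0 x] nth[of 0 y] eq by simp
    next
      case (Suc i)
      show ?case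
      proof (cases "i < n x")
        case True
        then show ?thesis using nth[of "Suc i" x] nth[of "Suc i" y] eq n by simp
      next
        case False
        then have "(follows G)\<^sup>*\<^sup>* (x (n x)) (x i)"
          using x by (intro stream_reach) (auto simp: cycle_streams_def)
        with reach[OF x] have "(follows G)\<^sup>*\<^sup>* e (x i)" by (rule rtranclp_trans)
        then have "cyclic_edge G (x i)" using cyclic_edge_reach e by blast
        moreover have "follows G (x i) (x (Suc i))" "follows G (y i) (y (Suc i))"
          using x y by (simp_all add: cycle_streams_def)
        ultimately show ?thesis using cyclic_edge_unique[of "x i"] Suc by simp
      qed
    qed
    then show "x = y" by auto
  qed
  ultimately show ?thesis using finite_imageD finite_subset by blast
qed

definition cycle_points :: "'e \<Rightarrow> nat \<Rightarrow> ((nat \<Rightarrow> 'e) \<times> nat) set" where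
  "cycle_points e M = cycle_streams e \<times> {..<M}"

definition cycle_domain :: "'e \<Rightarrow> nat \<Rightarrow> 'v set \<Rightarrow> ((nat \<Rightarrow> 'e) \<times> nat) set" where
  "cycle_domain e M A = {p \<in> cycle_points e M. src G (fst p 0) \<in> A}"

text \<open>The stream alone cannot tell how often a path winds around the cycle; the second component
  counts its edges modulo \<open>M\<close>.\<close>

definition cycle_push :: "nat \<Rightarrow> 'e \<Rightarrow> (nat \<Rightarrow> 'e) \<times> nat \<Rightarrow> (nat \<Rightarrow> 'e) \<times> nat" where
  "cycle_push M f p = (case_nat f (fst p), Suc (snd p) mod M)"

text \<open>Every stream has a first edge, so popping never fails. Adding \<open>M\<close> before
  subtracting avoids truncation at residue 0.\<close>

definition cycle_pop :: "nat \<Rightarrow> (nat \<Rightarrow> 'e) \<times> nat \<Rightarrow> ('e \<times> (nat \<Rightarrow> 'e) \<times> nat) option" where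
  "cycle_pop M p = Some (fst p 0, (\<lambda>i. fst p (Suc i)), (snd p + M - 1) mod M)"

lemma Suc_mod_pred: "k < M \<Longrightarrow> (Suc k mod M + M - Suc 0) mod M = k"
proof (cases "Suc k = M")
  case False
  moreover assume "k < M"
  ultimately have "Suc k < M" by simp
  then show ?thesis by simp
qed auto

lemma pred_mod_Suc: "k < M \<Longrightarrow> Suc ((k + M - Suc 0) mod M) mod M = k"
  by (cases k) simp_all

lemma cycle_branching_system:
  assumes e: "cyclic_edge G e" and M: "0 < M"
  shows "branching_system G (cycle_points e M) (cycle_domain e M) (cycle_push M) (cycle_pop M)"
proof unfold_locales
  show "finite (cycle_points e M)"
    using finite_cycle_streams[OF e] by (simp add: cycle_points_def)
next
  fix f p assume f: "f \<in> edges G" and p: "p \<in> cycle_domain e M (rng G f)"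
  have "follows G f (fst p 0)"
    using f p by (auto simp: follows_def cycle_domain_def cycle_points_def cycle_streams_def)
  then have "case_nat f (fst p) \<in> cycle_streams e"
    using p by (auto simp: cycle_domain_def cycle_points_def cycle_streams_def split: nat.splits)
  then show "cycle_push M f p \<in> cycle_domain e M {src G f}"
    using M by (auto simp: cycle_domain_def cycle_points_def cycle_push_def)
  show "cycle_pop M (cycle_push M f p) = Some (f, p)"
    using p by (auto simp: cycle_pop_def cycle_push_def cycle_domain_def cycle_points_def Suc_mod_pred)
next
  fix p f q assume p: "p \<in> cycle_points e M" and q: "cycle_pop M p = Some (f, q)"
  obtain x k where xk: "p = (x, k)" by (cases p)
  have k: "k < M" and f: "f = x 0" and q: "q = (\<lambda>i. x (Suc i), (k + M - 1) mod M)"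
    and x: "\<forall>i. follows G (x i) (x (Suc i))"
    using p q by (auto simp: xk cycle_points_def cycle_pop_def cycle_streams_def)
  obtain i where i: "(follows G)\<^sup>*\<^sup>* e (x i)"
    using p by (auto simp: xk cycle_points_def cycle_streams_def)
  have "(follows G)\<^sup>*\<^sup>* e (x (Suc i))" using i x[rule_format, of i] by (rule rtranclp.rtrancl_into_rtrancl)
  then have "(\<lambda>i. x (Suc i)) \<in> cycle_streams e" using x by (auto simp: cycle_streams_def)
  then show "f \<in> edges G \<and> q \<in> cycle_domain e M (rng G f)"
    using M x[rule_format, of 0] by (auto simp: f q cycle_domain_def cycle_points_def follows_def)
  have "case_nat (x 0) (\<lambda>i. x (Suc i)) = x" by (auto split: nat.splits)
  then show "cycle_push M f q = p"
    using k by (simp add: xk f q cycle_push_def pred_mod_Suc)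
qed (auto simp: cycle_domain_def cycle_pop_def)

text \<open>The empty list is set apart because k itself need not be reduced modulo
  \<open>M\<close>.\<close>

lemma foldr_cycle_push:
  "foldr (cycle_push M) \<alpha> (x, k)
    = (\<lambda>i. if i < length \<alpha> then \<alpha> ! i else x (i - length \<alpha>), if \<alpha> = [] then k else (k + length \<alpha>) mod M)"
proof (induction \<alpha>)
  case (Cons e \<alpha>)
  then show ?case
    by (auto simp: cycle_push_def fun_eq_iff mod_Suc_eq split: nat.splits)
qed simp

text \<open>Below \<open>M\<close> the counter is the length itself, and the length tells which
  entries of the stream are the letters of \<alpha>.\<close>

lemma inj_on_cycle_push: "inj_on (\<lambda>\<alpha>. foldr (cycle_push M) \<alpha> (x, 0)) {\<alpha>. length \<alpha> < M}"
proof
  fix \<alpha> \<beta> assume "\<alpha> \<in> {\<alpha>. length \<alpha> < M}" "\<beta> \<in> {\<alpha>. length \<alpha> < M}"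
    and eq: "foldr (cycle_push M) \<alpha> (x, 0) = foldr (cycle_push M) \<beta> (x, 0)"
  then have len: "length \<alpha> = length \<beta>"
    by (auto simp: foldr_cycle_push split: if_splits)
  have "\<alpha> ! i = \<beta> ! i" if "i < length \<alpha>" for i
    using fun_cong[OF arg_cong[OF eq, of fst], of i] that len by (simp add: foldr_cycle_push)
  with len show "\<alpha> = \<beta>" by (intro nth_equalityI) auto
qed

text \<open>The stream is obtained by iterating the successor of an edge around the cycle.\<close>

lemma on_cycle_stream:
  assumes "on_cycle G v"
  obtains e x where "cyclic_edge G e" "x \<in> cycle_streams e" "src G (x 0) = v"
proof -
  obtain e where e: "cyclic_edge G e" "src G e = v"
    using assms cycle_cyclic_edge unfolding on_cycle_def by (metis imageE)
  define s where "s = (\<lambda>e. SOME f. follows G e f)"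
  have s: "follows G f (s f)" if "cyclic_edge G f" for f
    using cyclic_edge_successor[OF that] unfolding s_def by (metis someI)
  have "cyclic_edge G ((s ^^ i) e)" for i
    by (induction i) (use e s cyclic_edge_step in auto)
  then have "(\<lambda>i. (s ^^ i) e) \<in> cycle_streams e"
    using s by (auto simp: cycle_streams_def intro: exI[of _ 0])
  with that e show ?thesis by fastforce
qed

section \<open>Residual finite-dimensionality\<close>

text \<open>A path \<gamma> from v into \<open>A\<close>, empty if \<open>A = {v}\<close>, serves as
  base point; distinct \<alpha> give distinct lists \<open>\<alpha> @ \<gamma>\<close>.\<close>

lemma terminal_detecting:
  fixes l :: "'e list \<Rightarrow> 'k::field"
  assumes v: "v \<in> verts G" "reaches_terminal G v" and P: "finite P" "\<forall>\<alpha>\<in>P. ends_at G \<alpha> v"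
    and \<alpha>: "\<alpha> \<in> P" "l \<alpha> \<noteq> 0"
  shows "has_detecting_representation G
    (\<Sum>\<alpha>\<in>P. pm_scale (l \<alpha>) (path_elem \<alpha> * gen_elem (Proj {v})))"
proof -
  obtain A \<gamma> where A: "A \<in> terminal_boundary_sets G" and \<gamma>: "\<gamma> \<in> terminal_domain A {v}"
  proof (cases "{v} \<in> terminal_boundary_sets G")
    case True
    moreover have "[] \<in> terminal_domain {v} {v}"
      by (simp add: terminal_domain_def terminal_points_def)
    ultimately show ?thesis using that by blast
  next
    case False
    then obtain \<gamma> A where "is_path G \<gamma>" "path_src G \<gamma> = v" "A \<in> terminal_boundary_sets G"
      "A \<subseteq> path_rng G \<gamma>" using v by (auto simp: reaches_terminal_def)
    moreover from this have "\<gamma> \<in> terminal_domain A {v}"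
      by (auto simp: terminal_domain_def terminal_points_def path_src_def is_path_def)
    ultimately show ?thesis using that by blast
  qed
  interpret branching_system G "terminal_points A" "terminal_domain A" Cons list_pop
    by (rule terminal_branching_system[OF A])
  show ?thesis
    using v(1) \<gamma> P \<alpha> by (intro separating_representation[where x = \<gamma>])
      (auto simp: foldr_Cons_append inj_on_def)
qed

lemma cycle_detecting:
  fixes l :: "'e list \<Rightarrow> 'k::field"
  assumes v: "v \<in> verts G" "reaches_cycle G v" and P: "finite P" "\<forall>\<alpha>\<in>P. ends_at G \<alpha> v"
    and \<alpha>: "\<alpha> \<in> P" "l \<alpha> \<noteq> 0"
  shows "has_detecting_representation G
    (\<Sum>\<alpha>\<in>P. pm_scale (l \<alpha>) (path_elem \<alpha> * gen_elem (Proj {v})))"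
proof -
  obtain \<gamma> w where w: "on_cycle G w" and \<gamma>: "\<gamma> = [] \<and> w = v
      \<or> is_path G \<gamma> \<and> path_src G \<gamma> = v \<and> w \<in> path_rng G \<gamma>"
    using v(2) unfolding reaches_cycle_def by blast
  obtain e x where e: "cyclic_edge G e" and x: "x \<in> cycle_streams e" "src G (x 0) = w"
    using on_cycle_stream[OF w] .
  have wv: "w \<in> verts G" using x src_in by (auto simp: cycle_streams_def follows_def)
  obtain m where m: "\<And>\<alpha>. \<alpha> \<in> P \<Longrightarrow> length \<alpha> < m"
    using finite_imageI[OF P(1), of length] finite_nat_set_iff_bounded by (metis image_eqI)
  \<comment> \<open>Every list \<open>\<alpha> @ \<gamma>\<close> with \<alpha> in \<open>P\<close>
    is shorter than this \<open>M\<close>, as \<open>inj_on_cycle_push\<close> requires.\<close>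
  define M where "M = m + length \<gamma> + 1"
  interpret branching_system G "cycle_points e M" "cycle_domain e M" "cycle_push M" "cycle_pop M"
    by (rule cycle_branching_system[OF e]) (simp add: M_def)
  have x0: "(x, 0) \<in> cycle_domain e M {w}"
    using x by (simp add: cycle_domain_def cycle_points_def M_def)
  let ?x = "foldr (cycle_push M) \<gamma> (x, 0)"
  have "?x \<in> cycle_domain e M {v}"
    using \<gamma> x0 foldr_push(1)[of \<gamma> "{w}" "(x, 0)"] gen_verts.singleton[OF wv] by auto
  moreover have "inj_on (\<lambda>\<alpha>. foldr (cycle_push M) \<alpha> ?x) P"
  proof
    fix \<alpha> \<beta> assume "\<alpha> \<in> P" "\<beta> \<in> P"
      and eq: "foldr (cycle_push M) \<alpha> ?x = foldr (cycle_push M) \<beta> ?x"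
    then have "\<alpha> @ \<gamma> \<in> {\<alpha>. length \<alpha> < M}" "\<beta> @ \<gamma> \<in> {\<alpha>. length \<alpha> < M}"
      using m by (auto simp: M_def less_Suc_eq)
    from inj_onD[OF inj_on_cycle_push _ this, of x] eq show "\<alpha> = \<beta>" by simp
  qed
  ultimately show ?thesis
    using v(1) P \<alpha> by (intro separating_representation[where x = ?x])
qed

end

lemma two_sided_ideal_Inter:
  assumes "S \<noteq> {}" "\<And>I. I \<in> S \<Longrightarrow> two_sided_ideal A I"
  shows "two_sided_ideal A (\<Inter>S)"
proof -
  obtain I where I: "I \<in> S" using assms(1) by auto
  have "\<Inter>S \<subseteq> acarrier A"
    using assms(2)[OF I] I by (auto simp: two_sided_ideal_def)
  moreover note ideal = assms(2)[unfolded two_sided_ideal_def]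
  have "azero A \<in> \<Inter>S" using ideal by simp
  moreover have "aadd A x y \<in> \<Inter>S" if "x \<in> \<Inter>S" "y \<in> \<Inter>S" for x y
    using that ideal by simp
  moreover have "ascale A c x \<in> \<Inter>S" if "x \<in> \<Inter>S" for x c
    using that ideal by simp
  moreover have "amult A a x \<in> \<Inter>S \<and> amult A x a \<in> \<Inter>S" if "x \<in> \<Inter>S" "a \<in> acarrier A" for a x
    using that ideal by simp
  ultimately show ?thesis by (simp add: two_sided_ideal_def)
qed

lemma fin_dim_endomorphism_algebra:
  fixes V :: "('a \<Rightarrow>\<^sub>0 'k::field) set"
  assumes "vector_space.fin_dim_subspace pm_scale V"
  shows "kalgebra (vector_space.endomorphism_algebra pm_scale V)"
proof -
  interpret vector_space "pm_scale :: 'k \<Rightarrow> ('a \<Rightarrow>\<^sub>0 'k) \<Rightarrow> _" by (rule vector_space_pm_scale)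
  show ?thesis
    using assms by (intro kalgebra_endomorphism_algebra) (simp add: fin_dim_subspace_def)
qed

theorem theorem6p1:
  fixes G :: "('v, 'e) ultragraph"
  assumes "ultragraph G"
    and "no_infinite_receivers G"
    and "no_cycle_has_exit G"
    and "no_infinite_backward_chains G"
    and "every_vertex_reaches_terminal_or_cycle G"
  shows "residually_finite_dimensional
    (leavitt_path_algebra G ::
      ('k::field, (('v, 'e) leavitt_gen free_monoid \<Rightarrow>\<^sub>0 'k) set) kalgebra)"
proof -
  interpret rfd_ultragraph G
    using assms by (simp add: rfd_ultragraph_def rfd_ultragraph_axioms_def)
  let ?A = "free_algebra (leavitt_gens G) :: ('k, ('v, 'e) leavitt_gen free_monoid \<Rightarrow>\<^sub>0 'k) kalgebra"
  define J where "J = ideal_generated ?A (leavitt_relations G)"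
  define N where "N = {f \<in> acarrier ?A. \<not> has_detecting_representation G f}"
  have A: "kalgebra ?A" by (rule kalgebra_free_algebra)
  have relations: "leavitt_relations G \<subseteq> acarrier ?A"
    by (rule leavitt_relations_subset[OF assms(1)])
  have L: "leavitt_path_algebra G = quotient_algebra ?A J"
    by (simp add: leavitt_path_algebra_def J_def)
  have J: "two_sided_ideal ?A J"
    unfolding J_def by (rule kalgebra.two_sided_ideal_generated[OF A relations])
  have coset: "alg_coset ?A J \<in> kalgebra_hom ?A (leavitt_path_algebra G)"
    unfolding L by (rule alg_coset_hom[OF A J])
  \<comment> \<open>Collecting the representations in a set exhibits \<open>N\<close> as an
    intersection of kernels, and so as an ideal.\<close>
  define reps where "reps = {(V :: (nat \<Rightarrow>\<^sub>0 'k) set, \<rho>).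
    vector_space.fin_dim_subspace pm_scale V \<and>
    \<rho> \<in> kalgebra_hom (leavitt_path_algebra G) (vector_space.endomorphism_algebra pm_scale V)}"
  define ker where "ker = (\<lambda>(V :: (nat \<Rightarrow>\<^sub>0 'k) set, \<rho>). {f \<in> acarrier ?A.
    (\<rho> \<circ> alg_coset ?A J) f = azero (vector_space.endomorphism_algebra pm_scale V)})"
  have ker: "two_sided_ideal ?A (ker r)" if "r \<in> reps" for r
    using that unfolding ker_def reps_def
    by (auto intro!: two_sided_ideal_kernel[OF A, unfolded comp_def]
        two_sided_ideal_kernel[OF A _ kalgebra_hom_comp[OF coset], unfolded comp_def]
        fin_dim_endomorphism_algebra)
  \<comment> \<open>Adding the whole carrier keeps the family nonempty without exhibiting a
    representation.\<close>
  have "two_sided_ideal ?A (acarrier ?A)" by (rule kalgebra.two_sided_ideal_carrier[OF A])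
  then have "two_sided_ideal ?A (\<Inter>(insert (acarrier ?A) (ker ` reps)))"
    using ker by (intro two_sided_ideal_Inter) auto
  also have "\<Inter>(insert (acarrier ?A) (ker ` reps)) = N"
    by (auto simp: N_def ker_def reps_def has_detecting_representation_def J_def)
  finally have N: "two_sided_ideal ?A N" .
  have coset_J: "alg_coset ?A J f = alg_coset ?A J (azero ?A)" if "f \<in> J" for f
  proof -
    have "aadd ?A (azero ?A) f = f" by (simp add: free_algebra_def)
    then show ?thesis
      using kalgebra.coset_absorb[OF A J kalgebra.zero_closed[OF A] that] by simp
  qed
  have J_N: "J \<subseteq> N"
  proof
    fix f assume f: "f \<in> J"
    have fA: "f \<in> acarrier ?A"
      using J f by (auto simp: two_sided_ideal_def)
    have "alg_coset ?A J f = alg_coset ?A J (azero ?A)" by (rule coset_J[OF f])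
    then have "\<rho> (alg_coset ?A J f) = azero (vector_space.endomorphism_algebra pm_scale V)"
      if "(V, \<rho>) \<in> reps" for V \<rho>
      using that kalgebra_hom_azero[OF A _ kalgebra_hom_comp[OF coset]]
        fin_dim_endomorphism_algebra by (auto simp: reps_def)
    then show "f \<in> N"
      using fA by (auto simp: N_def has_detecting_representation_def reps_def J_def)
  qed
  interpret separating_ideal G J N
  proof unfold_locales
    show "leavitt_relations G \<subseteq> J" by (auto simp: J_def ideal_generated_def)
    fix v P \<alpha> and l :: "'e list \<Rightarrow> 'k"
    assume "v \<in> verts G" "finite P" "\<forall>\<alpha>\<in>P. ends_at G \<alpha> v" "\<alpha> \<in> P"
      and "(\<Sum>\<alpha>\<in>P. pm_scale (l \<alpha>) (path_elem \<alpha> * gen_elem (Proj {v}))) \<in> N"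
    then show "l \<alpha> = 0"
      using reaches terminal_detecting[of v P \<alpha> l] cycle_detecting[of v P \<alpha> l]
      by (auto simp: every_vertex_reaches_terminal_or_cycle_def N_def)
  qed (rule J N J_N)+
  show ?thesis
    unfolding residually_finite_dimensional_def
  proof (intro ballI impI)
    fix a :: "(('v, 'e) leavitt_gen free_monoid \<Rightarrow>\<^sub>0 'k) set"
    assume a: "a \<in> acarrier (leavitt_path_algebra G)" "a \<noteq> azero (leavitt_path_algebra G)"
    then obtain f where f: "f \<in> acarrier ?A" "a = alg_coset ?A J f"
      by (auto simp: L quotient_algebra_def)
    have "f \<notin> J"
      using coset_J[of f] a(2) f(2) by (auto simp: L quotient_algebra_def)
    then have "has_detecting_representation G f" using N_sub_J f by (auto simp: N_def)
    then show "\<exists>(V :: (nat \<Rightarrow>\<^sub>0 'k) set) \<pi>. vector_space.fin_dim_subspace pm_scale V \<and>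
        \<pi> \<in> kalgebra_hom (leavitt_path_algebra G)
          (vector_space.endomorphism_algebra pm_scale V) \<and>
        \<pi> a \<noteq> azero (vector_space.endomorphism_algebra pm_scale V)"
      by (simp add: has_detecting_representation_def f J_def)
  qed
qed

end
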